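(* Let $q\ge 1$, $b,c,d\in L^\infty(Q)$, $0<t_0<T$, and let $M_1>0$ be an arbitrarily fixed constant. Let $u,v\in L^2\left(0,T;H^2_{\frac1a}(0,1)\right)\cap H^1\left(0,T;H^1_{\frac1a}(0,1)\right)$ both satisfy (with the same $G$) the equation $$w_t-a(x)w_{xx}+\frac{b(x,t)}{q}|w_x|^q+d(x,t)w_x+c(x,t)w=G(x,t)\ \text{ in }Q,\qquad w=0\ \text{ on }\Sigma$$ (for $w=u$ and for $w=v$), and $$\|u(\cdot,0)\|_{1,\frac1a}\le M_1,\qquad \|v(\cdot,0)\|_{1,\frac1a}\le M_1 .$$ Assume one of the following: Case 1: there exist constants $C_0,K>0$ such that $$|b(x,t)|+|d(x,t)|\le C_0\sqrt{a(x)},\qquad \|u_x\|_{L^\infty(Q)}\le K,\qquad \|v_x\|_{L^\infty(Q)}\le K;$$ Case 2: $b\in L^\infty(Q)$ and there exist constants $C_0,K>0$ such that $$\left\|\frac{|u_x|^{q-1}}{\sqrt a}\right\|_{L^\infty(Q)}\le K,\qquad \left\|\frac{|v_x|^{q-1}}{\sqrt a}\right\|_{L^\infty(Q)}\le K,\qquad |d(x,t)|\le C_0\sqrt{a(x)}.$$ Then there exist constants $C>0$ and $\theta\in(0,1)$, depending on $t_0$ and $M_1$ (and on the fixed data $T,a,b,c,d,q,C_0,K$, but not otherwise on $u,v$), such that $$\|u(\cdot,t_0)-v(\cdot,t_0)\|_{\frac1a}\le C\left(\|u(\cdot,T)-v(\cdot,T)\|_{1,\frac1a}^{\theta}+\|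u(\cdot,T)-v(\cdot,T)\|_{1,\frac1a}\right).$$
   Context: $T>0$, $\Omega=(0,1)$, $Q=\Omega\times(0,T)$, $\Sigma=\{0,1\}\times(0,T)$. The coefficient $a\in C([0,1])$ satisfies $a(x)>0$ for all $x\in(0,1)$ and $a(0)=a(1)=0$. $G$ is a given function on $Q$. Weighted spaces: $L^2_{\frac1a}(0,1)=\{u\in L^2(0,1): \|u\|_{\frac1a}<\infty\}$ with $\|u\|_{\frac1a}^2=\int_0^1\frac{u^2}{a}\,dx$; $H^1_{\frac1a}(0,1)=L^2_{\frac1a}(0,1)\cap H^1_0(0,1)$ with $\|u\|_{1,\frac1a}^2=\|u\|_{\frac1a}^2+\|u_x\|_{L^2(0,1)}^2$; $H^2_{\frac1a}(0,1)=\{u\in H^1_{\frac1a}(0,1): a u_{xx}\in L^2_{\frac1a}(0,1)\}$ with $\|u\|_{2,\frac1a}^2=\|u\|_{1,\frac1a}^2+\int_0^1 a u_{xx}^2\,dx$. The bounds on $b,d$ are understood for almost every $(x,t)\in Q$. *)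

theory Defs
  imports "HOL-Analysis.Analysis" "HOL-Probability.Essential_Supremum"
begin

text \<open>
  Elements of the function spaces below are represented by functions, not by equivalence classes;
  all norms depend only on the class, and on these spaces they are seminorms.
  A function of space and time is a function on pairs \<open>(x, t)\<close>.
\<close>

abbreviation (input) \<Omega> :: "real set" where
  "\<Omega> \<equiv> {0<..<1}"

definition Q :: "real \<Rightarrow> (real \<times> real) set" where
  "Q T = \<Omega> \<times> {0<..<T}"

definition at_time :: "(real \<times> real \<Rightarrow> real) \<Rightarrow> real \<Rightarrow> real \<Rightarrow> real" where
  "at_time u t = (\<lambda>x. u (x, t))"

text \<open>With \<open>s ^ 0 = 1\<close> also for \<open>s = 0\<close>, whereas \<open>0 powr 0 = 0\<close>.\<close>

definition rpow :: "real \<Rightarrow> real \<Rightarrow> real" where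
  "rpow s p = (if p = 0 then 1 else s powr p)"


section \<open>Sobolev spaces on the unit interval\<close>

definition test_function :: "real set \<Rightarrow> (real \<Rightarrow> real) \<Rightarrow> bool" where
  "test_function S \<phi> \<longleftrightarrow>
     (\<forall>k x. ((deriv ^^ k) \<phi>) field_differentiable (at x)) \<and>
     compact (closure {x. \<phi> x \<noteq> 0}) \<and> closure {x. \<phi> x \<noteq> 0} \<subseteq> S"

definition L1_loc :: "(real \<Rightarrow> real) set" where
  "L1_loc = {u. \<forall>K. compact K \<and> K \<subseteq> \<Omega> \<longrightarrow> u absolutely_integrable_on K}"

definition has_weak_deriv :: "(real \<Rightarrow> real) \<Rightarrow> (real \<Rightarrow> real) \<Rightarrow> bool" where
  "has_weak_deriv u g \<longleftrightarrow> u \<in> L1_loc \<and> g \<in> L1_loc \<and>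
     (\<forall>\<phi>. test_function \<Omega> \<phi> \<longrightarrow>
        (LINT x|lebesgue_on \<Omega>. u x * deriv \<phi> x) = - (LINT x|lebesgue_on \<Omega>. g x * \<phi> x))"

text \<open>Unique up to a null subset of \<open>\<Omega>\<close>, if it exists.\<close>

definition weak_deriv :: "(real \<Rightarrow> real) \<Rightarrow> real \<Rightarrow> real" where
  "weak_deriv u = (SOME g. has_weak_deriv u g)"

definition L2 :: "(real \<Rightarrow> real) set" where
  "L2 = {u. u \<in> borel_measurable (lebesgue_on \<Omega>) \<and> integrable (lebesgue_on \<Omega>) (\<lambda>x. (u x)\<^sup>2)}"

definition norm_L2 :: "(real \<Rightarrow> real) \<Rightarrow> real" where
  "norm_L2 u = sqrt (LINT x|lebesgue_on \<Omega>. (u x)\<^sup>2)"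

definition H1 :: "(real \<Rightarrow> real) set" where
  "H1 = {u \<in> L2. \<exists>g\<in>L2. has_weak_deriv u g}"

text \<open>The closure of the test functions in the norm of \<open>H1\<close>.\<close>

definition H10 :: "(real \<Rightarrow> real) set" where
  "H10 = {u \<in> H1. \<exists>\<phi>. (\<forall>n. test_function \<Omega> (\<phi> n)) \<and>
     (\<lambda>n. norm_L2 (\<lambda>x. \<phi> n x - u x)) \<longlonglongrightarrow> 0 \<and>
     (\<lambda>n. norm_L2 (\<lambda>x. deriv (\<phi> n) x - weak_deriv u x)) \<longlonglongrightarrow> 0}"

definition L2w :: "(real \<Rightarrow> real) \<Rightarrow> (real \<Rightarrow> real) set" where
  "L2w a = {u \<in> L2. integrable (lebesgue_on \<Omega>) (\<lambda>x. (u x)\<^sup>2 / a x)}"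

definition norm_L2w :: "(real \<Rightarrow> real) \<Rightarrow> (real \<Rightarrow> real) \<Rightarrow> real" where
  "norm_L2w a u = sqrt (LINT x|lebesgue_on \<Omega>. (u x)\<^sup>2 / a x)"

definition H1w :: "(real \<Rightarrow> real) \<Rightarrow> (real \<Rightarrow> real) set" where
  "H1w a = L2w a \<inter> H10"

definition norm_H1w :: "(real \<Rightarrow> real) \<Rightarrow> (real \<Rightarrow> real) \<Rightarrow> real" where
  "norm_H1w a u = sqrt ((norm_L2w a u)\<^sup>2 + (norm_L2 (weak_deriv u))\<^sup>2)"

definition H2w :: "(real \<Rightarrow> real) \<Rightarrow> (real \<Rightarrow> real) set" where
  "H2w a = {u \<in> H1w a. \<exists>g. has_weak_deriv (weak_deriv u) g \<and> (\<lambda>x. a x * g x) \<in> L2w a}"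

definition norm_H2w :: "(real \<Rightarrow> real) \<Rightarrow> (real \<Rightarrow> real) \<Rightarrow> real" where
  "norm_H2w a u = sqrt ((norm_H1w a u)\<^sup>2 +
     (LINT x|lebesgue_on \<Omega>. a x * (weak_deriv (weak_deriv u) x)\<^sup>2))"


section \<open>Bochner spaces on a time interval\<close>

text \<open>
  The values are taken in a set \<open>X\<close> of functions with seminorm \<open>N\<close>. The definitions follow
  those of \<open>has_bochner_integral\<close>, which is not applicable because it needs \<open>X\<close> to be a type
  of class \<open>banach\<close>.
\<close>

definition simple_into :: "real \<Rightarrow> (real \<Rightarrow> real) set \<Rightarrow> (real \<Rightarrow> real \<Rightarrow> real) \<Rightarrow> bool" where
  "simple_into T X s \<longleftrightarrow>
     simple_function (lebesgue_on {0<..<T}) s \<and> (\<forall>t\<in>{0<..<T}. s t \<in> X)"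

definition simple_integral_into :: "real \<Rightarrow> (real \<Rightarrow> real \<Rightarrow> real) \<Rightarrow> real \<Rightarrow> real" where
  "simple_integral_into T s =
     (\<lambda>x. \<Sum>w\<in>s ` {0<..<T}. measure lebesgue {t\<in>{0<..<T}. s t = w} * w x)"

definition strongly_measurable ::
  "real \<Rightarrow> (real \<Rightarrow> real) set \<Rightarrow> ((real \<Rightarrow> real) \<Rightarrow> real) \<Rightarrow> (real \<Rightarrow> real \<Rightarrow> real) \<Rightarrow> bool" where
  "strongly_measurable T X N f \<longleftrightarrow> (\<exists>s. (\<forall>n. simple_into T X (s n)) \<and>
     (AE t in lebesgue_on {0<..<T}. f t \<in> X \<and> (\<lambda>n. N (\<lambda>x. f t x - s n t x)) \<longlonglongrightarrow> 0))"

definition has_integral_into ::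
  "real \<Rightarrow> (real \<Rightarrow> real) set \<Rightarrow> ((real \<Rightarrow> real) \<Rightarrow> real) \<Rightarrow> (real \<Rightarrow> real \<Rightarrow> real) \<Rightarrow>
     (real \<Rightarrow> real) \<Rightarrow> bool" where
  "has_integral_into T X N f I \<longleftrightarrow> strongly_measurable T X N f \<and> I \<in> X \<and>
     (\<exists>s. (\<forall>n. simple_into T X (s n)) \<and>
       (\<lambda>n. \<integral>\<^sup>+ t. ennreal (N (\<lambda>x. f t x - s n t x)) \<partial>lebesgue_on {0<..<T}) \<longlonglongrightarrow> 0 \<and>
       (\<lambda>n. N (\<lambda>x. simple_integral_into T (s n) x - I x)) \<longlonglongrightarrow> 0)"

definition L2_time ::
  "real \<Rightarrow> (real \<Rightarrow> real) set \<Rightarrow> ((real \<Rightarrow> real) \<Rightarrow> real) \<Rightarrow> (real \<Rightarrow> real \<Rightarrow> real) set" where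
  "L2_time T X N = {f. strongly_measurable T X N f \<and>
     integrable (lebesgue_on {0<..<T}) (\<lambda>t. (N (f t))\<^sup>2)}"

text \<open>The two integrals need only agree as classes, and an integral is determined only up to
  seminorm \<open>0\<close>, so that a common value \<open>I\<close> can be used.\<close>

definition has_time_deriv ::
  "real \<Rightarrow> (real \<Rightarrow> real) set \<Rightarrow> ((real \<Rightarrow> real) \<Rightarrow> real) \<Rightarrow> (real \<Rightarrow> real \<Rightarrow> real) \<Rightarrow>
     (real \<Rightarrow> real \<Rightarrow> real) \<Rightarrow> bool" where
  "has_time_deriv T X N f f' \<longleftrightarrow> (\<forall>\<phi>. test_function {0<..<T} \<phi> \<longrightarrow>
     (\<exists>I. has_integral_into T X N (\<lambda>t x. deriv \<phi> t * f t x) I \<and>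
          has_integral_into T X N (\<lambda>t x. - \<phi> t * f' t x) I))"

definition H1_time ::
  "real \<Rightarrow> (real \<Rightarrow> real) set \<Rightarrow> ((real \<Rightarrow> real) \<Rightarrow> real) \<Rightarrow> (real \<Rightarrow> real \<Rightarrow> real) set" where
  "H1_time T X N = {f \<in> L2_time T X N. \<exists>f'\<in>L2_time T X N. has_time_deriv T X N f f'}"

definition C_time ::
  "real \<Rightarrow> (real \<Rightarrow> real) set \<Rightarrow> ((real \<Rightarrow> real) \<Rightarrow> real) \<Rightarrow> (real \<Rightarrow> real \<Rightarrow> real) set" where
  "C_time T X N = {f. \<forall>t\<in>{0..T}. f t \<in> X \<and>
     ((\<lambda>s. N (\<lambda>x. f s x - f t x)) \<longlongrightarrow> 0) (at t within {0..T})}"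


section \<open>The parabolic problem\<close>

definition Linf_norm :: "real \<Rightarrow> (real \<times> real \<Rightarrow> real) \<Rightarrow> ereal" where
  "Linf_norm T f = esssup (lebesgue_on (Q T)) (\<lambda>z. ereal \<bar>f z\<bar>)"

definition Linf :: "real \<Rightarrow> (real \<times> real \<Rightarrow> real) set" where
  "Linf T = {f. f \<in> borel_measurable (lebesgue_on (Q T)) \<and> Linf_norm T f < \<infinity>}"

text \<open>
  The space \<open>L\<^sup>2(0,T;H\<^sup>2) \<inter> H\<^sup>1(0,T;H\<^sup>1)\<close>. By the embedding of \<open>H\<^sup>1(0,T;X)\<close> into \<open>C([0,T];X)\<close>,
  every class in it has a representative that is continuous on \<open>[0,T]\<close>; membership in \<open>C_time\<close>
  selects it, so that the values at individual times \<open>0\<close>, \<open>t\<^sub>0\<close>, \<open>T\<close> are meaningful.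
\<close>

definition solution_space :: "real \<Rightarrow> (real \<Rightarrow> real) \<Rightarrow> (real \<times> real \<Rightarrow> real) set" where
  "solution_space T a = {u. u \<in> borel_measurable (lebesgue_on (Q T)) \<and>
     at_time u \<in> L2_time T (H2w a) (norm_H2w a) \<inter> H1_time T (H1w a) (norm_H1w a) \<and>
     at_time u \<in> C_time T (H1w a) (norm_H1w a)}"

definition is_dx :: "real \<Rightarrow> (real \<times> real \<Rightarrow> real) \<Rightarrow> (real \<times> real \<Rightarrow> real) \<Rightarrow> bool" where
  "is_dx T u g \<longleftrightarrow> g \<in> borel_measurable (lebesgue_on (Q T)) \<and>
     (AE t in lebesgue_on {0<..<T}. has_weak_deriv (at_time u t) (at_time g t))"

definition is_dt ::
  "real \<Rightarrow> (real \<Rightarrow> real) \<Rightarrow> (real \<times> real \<Rightarrow> real) \<Rightarrow> (real \<times> real \<Rightarrow> real) \<Rightarrow> bool" where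
  "is_dt T a u g \<longleftrightarrow> g \<in> borel_measurable (lebesgue_on (Q T)) \<and>
     at_time g \<in> L2_time T (H1w a) (norm_H1w a) \<and>
     has_time_deriv T (H1w a) (norm_H1w a) (at_time u) (at_time g)"

text \<open>
  \<open>wt\<close>, \<open>wx\<close>, \<open>wxx\<close> are representatives on \<open>Q T\<close> of the derivatives of \<open>w\<close>. The lateral boundary
  condition is meant in the sense of traces, that is, of \<open>H10\<close>.
\<close>

definition solves ::
  "real \<Rightarrow> (real \<Rightarrow> real) \<Rightarrow> (real \<times> real \<Rightarrow> real) \<Rightarrow> (real \<times> real \<Rightarrow> real) \<Rightarrow>
     (real \<times> real \<Rightarrow> real) \<Rightarrow> real \<Rightarrow> (real \<times> real \<Rightarrow> real) \<Rightarrow>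
     (real \<times> real \<Rightarrow> real) \<Rightarrow> (real \<times> real \<Rightarrow> real) \<Rightarrow> (real \<times> real \<Rightarrow> real) \<Rightarrow>
     (real \<times> real \<Rightarrow> real) \<Rightarrow> bool" where
  "solves T a b c d q G w wt wx wxx \<longleftrightarrow>
     w \<in> solution_space T a \<and> is_dt T a w wt \<and> is_dx T w wx \<and> is_dx T wx wxx \<and>
     (AE (x, t) in lebesgue_on (Q T).
        wt (x, t) - a x * wxx (x, t) + b (x, t) / q * rpow \<bar>wx (x, t)\<bar> q
          + d (x, t) * wx (x, t) + c (x, t) * w (x, t) = G (x, t)) \<and>
     (AE t in lebesgue_on {0<..<T}. at_time w t \<in> H10)"

definition case1 ::
  "real \<Rightarrow> (real \<Rightarrow> real) \<Rightarrow> (real \<times> real \<Rightarrow> real) \<Rightarrow> (real \<times> real \<Rightarrow> real) \<Rightarrow>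
     real \<Rightarrow> real \<Rightarrow> (real \<times> real \<Rightarrow> real) \<Rightarrow> (real \<times> real \<Rightarrow> real) \<Rightarrow> bool" where
  "case1 T a b d C0 K ux vx \<longleftrightarrow>
     (AE (x, t) in lebesgue_on (Q T). \<bar>b (x, t)\<bar> + \<bar>d (x, t)\<bar> \<le> C0 * sqrt (a x)) \<and>
     Linf_norm T ux \<le> ereal K \<and> Linf_norm T vx \<le> ereal K"

definition case2 ::
  "real \<Rightarrow> (real \<Rightarrow> real) \<Rightarrow> (real \<times> real \<Rightarrow> real) \<Rightarrow> (real \<times> real \<Rightarrow> real) \<Rightarrow> real \<Rightarrow>
     real \<Rightarrow> real \<Rightarrow> (real \<times> real \<Rightarrow> real) \<Rightarrow> (real \<times> real \<Rightarrow> real) \<Rightarrow> bool" where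
  "case2 T a b d q C0 K ux vx \<longleftrightarrow>
     b \<in> Linf T \<and>
     Linf_norm T (\<lambda>(x, t). rpow \<bar>ux (x, t)\<bar> (q - 1) / sqrt (a x)) \<le> ereal K \<and>
     Linf_norm T (\<lambda>(x, t). rpow \<bar>vx (x, t)\<bar> (q - 1) / sqrt (a x)) \<le> ereal K \<and>
     (AE (x, t) in lebesgue_on (Q T). \<bar>d (x, t)\<bar> \<le> C0 * sqrt (a x))"

end

theory Submission
  imports Defs
begin

text \<open>
  The difference \<open>z = u - v\<close> satisfies \<open>z\<^sub>t - a z\<^sub>x\<^sub>x = F\<close>, where the hypotheses of either case give
  \<open>\<bar>F\<bar> \<le> L (\<bar>z\<bar> + sqrt a \<bar>z\<^sub>x\<bar>)\<close>. In the space weighted by \<open>1/a\<close> the operator \<open>- a \<partial>\<^sub>x\<^sub>x\<close> is symmetric and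
  nonnegative, and \<open>F\<close> is controlled by \<open>f = \<parallel>z\<parallel>\<^sup>2\<close> and the Dirichlet energy \<open>D = \<parallel>z\<^sub>x\<parallel>\<^sup>2\<close>. Instead of a
  Carleman estimate, the proof uses the logarithmic convexity argument of Agmon and Nirenberg:
  the frequency \<open>D / f\<close> grows at most exponentially while \<open>(ln f)'\<close> is comparable to \<open>- D / f\<close>, so
  \<open>ln (f t\<^sub>0)\<close> lies below an interpolation of \<open>ln (f 0)\<close> and \<open>ln (f T)\<close> up to a constant. Replacing
  \<open>f\<close> by \<open>f + e\<close> and letting \<open>e\<close> tend to \<open>0\<close> covers zeros of \<open>f\<close>.
\<close>

section \<open>Smooth cutoff functions\<close>

text \<open>The weight degenerates at both endpoints, so the factor \<open>sqrt a\<close> next to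
  \<open>z_x\<close> in the bound on \<open>F\<close> is decisive: it cancels when \<open>F\<close>
  is divided by \<open>sqrt a\<close>, and the weighted norm of \<open>F\<close> is then controlled
  by \<open>f + D\<close> alone. Case 1 supplies this factor through \<open>b\<close> and
  \<open>d\<close>, Case 2 through \<open>|u_x|^(q-1)\<close>, \<open>|v_x|^(q-1)\<close> and
  \<open>d\<close>. Two formal computations need care. Differentiating \<open>f\<close> and
  \<open>D\<close> in time starts from weak derivatives with values in a set of representatives;
  bounded functionals turn these into scalar identities, and the product rule follows by summing
  local errors. Integrating by parts in space must produce no boundary term although
  \<open>z_xx\<close> is controlled only with the degenerate weight; this rests on the decay of
  \<open>H10\<close> functions near the boundary. The exponent arises by comparing
  \<open>ln f\<close> on both sides of \<open>t0\<close>: each comparison involves the unknown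
  frequency at \<open>t0\<close>, and eliminating it from the two inequalities fixes the
  interpolation weights. \<open>M1\<close> enters only through \<open>f 0\<close>.\<close>

definition smooth :: "(real \<Rightarrow> real) \<Rightarrow> bool" where
  "smooth f \<longleftrightarrow> (\<forall>k x. ((deriv ^^ k) f) field_differentiable (at x))"

text \<open>By induction on \<open>k\<close> every iterated derivative stays in \<open>P\<close>. A
  family closed under \<open>deriv\<close> thus replaces explicit formulas for higher
  derivatives.\<close>

lemma smooth_coinduct:
  assumes "f \<in> P"
    and "\<And>g x. g \<in> P \<Longrightarrow> g field_differentiable (at x)"
    and "\<And>g. g \<in> P \<Longrightarrow> deriv g \<in> P"
  shows "smooth f"
proof -
  have "(deriv ^^ k) f \<in> P" for k
    by (induction k) (auto intro: assms)
  then show ?thesis unfolding smooth_def using assms(2) by blast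
qed

lemma smooth_field_differentiable: "smooth f \<Longrightarrow> f field_differentiable (at x)"
  unfolding smooth_def by (drule spec[of _ 0]) simp

lemma smooth_deriv:
  assumes "smooth f"
  shows "smooth (deriv f)"
  unfolding smooth_def
proof (intro allI)
  fix k x
  show "((deriv ^^ k) (deriv f)) field_differentiable (at x)"
    using assms[unfolded smooth_def, rule_format, of "Suc k" x] by (simp add: funpow_swap1)
qed

lemma smooth_has_deriv: "smooth f \<Longrightarrow> (f has_field_derivative deriv f x) (at x)"
  by (simp add: field_differentiable_derivI smooth_field_differentiable)

lemma smooth_continuous_on: "smooth f \<Longrightarrow> continuous_on S f"
  by (intro continuous_at_imp_continuous_on ballI DERIV_isCont[OF smooth_has_deriv])

text \<open>Terms built by operations whose derivatives are again such terms, provided the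
  derivatives of the members of \<open>B\<close> are. This is the closed family that
  \<open>smooth_coinduct\<close> asks for; a direct induction on the order would need Leibniz and
  chain rule formulas of every order.\<close>

inductive_set smooth_closure :: "(real \<Rightarrow> real) set \<Rightarrow> (real \<Rightarrow> real) set" for B where
  base: "f \<in> B \<Longrightarrow> f \<in> smooth_closure B"
| const: "(\<lambda>x. c) \<in> smooth_closure B"
| add: "f \<in> smooth_closure B \<Longrightarrow> g \<in> smooth_closure B \<Longrightarrow> (\<lambda>x. f x + g x) \<in> smooth_closure B"
| mult: "f \<in> smooth_closure B \<Longrightarrow> g \<in> smooth_closure B \<Longrightarrow> (\<lambda>x. f x * g x) \<in> smooth_closure B"
| inverse: "f \<in> smooth_closure B \<Longrightarrow> (\<And>x. f x \<noteq> 0) \<Longrightarrow> (\<lambda>x. inverse (f x)) \<in> smooth_closure B"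
| affine: "f \<in> smooth_closure B \<Longrightarrow> (\<lambda>x. f (m * x + c)) \<in> smooth_closure B"

lemma smooth_closure_derivative:
  assumes "f \<in> smooth_closure B"
    and B: "\<And>g. g \<in> B \<Longrightarrow> \<exists>g'\<in>smooth_closure B. \<forall>x. (g has_field_derivative g' x) (at x)"
  shows "\<exists>f'\<in>smooth_closure B. \<forall>x. (f has_field_derivative f' x) (at x)"
  using assms(1)
proof induction
  case (base f)
  then show ?case using B by blast
next
  case (const c)
  show ?case by (rule bexI[OF _ smooth_closure.const[of 0]]) simp
next
  case (add f g)
  then obtain f' g' where *: "f' \<in> smooth_closure B" "\<And>x. (f has_field_derivative f' x) (at x)"
      "g' \<in> smooth_closure B" "\<And>x. (g has_field_derivative g' x) (at x)" by blast
  show ?case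
    by (rule bexI[OF _ smooth_closure.add[OF *(1,3)]]) (intro allI DERIV_add *(2,4))
next
  case (mult f g)
  then obtain f' g' where *: "f' \<in> smooth_closure B" "\<And>x. (f has_field_derivative f' x) (at x)"
      "g' \<in> smooth_closure B" "\<And>x. (g has_field_derivative g' x) (at x)" by blast
  show ?case
  proof (rule bexI[of _ "\<lambda>x. f' x * g x + g' x * f x"])
    show "\<forall>x. ((\<lambda>x. f x * g x) has_real_derivative f' x * g x + g' x * f x) (at x)"
      using *(2,4) DERIV_mult by blast
    show "(\<lambda>x. f' x * g x + g' x * f x) \<in> smooth_closure B"
      using * mult(1,2) by (intro smooth_closure.add smooth_closure.mult)
  qed
next
  case (inverse f)
  then obtain f' where *: "f' \<in> smooth_closure B" "\<And>x. (f has_field_derivative f' x) (at x)"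
    by blast
  show ?case
  \<comment> \<open>The derivative -f'/f^2 is spelled as a product of terms, so that the
    introduction rules of \<open>smooth_closure\<close> apply literally.\<close>
  proof (rule bexI[of _ "\<lambda>x. (-1) * ((inverse (f x) * f' x) * inverse (f x))"])
    show "\<forall>x. ((\<lambda>x. inverse (f x)) has_real_derivative (-1) * ((inverse (f x) * f' x) * inverse (f x))) (at x)"
    proof
      fix x
      show "((\<lambda>x. inverse (f x)) has_real_derivative (-1) * ((inverse (f x) * f' x) * inverse (f x))) (at x)"
        using DERIV_inverse'[OF *(2) inverse(2)] by simp
    qed
    have "(\<lambda>x. inverse (f x)) \<in> smooth_closure B"
      using inverse by (intro smooth_closure.inverse)
    then show "(\<lambda>x. (-1) * ((inverse (f x) * f' x) * inverse (f x))) \<in> smooth_closure B"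
      using *(1) smooth_closure.const[of "-1"] by (intro smooth_closure.mult)
  qed
next
  case (affine f m c)
  then obtain f' where *: "f' \<in> smooth_closure B" "\<And>x. (f has_field_derivative f' x) (at x)"
    by blast
  show ?case
  proof (rule bexI[of _ "\<lambda>x. f' (m * x + c) * m"])
    show "\<forall>x. ((\<lambda>x. f (m * x + c)) has_real_derivative f' (m * x + c) * m) (at x)"
    proof
      fix x
      have "((\<lambda>x. m * x + c) has_real_derivative m) (at x)"
        by (auto intro!: derivative_eq_intros)
      then show "((\<lambda>x. f (m * x + c)) has_real_derivative f' (m * x + c) * m) (at x)"
        using DERIV_chain2[OF *(2)] by blast
    qed
    show "(\<lambda>x. f' (m * x + c) * m) \<in> smooth_closure B"
      by (rule smooth_closure.mult[OF smooth_closure.affine[OF *(1), of m c] smooth_closure.const])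
  qed
qed

lemma smooth_closure_smooth:
  assumes "f \<in> smooth_closure B"
    and B: "\<And>g. g \<in> B \<Longrightarrow> \<exists>g'\<in>smooth_closure B. \<forall>x. (g has_field_derivative g' x) (at x)"
  shows "smooth f"
proof (rule smooth_coinduct[OF assms(1)])
  fix g assume g: "g \<in> smooth_closure B"
  then obtain g' where g': "g' \<in> smooth_closure B" "\<And>x. (g has_field_derivative g' x) (at x)"
    using smooth_closure_derivative B by blast
  show "g field_differentiable (at x)" for x
    using g' field_differentiable_def by blast
  have "deriv g = g'" using g' DERIV_imp_deriv by blast
  then show "deriv g \<in> smooth_closure B" using g' by simp
qed

lemma smooth_closure_of_smooth: "f \<in> smooth_closure {f. smooth f} \<Longrightarrow> smooth f"
proof (rule smooth_closure_smooth)
  fix g assume "g \<in> {f. smooth f}"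
  then show "\<exists>g'\<in>smooth_closure {f. smooth f}. \<forall>x. (g has_field_derivative g' x) (at x)"
    by (intro bexI[of _ "deriv g"] allI smooth_has_deriv smooth_closure.base CollectI smooth_deriv) auto
qed

lemma smooth_in_closure: "smooth f \<Longrightarrow> f \<in> smooth_closure {f. smooth f}"
  by (rule smooth_closure.base) simp

lemma smooth_const: "smooth (\<lambda>x. c)"
  by (rule smooth_closure_of_smooth, rule smooth_closure.const)

lemma smooth_add: "smooth f \<Longrightarrow> smooth g \<Longrightarrow> smooth (\<lambda>x. f x + g x)"
  by (rule smooth_closure_of_smooth[OF smooth_closure.add[OF smooth_in_closure smooth_in_closure]])

lemma smooth_mult: "smooth f \<Longrightarrow> smooth g \<Longrightarrow> smooth (\<lambda>x. f x * g x)"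
  by (rule smooth_closure_of_smooth[OF smooth_closure.mult[OF smooth_in_closure smooth_in_closure]])

lemma smooth_inverse: "smooth f \<Longrightarrow> (\<And>x. f x \<noteq> 0) \<Longrightarrow> smooth (\<lambda>x. inverse (f x))"
  by (rule smooth_closure_of_smooth[OF smooth_closure.inverse[OF smooth_in_closure]])

lemma smooth_affine: "smooth f \<Longrightarrow> smooth (\<lambda>x. f (m * x + c))"
  using smooth_closure_of_smooth[OF smooth_closure.affine[OF smooth_in_closure, of f m c]] .

definition flat :: "real poly \<Rightarrow> real \<Rightarrow> real" where
  "flat p x = (if x > 0 then poly p (1 / x) * exp (- (1 / x)) else 0)"

lemma poly_over_exp_tendsto_0: "((\<lambda>y::real. poly p y * exp (- y)) \<longlongrightarrow> 0) at_top"
proof -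
  have *: "((\<lambda>y::real. y ^ k * exp (- y)) \<longlongrightarrow> 0) at_top" for k
    using tendsto_power_div_exp_0[of k] unfolding exp_minus divide_inverse .
  have "poly p y * exp (- y) = (\<Sum>i\<le>degree p. coeff p i * (y ^ i * exp (- y)))" for y
    unfolding poly_altdef sum_distrib_right mult.assoc ..
  moreover have "((\<lambda>y. \<Sum>i\<le>degree p. coeff p i * (y ^ i * exp (- y))) \<longlongrightarrow> 0) at_top"
    by (intro tendsto_null_sum tendsto_mult_right_zero *)
  ultimately show ?thesis by simp
qed

text \<open>With y = 1/x, hence y' = -y^2, the derivative of p(y) exp(-y) is y^2 (p(y) - p'(y))
  exp(-y), and \<open>[:0, 0, 1:]\<close> is the polynomial y^2. At 0 the difference quotient from
  the right has the same form with y p(y) in place of p(y), so it tends to 0 because the exponential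
  dominates.\<close>

lemma flat_has_derivative:
  "(flat p has_field_derivative flat ([:0, 0, 1:] * (p - pderiv p)) x) (at x)"
proof -
  consider "x > 0" | "x < 0" | "x = 0" by linarith
  then show ?thesis
  proof cases
    case 1
    have "((\<lambda>x. poly p (1 / x) * exp (- (1 / x))) has_field_derivative
        flat ([:0, 0, 1:] * (p - pderiv p)) x) (at x)"
    proof (rule DERIV_cong)
      have inv: "((\<lambda>x. 1 / x) has_real_derivative - (1 / x\<^sup>2)) (at x)"
        using DERIV_inverse[of x] 1 unfolding divide_inverse power2_eq_square by simp
      show "((\<lambda>x. poly p (1 / x) * exp (- (1 / x))) has_real_derivative
          (poly (pderiv p) (1 / x) * - (1 / x\<^sup>2)) * exp (- (1 / x))
          + (exp (- (1 / x)) * - (- (1 / x\<^sup>2))) * poly p (1 / x)) (at x)"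
        by (rule DERIV_mult[OF DERIV_chain2[OF poly_DERIV inv] DERIV_fun_exp[OF DERIV_minus[OF inv]]])
      show "(poly (pderiv p) (1 / x) * - (1 / x\<^sup>2)) * exp (- (1 / x))
          + (exp (- (1 / x)) * - (- (1 / x\<^sup>2))) * poly p (1 / x)
          = flat ([:0, 0, 1:] * (p - pderiv p)) x"
        using 1 by (simp add: flat_def power2_eq_square algebra_simps)
    qed
    then show ?thesis
      by (rule has_field_derivative_transform_within_open[of _ _ _ "{0<..}"])
        (use 1 in \<open>auto simp: flat_def\<close>)
  next
    case 2
    have "((\<lambda>x. 0) has_field_derivative flat ([:0, 0, 1:] * (p - pderiv p)) x) (at x)"
      using 2 by (auto simp: flat_def)
    then show ?thesis
      by (rule has_field_derivative_transform_within_open[of _ _ _ "{..<0}"])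
        (use 2 in \<open>auto simp: flat_def\<close>)
  next
    case 3
    have "((\<lambda>h. flat p h / h) \<longlongrightarrow> 0) (at 0)"
    proof (rule filterlim_split_at)
      show "((\<lambda>h. flat p h / h) \<longlongrightarrow> 0) (at_left 0)"
        by (rule tendsto_eventually)
          (auto simp: flat_def eventually_at_filter)
      have "((\<lambda>h. poly (pCons 0 p) (inverse h) * exp (- (inverse h))) \<longlongrightarrow> 0) (at_right 0)"
        using filterlim_compose[OF poly_over_exp_tendsto_0 filterlim_inverse_at_top_right] .
      then show "((\<lambda>h. flat p h / h) \<longlongrightarrow> 0) (at_right 0)"
        by (rule Lim_transform_eventually)
          (auto simp: flat_def eventually_at_filter field_simps)
    qed
    then show ?thesis
      using 3 by (auto simp: has_field_derivative_iff flat_def)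
  qed
qed

lemma smooth_flat: "smooth (flat p)"
proof (rule smooth_coinduct[of _ "range flat"])
  show "flat p \<in> range flat" by simp
  fix g assume "g \<in> range flat"
  then obtain p where g: "g = flat p" by auto
  show "g field_differentiable (at x)" for x
    unfolding g using flat_has_derivative field_differentiable_def by blast
  show "deriv g \<in> range flat"
    unfolding g using DERIV_imp_deriv[OF flat_has_derivative] by blast
qed

text \<open>The two summands of the denominator never vanish together, so the quotient is smooth and
  rises from 0 to 1 on the unit interval. The spelling \<open>- 1 * x + 1\<close> matches
  \<open>smooth_affine\<close>.\<close>

definition step :: "real \<Rightarrow> real" where
  "step x = flat 1 x * inverse (flat 1 x + flat 1 (- 1 * x + 1))"

lemma step_denom_pos: "flat 1 x + flat 1 (- 1 * x + 1) > 0"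
  by (cases "x > 0"; cases "x < 1") (auto simp: flat_def add_pos_pos)

lemma smooth_step: "smooth step"
  unfolding step_def[abs_def]
  by (intro smooth_mult smooth_inverse smooth_add smooth_flat smooth_affine[of "flat 1"]
      less_imp_neq[OF step_denom_pos, THEN not_sym])

lemma step_le_0: "x \<le> 0 \<Longrightarrow> step x = 0"
  by (simp add: step_def flat_def)

lemma step_ge_1: "x \<ge> 1 \<Longrightarrow> step x = 1"
  by (simp add: step_def flat_def)

lemma step_nonneg: "0 \<le> step x" and step_le_1: "step x \<le> 1"
proof -
  have "flat 1 x \<ge> 0" "flat 1 (-1 * x + 1) \<ge> 0" by (auto simp: flat_def)
  then show "0 \<le> step x" "step x \<le> 1"
    using step_denom_pos[of x] by (auto simp: step_def field_simps)
qed

text \<open>Off the closed unit interval \<open>step\<close> is locally constant. At 0 and 1 it is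
  constant on one side only, and there the value follows from continuity of the derivative.\<close>

lemma deriv_step_outside:
  assumes "x \<le> 0 \<or> x \<ge> 1"
  shows "deriv step x = 0"
proof -
  have eq: "deriv step y = 0" if "y < 0 \<or> y > 1" for y
  proof -
    have "((\<lambda>x. if y < 0 then 0 else 1) has_field_derivative 0) (at y)" by auto
    then have "(step has_field_derivative 0) (at y)"
      by (rule has_field_derivative_transform_within_open[of _ _ _ "if y < 0 then {..<0} else {1<..}"])
        (use that in \<open>auto simp: step_le_0 step_ge_1\<close>)
    then show ?thesis by (rule DERIV_imp_deriv)
  qed
  have "isCont (deriv step) x"
    using smooth_continuous_on[OF smooth_deriv[OF smooth_step], of UNIV]
    by (simp add: continuous_on_eq_continuous_at)
  then have lim: "(deriv step \<longlongrightarrow> deriv step x) (at x)" by (simp add: isCont_def)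
  show ?thesis
  proof (cases "x \<le> 0")
    case True
    have "(deriv step \<longlongrightarrow> deriv step x) (at_left x)" using lim by (simp add: filterlim_at_split)
    moreover have "(deriv step \<longlongrightarrow> 0) (at_left x)"
      by (rule tendsto_eventually) (use True eq in \<open>auto simp: eventually_at_filter\<close>)
    ultimately show ?thesis using tendsto_unique trivial_limit_at_left_real by blast
  next
    case False
    have "(deriv step \<longlongrightarrow> deriv step x) (at_right x)" using lim by (simp add: filterlim_at_split)
    moreover have "(deriv step \<longlongrightarrow> 0) (at_right x)"
      by (rule tendsto_eventually) (use False assms eq in \<open>auto simp: eventually_at_filter\<close>)
    ultimately show ?thesis using tendsto_unique trivial_limit_at_right_real by blast
  qed
qed

lemma deriv_step_bounded: "\<exists>C>0. \<forall>x. \<bar>deriv step x\<bar> \<le> C"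
proof -
  have "bounded (deriv step ` {0..1})"
    by (intro compact_imp_bounded compact_continuous_image smooth_continuous_on smooth_deriv smooth_step) simp
  then obtain C where C: "C > 0" "\<And>x. x \<in> {0..1} \<Longrightarrow> \<bar>deriv step x\<bar> \<le> C"
    by (auto simp: bounded_pos)
  have "\<bar>deriv step x\<bar> \<le> C" for x
    using C deriv_step_outside[of x] by (cases "x \<in> {0..1}") auto
  then show ?thesis using C(1) by blast
qed

text \<open>A plateau of height 1 on \<open>{s + 2 * \<delta>..t - 2 * \<delta>}\<close> with
  transitions of width \<open>\<delta>\<close>. The outer margins of width \<open>\<delta>\<close>,
  where the function is 0, make its support a compact subset of the open interval.\<close>

definition cutoff :: "real \<Rightarrow> real \<Rightarrow> real \<Rightarrow> real \<Rightarrow> real" where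
  "cutoff s t \<delta> x = step ((x - s - \<delta>) / \<delta>) * step ((t - x - \<delta>) / \<delta>)"

lemma smooth_cutoff: "smooth (cutoff s t \<delta>)"
proof -
  have "cutoff s t \<delta> = (\<lambda>x. step ((1 / \<delta>) * x + (- s - \<delta>) / \<delta>) * step ((- 1 / \<delta>) * x + (t - \<delta>) / \<delta>))"
    unfolding cutoff_def[abs_def]
    by (intro ext arg_cong2[where f="(*)"] arg_cong[where f=step])
      (simp_all add: diff_divide_distrib add_divide_distrib)
  then show ?thesis
    by (simp only:) (rule smooth_mult[OF smooth_affine[OF smooth_step] smooth_affine[OF smooth_step]])
qed

lemma cutoff_nonneg: "0 \<le> cutoff s t \<delta> x" and cutoff_le_1: "cutoff s t \<delta> x \<le> 1"
  unfolding cutoff_def by (simp_all add: step_nonneg step_le_1 mult_le_one)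

lemma cutoff_eq_0:
  assumes "\<delta> > 0" "x \<le> s + \<delta> \<or> t - \<delta> \<le> x"
  shows "cutoff s t \<delta> x = 0"
proof -
  have "(x - s - \<delta>) / \<delta> \<le> 0 \<or> (t - x - \<delta>) / \<delta> \<le> 0"
    using assms by (auto simp: divide_le_0_iff)
  then show ?thesis unfolding cutoff_def by (auto simp: step_le_0)
qed

lemma cutoff_eq_1:
  assumes "\<delta> > 0" "s + 2 * \<delta> \<le> x" "x \<le> t - 2 * \<delta>"
  shows "cutoff s t \<delta> x = 1"
proof -
  have "(x - s - \<delta>) / \<delta> \<ge> 1" "(t - x - \<delta>) / \<delta> \<ge> 1"
    using assms by (simp_all add: pos_le_divide_eq)
  then show ?thesis unfolding cutoff_def by (simp add: step_ge_1)
qed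

lemma deriv_cutoff:
  "deriv (cutoff s t \<delta>) x =
    deriv step ((x - s - \<delta>) / \<delta>) * (1 / \<delta>) * step ((t - x - \<delta>) / \<delta>) +
    deriv step ((t - x - \<delta>) / \<delta>) * (- 1 / \<delta>) * step ((x - s - \<delta>) / \<delta>)"
proof (rule DERIV_imp_deriv)
  have "((\<lambda>x. (x - s - \<delta>) / \<delta>) has_real_derivative 1 / \<delta>) (at x)"
    by (rule DERIV_cdivide) (auto intro!: derivative_eq_intros)
  then have 1: "((\<lambda>x. step ((x - s - \<delta>) / \<delta>)) has_real_derivative
      deriv step ((x - s - \<delta>) / \<delta>) * (1 / \<delta>)) (at x)"
    by (rule DERIV_chain2[OF smooth_has_deriv[OF smooth_step]])
  have "((\<lambda>x. (t - x - \<delta>) / \<delta>) has_real_derivative - 1 / \<delta>) (at x)"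
    by (rule DERIV_cdivide) (auto intro!: derivative_eq_intros)
  then have 2: "((\<lambda>x. step ((t - x - \<delta>) / \<delta>)) has_real_derivative
      deriv step ((t - x - \<delta>) / \<delta>) * (- 1 / \<delta>)) (at x)"
    by (rule DERIV_chain2[OF smooth_has_deriv[OF smooth_step]])
  show "(cutoff s t \<delta> has_real_derivative
      deriv step ((x - s - \<delta>) / \<delta>) * (1 / \<delta>) * step ((t - x - \<delta>) / \<delta>) +
      deriv step ((t - x - \<delta>) / \<delta>) * (- 1 / \<delta>) * step ((x - s - \<delta>) / \<delta>)) (at x)"
    unfolding cutoff_def[abs_def] by (rule DERIV_mult[OF 1 2])
qed

lemma deriv_cutoff_eq_0:
  assumes "\<delta> > 0" "x \<le> s + \<delta> \<or> t - \<delta> \<le> x \<or> (s + 2 * \<delta> \<le> x \<and> x \<le> t - 2 * \<delta>)"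
  shows "deriv (cutoff s t \<delta>) x = 0"
proof -
  have 1: "deriv step ((x - s - \<delta>) / \<delta>) = 0" if "x \<le> s + \<delta> \<or> s + 2 * \<delta> \<le> x"
    by (rule deriv_step_outside) (use that assms(1) in \<open>auto simp: divide_le_0_iff pos_le_divide_eq\<close>)
  have 2: "deriv step ((t - x - \<delta>) / \<delta>) = 0" if "t - \<delta> \<le> x \<or> x \<le> t - 2 * \<delta>"
    by (rule deriv_step_outside) (use that assms(1) in \<open>auto simp: divide_le_0_iff pos_le_divide_eq\<close>)
  have 3: "step ((x - s - \<delta>) / \<delta>) = 0" if "x \<le> s + \<delta>"
    by (rule step_le_0) (use that assms(1) in \<open>auto simp: divide_le_0_iff\<close>)
  have 4: "step ((t - x - \<delta>) / \<delta>) = 0" if "t - \<delta> \<le> x"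
    by (rule step_le_0) (use that assms(1) in \<open>auto simp: divide_le_0_iff\<close>)
  show ?thesis unfolding deriv_cutoff using 1 2 3 4 assms(2) by auto
qed

text \<open>The constant has to be uniform in \<open>\<delta>\<close>, because later the rate
  \<open>C / \<delta>\<close> is played off against the width of the transitions. The product rule
  gives two terms, each at most the supremum of the derivative of \<open>step\<close>, divided by
  \<open>\<delta>\<close>.\<close>

lemma deriv_cutoff_bound:
  "\<exists>C>0. \<forall>s t \<delta> x. \<delta> > 0 \<longrightarrow> \<bar>deriv (cutoff s t \<delta>) x\<bar> \<le> C / \<delta>"
proof -
  obtain C where C: "C > 0" "\<And>x. \<bar>deriv step x\<bar> \<le> C" using deriv_step_bounded by blast
  have "\<bar>deriv (cutoff s t \<delta>) x\<bar> \<le> (2 * C) / \<delta>" if "\<delta> > 0" for s t \<delta> x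
  proof -
    have *: "\<bar>deriv step y * m * step z\<bar> \<le> C / \<delta>" if "\<bar>m\<bar> = 1 / \<delta>" for y m z
    proof -
      have "\<bar>deriv step y * m * step z\<bar> = \<bar>deriv step y\<bar> * step z / \<delta>"
        using that step_nonneg[of z] by (simp add: abs_mult)
      also have "\<dots> \<le> (C * 1) / \<delta>"
        using \<open>\<delta> > 0\<close> C step_nonneg[of z] step_le_1[of z]
        by (intro divide_right_mono mult_mono) auto
      finally show ?thesis by simp
    qed
    show ?thesis unfolding deriv_cutoff
      using abs_triangle_ineq[THEN order_trans, OF add_mono[OF *[of "1/\<delta>"] *[of "-1/\<delta>"]]] that
      by simp
  qed
  then show ?thesis using C(1) by (intro exI[of _ "2 * C"]) auto
qed

section \<open>Test functions: supports and closure properties\<close>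

lemma test_function_iff:
  "test_function S \<phi> \<longleftrightarrow> smooth \<phi> \<and> compact (closure {x. \<phi> x \<noteq> 0}) \<and> closure {x. \<phi> x \<noteq> 0} \<subseteq> S"
  unfolding test_function_def smooth_def by auto

lemma test_functionI:
  assumes "smooth \<phi>" "compact K" "K \<subseteq> S" "\<And>x. x \<notin> K \<Longrightarrow> \<phi> x = 0"
  shows "test_function S \<phi>"
proof -
  have "closure {x. \<phi> x \<noteq> 0} \<subseteq> K"
    using assms(2,4) by (intro closure_minimal) (auto intro: compact_imp_closed)
  moreover have "compact (closure {x. \<phi> x \<noteq> 0})"
    using assms(2) calculation
    by (metis bounded_subset closed_closure compact_eq_bounded_closed)
  ultimately show ?thesis unfolding test_function_iff
    using assms(1,3) by auto
qed

lemma test_function_support: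
  assumes "test_function S \<phi>"
  shows "\<exists>K. compact K \<and> K \<subseteq> S \<and> (\<forall>x. x \<notin> K \<longrightarrow> \<phi> x = 0 \<and> deriv \<phi> x = 0)"
proof -
  let ?K = "closure {x. \<phi> x \<noteq> 0}"
  have K: "compact ?K" "?K \<subseteq> S" using assms by (auto simp: test_function_iff)
  have 0: "\<phi> x = 0" if "x \<notin> ?K" for x
    using that closure_subset[of "{x. \<phi> x \<noteq> 0}"] by blast
  have 1: "deriv \<phi> x = 0" if "x \<notin> ?K" for x
  proof (rule DERIV_imp_deriv)
    have "((\<lambda>x. 0) has_field_derivative 0) (at x)" by auto
    then show "(\<phi> has_field_derivative 0) (at x)"
    proof (rule has_field_derivative_transform_within_open)
      show "open (- ?K)" by (simp add: open_Compl)
      show "x \<in> - ?K" using that by simp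
      show "0 = \<phi> y" if "y \<in> - ?K" for y
        by (rule 0[symmetric], rule ComplD[OF that])
    qed
  qed
  show ?thesis
    by (rule exI[of _ ?K]) (intro conjI K allI impI 0 1)
qed

lemma test_function_smooth: "test_function S \<phi> \<Longrightarrow> smooth \<phi>"
  by (simp add: test_function_iff)

lemma test_function_cutoff:
  assumes "\<delta> > 0" "{s<..<t} \<subseteq> S"
  shows "test_function S (cutoff s t \<delta>)"
proof (rule test_functionI[OF smooth_cutoff, of "{s + \<delta>..t - \<delta>}"])
  show "{s + \<delta>..t - \<delta>} \<subseteq> S" using assms by force
  show "\<And>x. x \<notin> {s + \<delta>..t - \<delta>} \<Longrightarrow> cutoff s t \<delta> x = 0"
    using cutoff_eq_0[OF assms(1)] by auto
qed auto

lemma test_function_mult: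
  assumes "test_function S \<phi>" "smooth \<psi>"
  shows "test_function S (\<lambda>x. \<psi> x * \<phi> x)"
proof -
  obtain K where "compact K" "K \<subseteq> S" "\<And>x. x \<notin> K \<Longrightarrow> \<phi> x = 0"
    using test_function_support[OF assms(1)] by blast
  then show ?thesis
    using test_functionI[OF smooth_mult[OF assms(2) test_function_smooth[OF assms(1)]], of K] by simp
qed

lemma test_function_lincomb:
  assumes "test_function S \<phi>" "test_function S \<psi>"
  shows "test_function S (\<lambda>x. c * \<phi> x + d * \<psi> x)"
proof -
  obtain K where K: "compact K" "K \<subseteq> S" "\<And>x. x \<notin> K \<Longrightarrow> \<phi> x = 0"
    using test_function_support[OF assms(1)] by blast
  obtain L where L: "compact L" "L \<subseteq> S" "\<And>x. x \<notin> L \<Longrightarrow> \<psi> x = 0"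
    using test_function_support[OF assms(2)] by blast
  show ?thesis
  proof (rule test_functionI[of _ "K \<union> L"])
    show "smooth (\<lambda>x. c * \<phi> x + d * \<psi> x)"
      by (rule smooth_add[OF smooth_mult[OF smooth_const test_function_smooth[OF assms(1)]]
            smooth_mult[OF smooth_const test_function_smooth[OF assms(2)]]])
    show "compact (K \<union> L)" "K \<union> L \<subseteq> S" using K L by auto
    show "c * \<phi> x + d * \<psi> x = 0" if "x \<notin> K \<union> L" for x using K(3)[of x] L(3)[of x] that by simp
  qed
qed

lemma deriv_lincomb:
  assumes "smooth \<phi>" "smooth \<psi>"
  shows "deriv (\<lambda>x. c * \<phi> x + d * \<psi> x) x = c * deriv \<phi> x + d * deriv \<psi> x"
  by (rule DERIV_imp_deriv[OF DERIV_add[OF DERIV_cmult[OF smooth_has_deriv[OF assms(1)]]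
        DERIV_cmult[OF smooth_has_deriv[OF assms(2)]]]])

section \<open>The fundamental lemma of the calculus of variations\<close>

lemma integrable_loc_mult:
  fixes g \<phi> :: "real \<Rightarrow> real"
  assumes g: "g absolutely_integrable_on K" and \<phi>: "continuous_on UNIV \<phi>"
    and K: "compact K" "K \<subseteq> S" "\<And>x. x \<notin> K \<Longrightarrow> \<phi> x = 0" and S: "S \<in> sets lebesgue"
  shows "integrable (lebesgue_on S) (\<lambda>x. g x * \<phi> x)"
proof -
  have "bounded (\<phi> ` K)"
    by (intro compact_imp_bounded compact_continuous_image continuous_on_subset[OF \<phi>] K(1)) simp
  then obtain B where B: "\<And>x. x \<in> K \<Longrightarrow> \<bar>\<phi> x\<bar> \<le> B" by (auto simp: bounded_iff)
  have B0: "\<bar>\<phi> x\<bar> \<le> \<bar>B\<bar>" for x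
  proof (cases "x \<in> K")
    case True
    then show ?thesis using B[of x] by linarith
  next
    case False
    then show ?thesis using K(3)[of x] by simp
  qed
  have \<phi>m: "\<phi> \<in> borel_measurable lebesgue"
    using borel_measurable_continuous_onI[OF \<phi>] by (simp add: measurable_completion)
  have gi: "integrable lebesgue (\<lambda>x. indicator K x * g x)"
    using g unfolding set_integrable_def by simp
  have gm: "(\<lambda>x. indicator K x * g x) \<in> borel_measurable lebesgue"
    using gi by (rule borel_measurable_integrable)
  have "integrable lebesgue (\<lambda>x. (indicator K x * g x) * \<phi> x)"
  proof (rule Bochner_Integration.integrable_bound)
    show "integrable lebesgue (\<lambda>x. \<bar>B\<bar> * (indicator K x * g x))"
      by (rule integrable_mult_right[OF gi])
    show "(\<lambda>x. (indicator K x * g x) * \<phi> x) \<in> borel_measurable lebesgue"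
      by (rule borel_measurable_times[OF gm \<phi>m])
    have "norm ((indicator K x * g x) * \<phi> x) \<le> norm (\<bar>B\<bar> * (indicator K x * g x))" for x
      using mult_right_mono[OF B0[of x], of "\<bar>indicator K x * g x\<bar>"]
      by (simp add: abs_mult mult.commute mult.left_commute)
    then show "AE x in lebesgue. norm ((indicator K x * g x) * \<phi> x) \<le> norm (\<bar>B\<bar> * (indicator K x * g x))"
      by simp
  qed
  moreover have "indicator S x *\<^sub>R (g x * \<phi> x) = (indicator K x * g x) * \<phi> x" for x
    using K(2) K(3)[of x] by (cases "x \<in> K") (auto simp: indicator_def)
  ultimately have "integrable lebesgue (\<lambda>x. indicator S x *\<^sub>R (g x * \<phi> x))"
    by presburger
  then show ?thesis
    using S by (simp add: integrable_restrict_space)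
qed

lemma integrable_test_mult:
  assumes "g \<in> L1_loc" "test_function \<Omega> \<phi>"
  shows "integrable (lebesgue_on \<Omega>) (\<lambda>x. g x * \<phi> x)"
    and "integrable (lebesgue_on \<Omega>) (\<lambda>x. g x * deriv \<phi> x)"
proof -
  obtain K where K: "compact K" "K \<subseteq> \<Omega>" "\<And>x. x \<notin> K \<Longrightarrow> \<phi> x = 0" "\<And>x. x \<notin> K \<Longrightarrow> deriv \<phi> x = 0"
    using test_function_support[OF assms(2)] by blast
  have s: "smooth \<phi>" by (rule test_function_smooth[OF assms(2)])
  have g: "g absolutely_integrable_on K" using assms(1) K(1,2) unfolding L1_loc_def by blast
  show "integrable (lebesgue_on \<Omega>) (\<lambda>x. g x * \<phi> x)"
    by (rule integrable_loc_mult[OF g smooth_continuous_on[OF s] K(1,2,3)]) auto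
  show "integrable (lebesgue_on \<Omega>) (\<lambda>x. g x * deriv \<phi> x)"
    by (rule integrable_loc_mult[OF g smooth_continuous_on[OF smooth_deriv[OF s]] K(1,2,4)]) auto
qed

text \<open>Lebesgue differentiation: off a negligible set \<open>f x\<close> is the limit of the
  means of \<open>f\<close> over \<open>{x..x + h}\<close>, and these vanish as soon as
  \<open>x + h\<close> is below \<open>\<beta>\<close>.\<close>

lemma AE_zero_of_zero_integrals:
  fixes f :: "real \<Rightarrow> real"
  assumes f: "integrable lebesgue f"
    and 0: "\<And>s t. \<alpha> < s \<Longrightarrow> s < t \<Longrightarrow> t < \<beta> \<Longrightarrow> integral {s..t} f = 0"
  shows "AE x in lebesgue. x \<in> {\<alpha><..<\<beta>} \<longrightarrow> f x = 0"
proof -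
  have "f integrable_on cbox u v" for u v
    using integrable_on_lebesgue[OF f] integrable_on_subcbox by blast
  then obtain N where N: "negligible N"
    and d: "\<And>x e. x \<notin> N \<Longrightarrow> 0 < e \<Longrightarrow> \<exists>d>0. \<forall>h. 0 < h \<and> h < d \<longrightarrow>
        norm (integral (cbox x (x + h *\<^sub>R One)) f /\<^sub>R h ^ DIM(real) - f x) < e"
    by (rule integrable_ccontinuous_explicit) blast
  have "f x = 0" if x: "x \<notin> N" "x \<in> {\<alpha><..<\<beta>}" for x
  proof (rule ccontr)
    assume "f x \<noteq> 0"
    then obtain d where "d > 0" and d: "\<And>h. 0 < h \<Longrightarrow> h < d \<Longrightarrow>
        norm (integral (cbox x (x + h *\<^sub>R One)) f /\<^sub>R h ^ DIM(real) - f x) < \<bar>f x\<bar>"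
      using d[OF x(1), of "\<bar>f x\<bar>"] by auto
    define h where "h = min (d / 2) ((\<beta> - x) / 2)"
    have h: "0 < h" "h < d" "x + h < \<beta>"
      using \<open>d > 0\<close> x(2) by (auto simp: h_def min_def field_simps)
    have "integral {x..x + h} f = 0"
      using 0[of x "x + h"] h x(2) by auto
    then show False using d[OF h(1,2)] by simp
  qed
  then have "{x. \<not> (x \<in> {\<alpha><..<\<beta>} \<longrightarrow> f x = 0)} \<subseteq> N" by auto
  moreover have "N \<in> null_sets lebesgue" using N by (simp add: negligible_iff_null_sets)
  ultimately show ?thesis by (intro AE_I'[of N]) auto
qed

lemma cutoff_tendsto:
  assumes "s < t"
  shows "(\<lambda>n. cutoff s t ((t - s) / (4 * real (Suc n))) x) \<longlonglongrightarrow> indicator {s<..<t} x"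
proof (cases "x \<in> {s<..<t}")
  case False
  have "cutoff s t ((t - s) / (4 * real (Suc n))) x = 0" for n
  proof -
    have "(t - s) / (4 * real (Suc n)) > 0" using assms by simp
    then show ?thesis
      by (rule cutoff_eq_0) (use False \<open>0 < (t - s) / (4 * real (Suc n))\<close> in force)
  qed
  then show ?thesis using False by simp
next
  case True
  have "(\<lambda>n. (t - s) / 4 * inverse (real (Suc n))) \<longlonglongrightarrow> (t - s) / 4 * 0"
    by (intro tendsto_mult tendsto_const LIMSEQ_inverse_real_of_nat)
  moreover have "(t - s) / (4 * real (Suc n)) = (t - s) / 4 * inverse (real (Suc n))" for n
    by (simp add: field_simps)
  ultimately have "(\<lambda>n. (t - s) / (4 * real (Suc n))) \<longlonglongrightarrow> 0"
    by (simp only: mult_zero_right)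
  moreover have "0 < min (x - s) (t - x) / 2" using True by simp
  ultimately have ev: "\<forall>\<^sub>F n in sequentially. (t - s) / (4 * real (Suc n)) < min (x - s) (t - x) / 2"
    by (rule order_tendstoD)
  have "\<forall>\<^sub>F n in sequentially. cutoff s t ((t - s) / (4 * real (Suc n))) x = 1"
    using ev
  proof eventually_elim
    case (elim n)
    define \<delta> where "\<delta> = (t - s) / (4 * real (Suc n))"
    have "\<delta> > 0" using assms by (simp add: \<delta>_def)
    moreover have "2 * \<delta> < x - s" "2 * \<delta> < t - x"
      using elim unfolding \<delta>_def[symmetric] by (auto simp: min_def split: if_splits)
    ultimately show ?case unfolding \<delta>_def[symmetric] by (intro cutoff_eq_1) auto
  qed
  then show ?thesis using True by (simp add: tendsto_eventually)
qed

lemma integral_cutoff_tendsto: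
  fixes g :: "real \<Rightarrow> real"
  assumes g: "integrable (lebesgue_on {s<..<t}) g" and "s < t"
  shows "(\<lambda>n. LINT x|lebesgue_on {s<..<t}. g x * cutoff s t ((t - s) / (4 * real (Suc n))) x)
    \<longlonglongrightarrow> (LINT x|lebesgue_on {s<..<t}. g x)"
proof (rule integral_dominated_convergence[where w="\<lambda>x. \<bar>g x\<bar>"])
  show gm: "g \<in> borel_measurable (lebesgue_on {s<..<t})"
    using g by (rule borel_measurable_integrable)
  show "integrable (lebesgue_on {s<..<t}) (\<lambda>x. \<bar>g x\<bar>)" using g by (rule integrable_abs)
  have "cutoff s t \<delta> \<in> borel_measurable (lebesgue_on {s<..<t})" for \<delta>
    by (intro continuous_imp_measurable_on_sets_lebesgue smooth_continuous_on smooth_cutoff) simp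
  then show "(\<lambda>x. g x * cutoff s t ((t - s) / (4 * real (Suc n))) x) \<in> borel_measurable (lebesgue_on {s<..<t})" for n
    by (rule borel_measurable_times[OF gm])
  show "AE x in lebesgue_on {s<..<t}. (\<lambda>n. g x * cutoff s t ((t - s) / (4 * real (Suc n))) x) \<longlonglongrightarrow> g x"
  proof (rule AE_I2)
    fix x assume x: "x \<in> space (lebesgue_on {s<..<t})"
    have "(\<lambda>n. g x * cutoff s t ((t - s) / (4 * real (Suc n))) x) \<longlonglongrightarrow> g x * indicator {s<..<t} x"
      by (intro tendsto_mult tendsto_const cutoff_tendsto \<open>s < t\<close>)
    then show "(\<lambda>n. g x * cutoff s t ((t - s) / (4 * real (Suc n))) x) \<longlonglongrightarrow> g x" using x by simp
  qed
  show "AE x in lebesgue_on {s<..<t}. norm (g x * cutoff s t ((t - s) / (4 * real (Suc n))) x) \<le> \<bar>g x\<bar>" for n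
    by (rule AE_I2) (simp add: abs_mult mult_left_le cutoff_nonneg cutoff_le_1)
qed

lemma integral_lebesgue_on_superset:
  fixes f :: "real \<Rightarrow> real"
  assumes "A \<subseteq> B" "A \<in> sets lebesgue" "B \<in> sets lebesgue" "\<And>x. x \<notin> A \<Longrightarrow> f x = 0"
  shows "(LINT x|lebesgue_on B. f x) = (LINT x|lebesgue_on A. f x)"
proof -
  have "f = (\<lambda>x. if x \<in> A then f x else 0)" using assms(4) by auto
  then show ?thesis using integral_restrict[OF assms(1-3), of f] by simp
qed

lemma integral_Ioo_Icc:
  fixes f :: "real \<Rightarrow> real"
  assumes "integrable (lebesgue_on {s<..<t}) f"
  shows "(LINT x|lebesgue_on {s<..<t}. f x) = integral {s..t} f"
  using lebesgue_integral_eq_integral[OF assms] by (simp add: integral_open_interval_real)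

text \<open>Cutoffs with shrinking transitions approximate the indicator of an interval, so the
  integral of \<open>g\<close> over every compact subinterval of the open unit interval is 0. Since
  \<open>g\<close> is only locally integrable, the differentiation argument runs on an exhausting
  sequence of smaller intervals.\<close>

lemma fundamental_lemma:
  assumes g: "g \<in> L1_loc"
    and 0: "\<And>\<phi>. test_function \<Omega> \<phi> \<Longrightarrow> (LINT x|lebesgue_on \<Omega>. g x * \<phi> x) = 0"
  shows "AE x in lebesgue_on \<Omega>. g x = 0"
proof -
  have loc: "integrable (lebesgue_on {s<..<t}) g" if "0 < s" "t < 1" for s t
  proof -
    have "g absolutely_integrable_on {s..t}"
      using g that unfolding L1_loc_def by (auto simp: subset_eq)
    then have "g absolutely_integrable_on {s<..<t}"
      by (rule set_integrable_subset) auto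
    then show ?thesis by (simp add: set_integrable_def integrable_restrict_space)
  qed
  have I0: "integral {s..t} g = 0" if st: "0 < s" "s < t" "t < 1" for s t
  proof -
    have "(LINT x|lebesgue_on {s<..<t}. g x * cutoff s t \<delta> x) = 0" if "\<delta> > 0" for \<delta>
    proof -
      have "(LINT x|lebesgue_on \<Omega>. g x * cutoff s t \<delta> x) = (LINT x|lebesgue_on {s<..<t}. g x * cutoff s t \<delta> x)"
        by (rule integral_lebesgue_on_superset) (use st that in \<open>auto simp: not_less cutoff_eq_0\<close>)
      moreover have "test_function \<Omega> (cutoff s t \<delta>)"
        by (rule test_function_cutoff) (use st that in auto)
      ultimately show ?thesis using 0 by simp
    qed
    then have "(\<lambda>n. 0) \<longlonglongrightarrow> (LINT x|lebesgue_on {s<..<t}. g x)"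
      using integral_cutoff_tendsto[OF loc \<open>s < t\<close>] st by simp
    then have "(LINT x|lebesgue_on {s<..<t}. g x) = 0" using LIMSEQ_unique tendsto_const by blast
    then show ?thesis using integral_Ioo_Icc[OF loc] st by simp
  qed
  have "AE x in lebesgue. x \<in> {1 / real (Suc m)<..<1 - 1 / real (Suc m)} \<longrightarrow> g x = 0" for m
  proof -
    let ?A = "{1 / real (Suc m)<..<1 - 1 / real (Suc m)}"
    have "integrable lebesgue (\<lambda>x. indicator ?A x * g x)"
      using loc[of "1 / real (Suc m)" "1 - 1 / real (Suc m)"] by (simp add: integrable_restrict_space)
    moreover have "integral {s..t} (\<lambda>x. indicator ?A x * g x) = 0"
      if "1 / real (Suc m) < s" "s < t" "t < 1 - 1 / real (Suc m)" for s t
    proof -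
      have "0 < 1 / real (Suc m)" by simp
      then have "0 < s" "t < 1" using that by linarith+
      have "integral {s..t} (\<lambda>x. indicator ?A x * g x) = integral {s..t} g"
        by (rule integral_cong) (use that in auto)
      then show ?thesis using I0[OF \<open>0 < s\<close> \<open>s < t\<close> \<open>t < 1\<close>] by simp
    qed
    ultimately have "AE x in lebesgue. x \<in> ?A \<longrightarrow> indicator ?A x * g x = 0"
      by (rule AE_zero_of_zero_integrals)
    then show ?thesis by eventually_elim auto
  qed
  then have "AE x in lebesgue. \<forall>m. x \<in> {1 / real (Suc m)<..<1 - 1 / real (Suc m)} \<longrightarrow> g x = 0"
    unfolding AE_all_countable by blast
  then have "AE x in lebesgue. x \<in> \<Omega> \<longrightarrow> g x = 0"
  proof eventually_elim
    case (elim x)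
    show ?case
    proof
      assume x: "x \<in> \<Omega>"
      then obtain m where "inverse (real (Suc m)) < min x (1 - x)"
        using reals_Archimedean[of "min x (1 - x)"] by auto
      then show "g x = 0" using elim[rule_format, of m] by (auto simp: inverse_eq_divide)
    qed
  qed
  then show ?thesis by (simp add: AE_restrict_space_iff)
qed

section \<open>Linearity and uniqueness of weak derivatives\<close>

lemma L1_loc_lincomb:
  assumes "g \<in> L1_loc" "h \<in> L1_loc"
  shows "(\<lambda>x. c * g x + d * h x) \<in> L1_loc"
  unfolding L1_loc_def
proof (intro CollectI allI impI)
  fix K :: "real set" assume K: "compact K \<and> K \<subseteq> \<Omega>"
  have "set_integrable lebesgue K (\<lambda>x. c * g x)" "set_integrable lebesgue K (\<lambda>x. d * h x)"
    using assms K by (auto simp: L1_loc_def)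
  then show "set_integrable lebesgue K (\<lambda>x. c * g x + d * h x)"
    by (rule set_integral_add(1))
qed

lemma has_weak_deriv_lincomb:
  assumes u: "has_weak_deriv u g" and v: "has_weak_deriv v h"
  shows "has_weak_deriv (\<lambda>x. c * u x + d * v x) (\<lambda>x. c * g x + d * h x)"
  unfolding has_weak_deriv_def
proof (intro conjI allI impI)
  have L: "u \<in> L1_loc" "v \<in> L1_loc" "g \<in> L1_loc" "h \<in> L1_loc"
    using u v by (auto simp: has_weak_deriv_def)
  show "(\<lambda>x. c * u x + d * v x) \<in> L1_loc" "(\<lambda>x. c * g x + d * h x) \<in> L1_loc"
    using L by (auto intro: L1_loc_lincomb)
  fix \<phi> assume \<phi>: "test_function \<Omega> \<phi>"
  have lin: "(LINT x|lebesgue_on \<Omega>. (c * p x + d * q x) * f x) =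
      c * (LINT x|lebesgue_on \<Omega>. p x * f x) + d * (LINT x|lebesgue_on \<Omega>. q x * f x)"
    if "integrable (lebesgue_on \<Omega>) (\<lambda>x. p x * f x)" "integrable (lebesgue_on \<Omega>) (\<lambda>x. q x * f x)"
    for p q f :: "real \<Rightarrow> real"
    using that by (simp add: distrib_right mult.assoc)
  show "(LINT x|lebesgue_on \<Omega>. (c * u x + d * v x) * deriv \<phi> x) =
      - (LINT x|lebesgue_on \<Omega>. (c * g x + d * h x) * \<phi> x)"
    using lin[OF integrable_test_mult(2)[OF L(1) \<phi>] integrable_test_mult(2)[OF L(2) \<phi>]]
      lin[OF integrable_test_mult(1)[OF L(3) \<phi>] integrable_test_mult(1)[OF L(4) \<phi>]] u v \<phi>
    by (simp add: has_weak_deriv_def)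
qed

text \<open>Stated for almost everywhere equal \<open>u\<close> and \<open>v\<close>, because a
  second weak derivative is taken of whichever representative of the first one is at hand.\<close>

lemma has_weak_deriv_unique:
  assumes "has_weak_deriv u g" "has_weak_deriv v h" "AE x in lebesgue_on \<Omega>. u x = v x"
  shows "AE x in lebesgue_on \<Omega>. g x = h x"
proof -
  have L: "u \<in> L1_loc" "v \<in> L1_loc" "g \<in> L1_loc" "h \<in> L1_loc"
    using assms by (auto simp: has_weak_deriv_def)
  have "AE x in lebesgue_on \<Omega>. 1 * g x + (- 1) * h x = 0"
  proof (rule fundamental_lemma[OF L1_loc_lincomb[OF L(3,4)]])
    fix \<phi> assume \<phi>: "test_function \<Omega> \<phi>"
    have "(LINT x|lebesgue_on \<Omega>. (1 * g x + (- 1) * h x) * \<phi> x) =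
        - (LINT x|lebesgue_on \<Omega>. (1 * u x + (- 1) * v x) * deriv \<phi> x)"
      using has_weak_deriv_lincomb[OF assms(1,2), of 1 "- 1"] \<phi> unfolding has_weak_deriv_def by simp
    also have "(LINT x|lebesgue_on \<Omega>. (1 * u x + (- 1) * v x) * deriv \<phi> x) = 0"
      by (rule integral_eq_zero_AE) (use assms(3) in eventually_elim, simp)
    finally show "(LINT x|lebesgue_on \<Omega>. (1 * g x + (- 1) * h x) * \<phi> x) = 0" by simp
  qed
  then show ?thesis by eventually_elim simp
qed

lemma weak_deriv_eq:
  assumes "has_weak_deriv u g"
  shows "has_weak_deriv u (weak_deriv u)" "AE x in lebesgue_on \<Omega>. weak_deriv u x = g x"
proof -
  show "has_weak_deriv u (weak_deriv u)"
    unfolding weak_deriv_def by (rule someI[of "has_weak_deriv u", OF assms])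
  from this assms show "AE x in lebesgue_on \<Omega>. weak_deriv u x = g x"
    by (rule has_weak_deriv_unique) simp
qed

section \<open>Continuous functions with an integrable weak derivative\<close>

lemma integrable_lebesgue_on_subset:
  fixes f :: "real \<Rightarrow> real"
  assumes "integrable (lebesgue_on B) f" "A \<subseteq> B" "A \<in> sets lebesgue" "B \<in> sets lebesgue"
  shows "integrable (lebesgue_on A) f"
  using set_integrable_subset[of lebesgue B f A] assms
  by (simp add: set_integrable_def integrable_restrict_space)

text \<open>On a transition of the cutoff, its derivative acts as a density of total mass
  \<open>\<phi> r - \<phi> p\<close>. Replacing \<open>h\<close> by the constant \<open>c\<close>
  costs at most the oscillation \<open>\<epsilon>\<close> times \<open>B\<close> times the
  length.\<close>

lemma weighted_mean_bound:
  fixes h :: "real \<Rightarrow> real"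
  assumes \<phi>: "smooth \<phi>" "\<And>x. \<bar>deriv \<phi> x\<bar> \<le> B" and h: "continuous_on {p..r} h"
    and "p \<le> r" and c: "\<And>x. x \<in> {p..r} \<Longrightarrow> \<bar>h x - c\<bar> \<le> \<epsilon>"
  shows "\<bar>integral {p..r} (\<lambda>x. deriv \<phi> x * h x) - c * (\<phi> r - \<phi> p)\<bar> \<le> B * \<epsilon> * (r - p)"
proof -
  have d: "continuous_on {p..r} (deriv \<phi>)" by (rule smooth_continuous_on[OF smooth_deriv[OF \<phi>(1)]])
  have "(deriv \<phi> has_integral \<phi> r - \<phi> p) {p..r}"
    using \<open>p \<le> r\<close> smooth_has_deriv[OF \<phi>(1)]
    by (intro fundamental_theorem_of_calculus)
      (auto simp: has_real_derivative_iff_has_vector_derivative intro: has_vector_derivative_at_within)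
  then have "c * (\<phi> r - \<phi> p) = integral {p..r} (\<lambda>x. c * deriv \<phi> x)"
    by (metis has_integral_mult_right integral_unique)
  then have "integral {p..r} (\<lambda>x. deriv \<phi> x * h x) - c * (\<phi> r - \<phi> p) =
      integral {p..r} (\<lambda>x. deriv \<phi> x * h x - c * deriv \<phi> x)"
    using integral_diff[OF integrable_continuous_interval[OF continuous_on_mult[OF d h]]
        integrable_continuous_interval[OF continuous_on_mult_left[OF d, of c]]] by simp
  also have "norm \<dots> \<le> B * \<epsilon> * (r - p)"
  proof (rule integral_bound[OF \<open>p \<le> r\<close>])
    show "continuous_on {p..r} (\<lambda>x. deriv \<phi> x * h x - c * deriv \<phi> x)"
      by (intro continuous_intros d h)
    fix x assume "x \<in> {p..r}"
    have "deriv \<phi> x * h x - c * deriv \<phi> x = deriv \<phi> x * (h x - c)" by (simp add: algebra_simps)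
    then have "norm (deriv \<phi> x * h x - c * deriv \<phi> x) = \<bar>deriv \<phi> x\<bar> * \<bar>h x - c\<bar>"
      by (simp add: abs_mult)
    also have "\<dots> \<le> B * \<epsilon>"
      using \<phi>(2)[of x] c[OF \<open>x \<in> {p..r}\<close>] by (intro mult_mono) auto
    finally show "norm (deriv \<phi> x * h x - c * deriv \<phi> x) \<le> B * \<epsilon>" .
  qed
  finally show ?thesis by simp
qed

text \<open>Test with a cutoff of the interval from \<open>s\<close> to \<open>t\<close>. As
  \<open>\<delta>\<close> shrinks, its derivative concentrates near \<open>s\<close> with mass 1 and
  near \<open>t\<close> with mass -1, so by continuity the left side tends to
  \<open>h s - h t\<close>, while the right side tends to minus the integral of \<open>k\<close>.
  The cutoff is supported strictly inside the interval, so \<open>s = 0\<close> and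
  \<open>t = T\<close> are allowed.\<close>

lemma du_Bois_Reymond:
  fixes h k :: "real \<Rightarrow> real"
  assumes h: "continuous_on {0..T} h" and k: "integrable (lebesgue_on {0<..<T}) k"
    and eq: "\<And>\<phi>. test_function {0<..<T} \<phi> \<Longrightarrow>
      (LINT x|lebesgue_on {0<..<T}. deriv \<phi> x * h x) = - (LINT x|lebesgue_on {0<..<T}. \<phi> x * k x)"
    and st: "0 \<le> s" "s < t" "t \<le> T"
  shows "h t - h s = integral {s..t} k"
proof -
  have kst: "integrable (lebesgue_on {s<..<t}) k"
    by (rule integrable_lebesgue_on_subset[OF k]) (use st in auto)
  have hst: "continuous_on {s..t} h" by (rule continuous_on_subset[OF h]) (use st in auto)
  obtain C where C: "C > 0" "\<And>s t \<delta> x. \<delta> > 0 \<Longrightarrow> \<bar>deriv (cutoff s t \<delta>) x\<bar> \<le> C / \<delta>"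
    using deriv_cutoff_bound by blast
  \<comment> \<open>The factor 4 guarantees a plateau,
    \<open>s + 2 * \<delta> n \<le> t - 2 * \<delta> n\<close>, for every \<open>n\<close>. The
    sequence is the one of \<open>integral_cutoff_tendsto\<close>.\<close>
  define \<delta> where "\<delta> = (\<lambda>n. (t - s) / (4 * real (Suc n)))"
  define J where "J = (\<lambda>n. integral {s..t} (\<lambda>x. deriv (cutoff s t (\<delta> n)) x * h x))"
  have \<delta>: "\<delta> n > 0" "4 * \<delta> n \<le> t - s" for n
    using st mult_right_mono[of s t "real n"] by (auto simp: \<delta>_def field_simps)
  have \<delta>0: "\<delta> \<longlonglongrightarrow> 0"
  proof -
    have "(\<lambda>n. (t - s) / 4 * inverse (real (Suc n))) \<longlonglongrightarrow> (t - s) / 4 * 0"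
      by (intro tendsto_mult tendsto_const LIMSEQ_inverse_real_of_nat)
    moreover have "\<delta> = (\<lambda>n. (t - s) / 4 * inverse (real (Suc n)))"
      by (simp add: \<delta>_def field_simps)
    ultimately show ?thesis by (simp only: mult_zero_right)
  qed
  have J: "J n = - (LINT x|lebesgue_on {s<..<t}. k x * cutoff s t (\<delta> n) x)" for n
  proof -
    let ?\<phi> = "cutoff s t (\<delta> n)"
    have z: "?\<phi> x = 0" "deriv ?\<phi> x = 0" if "x \<notin> {s<..<t}" for x
      using that \<delta>[of n] by (auto intro!: cutoff_eq_0 deriv_cutoff_eq_0 simp: not_less)
    have i: "integrable (lebesgue_on {s<..<t}) (\<lambda>x. deriv ?\<phi> x * h x)"
    proof (rule integrable_lebesgue_on_subset)
      show "integrable (lebesgue_on {s..t}) (\<lambda>x. deriv ?\<phi> x * h x)"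
        by (intro continuous_imp_integrable_real continuous_on_mult hst
            smooth_continuous_on[OF smooth_deriv[OF smooth_cutoff]])
    qed auto
    have "J n = (LINT x|lebesgue_on {s<..<t}. deriv ?\<phi> x * h x)"
      unfolding J_def using integral_Ioo_Icc[OF i] by simp
    also have "\<dots> = (LINT x|lebesgue_on {0<..<T}. deriv ?\<phi> x * h x)"
      by (rule integral_lebesgue_on_superset[symmetric]) (use st z in auto)
    also have "\<dots> = - (LINT x|lebesgue_on {0<..<T}. ?\<phi> x * k x)"
      by (rule eq, rule test_function_cutoff) (use st \<delta> in auto)
    also have "(LINT x|lebesgue_on {0<..<T}. ?\<phi> x * k x) = (LINT x|lebesgue_on {s<..<t}. ?\<phi> x * k x)"
      by (rule integral_lebesgue_on_superset) (use st z in auto)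
    finally show ?thesis by (simp add: mult.commute)
  qed
  have "J \<longlonglongrightarrow> - (LINT x|lebesgue_on {s<..<t}. k x)"
    unfolding J \<delta>_def by (intro tendsto_minus integral_cutoff_tendsto kst st)
  moreover have "J \<longlonglongrightarrow> h s - h t"
  proof (rule LIMSEQ_I)
    fix r :: real assume "r > 0"
    \<comment> \<open>Each end piece has length \<open>2 * \<delta> n\<close> and density at most
      \<open>C / \<delta> n\<close>, hence an error of at most \<open>2 * C * \<epsilon>\<close>;
      both together contribute r/2.\<close>
    define \<epsilon> where "\<epsilon> = r / (8 * C)"
    have "\<epsilon> > 0" using \<open>r > 0\<close> C(1) by (simp add: \<epsilon>_def)
    obtain d where d: "d > 0" "\<And>x y. x \<in> {s..t} \<Longrightarrow> y \<in> {s..t} \<Longrightarrow> \<bar>x - y\<bar> < d \<Longrightarrow> \<bar>h x - h y\<bar> < \<epsilon>"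
      using compact_uniformly_continuous[OF hst] \<open>\<epsilon> > 0\<close>
      unfolding uniformly_continuous_on_def dist_real_def by (metis compact_Icc)
    have "\<forall>\<^sub>F n in sequentially. \<delta> n < d / 2"
      using \<delta>0 by (rule order_tendstoD) (use d in simp)
    then obtain N where N: "\<And>n. n \<ge> N \<Longrightarrow> 2 * \<delta> n < d"
      unfolding eventually_sequentially by (metis less_divide_eq_numeral1(1) mult.commute)
    have "norm (J n - (h s - h t)) < r" if "n \<ge> N" for n
    proof -
      let ?\<phi> = "cutoff s t (\<delta> n)" and ?f = "\<lambda>x. deriv (cutoff s t (\<delta> n)) x * h x"
      let ?p = "s + 2 * \<delta> n" and ?q = "t - 2 * \<delta> n"
      note \<delta>n = \<delta>[of n] N[OF that]
      have int: "?f integrable_on {p..q}" if "s \<le> p" "q \<le> t" for p q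
        by (intro integrable_continuous_interval continuous_on_mult continuous_on_subset[OF hst]
            smooth_continuous_on[OF smooth_deriv[OF smooth_cutoff]]) (use that in auto)
      have "J n = integral {s..?p} ?f + (integral {?p..?q} ?f + integral {?q..t} ?f)"
        unfolding J_def
        using Henstock_Kurzweil_Integration.integral_combine[of s ?p t ?f]
          Henstock_Kurzweil_Integration.integral_combine[of ?p ?q t ?f] int[of s t] int[of ?p t] \<delta>n
        by simp
      moreover have "integral {?p..?q} ?f = integral {?p..?q} (\<lambda>x. 0)"
        by (rule integral_cong) (use \<delta>n deriv_cutoff_eq_0 in auto)
      moreover have "\<bar>integral {s..?p} ?f - h s * (?\<phi> ?p - ?\<phi> s)\<bar> \<le> C / \<delta> n * \<epsilon> * (?p - s)"
      proof (rule weighted_mean_bound[OF smooth_cutoff C(2)])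
        show "continuous_on {s..?p} h" by (rule continuous_on_subset[OF hst]) (use \<delta>n in auto)
        show "\<bar>h x - h s\<bar> \<le> \<epsilon>" if "x \<in> {s..?p}" for x
          using d(2)[of x s] that \<delta>n by auto
      qed (use \<delta>n in auto)
      moreover have "\<bar>integral {?q..t} ?f - h t * (?\<phi> t - ?\<phi> ?q)\<bar> \<le> C / \<delta> n * \<epsilon> * (t - ?q)"
      proof (rule weighted_mean_bound[OF smooth_cutoff C(2)])
        show "continuous_on {?q..t} h" by (rule continuous_on_subset[OF hst]) (use \<delta>n in auto)
        show "\<bar>h x - h t\<bar> \<le> \<epsilon>" if "x \<in> {?q..t}" for x
          using d(2)[of x t] that \<delta>n by auto
      qed (use \<delta>n in auto)
      moreover have "?\<phi> ?p = 1" "?\<phi> ?q = 1" "?\<phi> s = 0" "?\<phi> t = 0"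
        using \<delta>n by (auto intro!: cutoff_eq_0 cutoff_eq_1)
      moreover have "C / \<delta> n * \<epsilon> * (?p - s) = 2 * C * \<epsilon>" "C / \<delta> n * \<epsilon> * (t - ?q) = 2 * C * \<epsilon>"
        using \<delta>n by (auto simp: field_simps)
      moreover have "4 * C * \<epsilon> = r / 2" using C(1) by (simp add: \<epsilon>_def field_simps)
      ultimately show ?thesis using \<open>r > 0\<close> by (simp add: abs_le_iff abs_less_iff)
    qed
    then show "\<exists>N. \<forall>n\<ge>N. norm (J n - (h s - h t)) < r" by blast
  qed
  ultimately have "- (LINT x|lebesgue_on {s<..<t}. k x) = h s - h t"
    by (rule LIMSEQ_unique)
  then show ?thesis using integral_Ioo_Icc[OF kst] by simp
qed

section \<open>Semi-inner products and square integrable functions\<close>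

text \<open>Vectors are representatives in a set of functions, so the form is only semidefinite. The
  combined shape \<open>c * p x + d * q x\<close> covers sums, differences and multiples through the
  choice of \<open>c\<close> and \<open>d\<close>.\<close>

locale semi_inner =
  fixes X :: "('a \<Rightarrow> real) set" and B :: "('a \<Rightarrow> real) \<Rightarrow> ('a \<Rightarrow> real) \<Rightarrow> real"
  assumes lincomb: "p \<in> X \<Longrightarrow> q \<in> X \<Longrightarrow> (\<lambda>x. c * p x + d * q x) \<in> X"
    and B_lincomb: "p \<in> X \<Longrightarrow> q \<in> X \<Longrightarrow> r \<in> X \<Longrightarrow> B (\<lambda>x. c * p x + d * q x) r = c * B p r + d * B q r"
    and B_commute: "p \<in> X \<Longrightarrow> q \<in> X \<Longrightarrow> B p q = B q p"
    and B_nonneg: "p \<in> X \<Longrightarrow> B p p \<ge> 0"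
begin

definition N :: "('a \<Rightarrow> real) \<Rightarrow> real" where "N p = sqrt (B p p)"

lemma N_nonneg: "p \<in> X \<Longrightarrow> N p \<ge> 0"
  by (simp add: N_def B_nonneg)

lemma N_square: "p \<in> X \<Longrightarrow> (N p)\<^sup>2 = B p p"
  by (simp add: N_def B_nonneg)

lemma B_lincomb_right:
  assumes "p \<in> X" "q \<in> X" "r \<in> X"
  shows "B r (\<lambda>x. c * p x + d * q x) = c * B r p + d * B r q"
  using assms B_commute[OF assms(3) lincomb[OF assms(1,2)]] B_lincomb[OF assms(1-3)]
    B_commute[OF assms(1,3)] B_commute[OF assms(2,3)] by simp

lemma B_lincomb_self:
  assumes "p \<in> X" "q \<in> X"
  shows "B (\<lambda>x. c * p x + d * q x) (\<lambda>x. c * p x + d * q x) = c\<^sup>2 * B p p + 2 * c * d * B p q + d\<^sup>2 * B q q"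
  using B_lincomb[OF assms lincomb[OF assms]] B_lincomb_right[OF assms assms(1)]
    B_lincomb_right[OF assms assms(2)] B_commute[OF assms]
  by (simp add: power2_eq_square algebra_simps)

lemma Cauchy_Schwarz_square:
  assumes "p \<in> X" "q \<in> X"
  shows "(B p q)\<^sup>2 \<le> B p p * B q q"
proof -
  have *: "0 \<le> c\<^sup>2 * B p p + 2 * c * d * B p q + d\<^sup>2 * B q q" for c d
    using B_nonneg[OF lincomb[OF assms, of c d]] B_lincomb_self[OF assms, of c d] by simp
  show ?thesis
  proof (cases "B q q = 0")
    case True
    have "B p q = 0"
    proof (rule ccontr)
      assume "B p q \<noteq> 0"
      \<comment> \<open>With \<open>B q q = 0\<close> the quadratic is affine in the second
        coefficient, and the chosen value makes it equal to -1.\<close>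
      then show False
        using *[of 1 "- (B p p + 1) / (2 * B p q)"] True by (simp add: field_simps)
    qed
    then show ?thesis using True by simp
  next
    case False
    then have "B q q > 0" using B_nonneg[OF assms(2)] by simp
    \<comment> \<open>The minimizing combination, scaled by \<open>B q q\<close> to avoid a
      division.\<close>
    moreover have "0 \<le> B q q * (B p p * B q q - (B p q)\<^sup>2)"
      using *[of "B q q" "- B p q"] by (simp add: power2_eq_square algebra_simps)
    ultimately show ?thesis by (simp add: zero_le_mult_iff)
  qed
qed

lemma Cauchy_Schwarz:
  assumes "p \<in> X" "q \<in> X"
  shows "\<bar>B p q\<bar> \<le> N p * N q"
  unfolding N_def real_sqrt_mult[symmetric]
  by (rule real_le_rsqrt) (simp add: Cauchy_Schwarz_square assms)

lemma N_lincomb: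
  assumes "p \<in> X" "q \<in> X"
  shows "N (\<lambda>x. c * p x + d * q x) \<le> \<bar>c\<bar> * N p + \<bar>d\<bar> * N q"
proof (rule power2_le_imp_le)
  have "2 * (c * d * B p q) \<le> 2 * (\<bar>c\<bar> * \<bar>d\<bar> * (N p * N q))"
  proof -
    have "c * d * B p q \<le> \<bar>c * d * B p q\<bar>" by simp
    also have "\<dots> = \<bar>c\<bar> * \<bar>d\<bar> * \<bar>B p q\<bar>" by (simp add: abs_mult)
    also have "\<dots> \<le> \<bar>c\<bar> * \<bar>d\<bar> * (N p * N q)"
      by (intro mult_left_mono Cauchy_Schwarz assms) simp
    finally show ?thesis by simp
  qed
  then show "(N (\<lambda>x. c * p x + d * q x))\<^sup>2 \<le> (\<bar>c\<bar> * N p + \<bar>d\<bar> * N q)\<^sup>2"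
    using assms by (simp add: N_square lincomb B_lincomb_self power2_sum power_mult_distrib algebra_simps)
  show "0 \<le> \<bar>c\<bar> * N p + \<bar>d\<bar> * N q"
    using assms by (simp add: N_nonneg)
qed

end

section \<open>Square integrable functions\<close>

definition sqint :: "'a measure \<Rightarrow> ('a \<Rightarrow> real) set" where
  "sqint M = {f. f \<in> borel_measurable M \<and> integrable M (\<lambda>x. (f x)\<^sup>2)}"

lemma sqint_mult_integrable:
  assumes "f \<in> sqint M" "g \<in> sqint M"
  shows "integrable M (\<lambda>x. f x * g x)"
proof (rule Bochner_Integration.integrable_bound)
  show "integrable M (\<lambda>x. (f x)\<^sup>2 + (g x)\<^sup>2)" using assms by (auto simp: sqint_def)
  show "(\<lambda>x. f x * g x) \<in> borel_measurable M" using assms by (auto simp: sqint_def)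
  have "\<bar>u * v\<bar> \<le> u\<^sup>2 + v\<^sup>2" for u v :: real
  proof -
    have "0 \<le> (\<bar>u\<bar> - \<bar>v\<bar>)\<^sup>2" "0 \<le> u\<^sup>2 + v\<^sup>2" by simp_all
    moreover have "(\<bar>u\<bar> - \<bar>v\<bar>)\<^sup>2 = u\<^sup>2 + v\<^sup>2 - 2 * \<bar>u * v\<bar>" by (simp add: power2_diff abs_mult)
    ultimately show ?thesis by linarith
  qed
  then show "AE x in M. norm (f x * g x) \<le> norm ((f x)\<^sup>2 + (g x)\<^sup>2)" by simp
qed

lemma sqint_lincomb:
  assumes "f \<in> sqint M" "g \<in> sqint M"
  shows "(\<lambda>x. c * f x + d * g x) \<in> sqint M"
proof -
  have "(c * f x + d * g x)\<^sup>2 = c\<^sup>2 * (f x)\<^sup>2 + d\<^sup>2 * (g x)\<^sup>2 + 2 * c * d * (f x * g x)" for x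
    by (simp add: power2_sum power_mult_distrib)
  moreover have "(\<lambda>x. c * f x + d * g x) \<in> borel_measurable M"
    by (intro borel_measurable_add borel_measurable_times borel_measurable_const)
      (use assms in \<open>auto simp: sqint_def\<close>)
  ultimately show ?thesis
    using assms sqint_mult_integrable[OF assms] by (simp add: sqint_def)
qed

lemma sqint_bounded_mult:
  assumes f: "f \<in> sqint M" and m: "m \<in> borel_measurable M" and b: "AE x in M. \<bar>m x\<bar> \<le> C"
  shows "(\<lambda>x. m x * f x) \<in> sqint M"
    and "(LINT x|M. (m x * f x)\<^sup>2) \<le> C\<^sup>2 * (LINT x|M. (f x)\<^sup>2)"
proof -
  have le: "AE x in M. (m x * f x)\<^sup>2 \<le> C\<^sup>2 * (f x)\<^sup>2"
    using b
  proof eventually_elim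
    case (elim x)
    then have "\<bar>m x\<bar>\<^sup>2 \<le> C\<^sup>2" by (intro power_mono) auto
    then show ?case by (simp add: power_mult_distrib mult_right_mono)
  qed
  have int: "integrable M (\<lambda>x. C\<^sup>2 * (f x)\<^sup>2)" using f by (simp add: sqint_def)
  have meas: "(\<lambda>x. m x * f x) \<in> borel_measurable M"
    by (rule borel_measurable_times[OF m]) (use f in \<open>simp add: sqint_def\<close>)
  have i: "integrable M (\<lambda>x. (m x * f x)\<^sup>2)"
  proof (rule Bochner_Integration.integrable_bound[OF int])
    show "(\<lambda>x. (m x * f x)\<^sup>2) \<in> borel_measurable M" using meas by simp
    show "AE x in M. norm ((m x * f x)\<^sup>2) \<le> norm (C\<^sup>2 * (f x)\<^sup>2)"
      using le by eventually_elim simp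
  qed
  then show "(\<lambda>x. m x * f x) \<in> sqint M" using meas by (simp add: sqint_def)
  have "(LINT x|M. (m x * f x)\<^sup>2) \<le> (LINT x|M. C\<^sup>2 * (f x)\<^sup>2)"
    by (rule integral_mono_AE[OF i int le])
  then show "(LINT x|M. (m x * f x)\<^sup>2) \<le> C\<^sup>2 * (LINT x|M. (f x)\<^sup>2)" by simp
qed

interpretation sq: semi_inner "sqint M" "\<lambda>f g. LINT x|M. f x * g x" for M
proof
  fix p q r :: "'a \<Rightarrow> real" and c d
  assume p: "p \<in> sqint M" and q: "q \<in> sqint M"
  show "(\<lambda>x. c * p x + d * q x) \<in> sqint M" by (rule sqint_lincomb[OF p q])
  show "(LINT x|M. p x * q x) = (LINT x|M. q x * p x)" by (simp add: mult.commute)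
  assume "r \<in> sqint M"
  then show "(LINT x|M. (c * p x + d * q x) * r x) = c * (LINT x|M. p x * r x) + d * (LINT x|M. q x * r x)"
    using sqint_mult_integrable[OF p] sqint_mult_integrable[OF q]
    by (simp add: distrib_right mult.assoc)
next
  fix p :: "'a \<Rightarrow> real"
  show "0 \<le> (LINT x|M. p x * p x)" by (rule integral_nonneg_AE) simp
qed

lemma sq_N: "sq.N M f = sqrt (LINT x|M. (f x)\<^sup>2)"
  by (simp add: sq.N_def power2_eq_square)

lemma sq_N_bounded_mult:
  assumes f: "f \<in> sqint M" and m: "m \<in> borel_measurable M" and b: "AE x in M. \<bar>m x\<bar> \<le> C" and "C \<ge> 0"
  shows "sq.N M (\<lambda>x. m x * f x) \<le> C * sq.N M f"
proof -
  have "sq.N M (\<lambda>x. m x * f x) \<le> sqrt (C\<^sup>2 * (LINT x|M. (f x)\<^sup>2))"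
    unfolding sq_N using sqint_bounded_mult(2)[OF f m b] by simp
  then show ?thesis using \<open>C \<ge> 0\<close> by (simp add: real_sqrt_mult sq_N)
qed

lemma sq_N_cong:
  assumes "f \<in> sqint M" "g \<in> sqint M" "AE x in M. f x = g x"
  shows "sq.N M f = sq.N M g"
proof -
  have "(LINT x|M. (f x)\<^sup>2) = (LINT x|M. (g x)\<^sup>2)"
    by (rule integral_cong_AE) (use assms in \<open>auto simp: sqint_def\<close>)
  then show ?thesis by (simp add: sq_N)
qed

lemma sq_integral_tendsto:
  assumes f: "f \<in> sqint M" and g: "g \<in> sqint M" "\<And>n. \<phi> n \<in> sqint M"
    and lim: "(\<lambda>n. sq.N M (\<lambda>x. \<phi> n x - g x)) \<longlonglongrightarrow> 0"
  shows "(\<lambda>n. LINT x|M. f x * \<phi> n x) \<longlonglongrightarrow> (LINT x|M. f x * g x)"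
proof (rule LIM_zero_cancel, rule Lim_null_comparison)
  have eq: "(\<lambda>x. 1 * \<phi> n x + (- 1) * g x) = (\<lambda>x. \<phi> n x - g x)" for n by auto
  have "(LINT x|M. f x * \<phi> n x) - (LINT x|M. f x * g x) = (LINT x|M. f x * (\<phi> n x - g x))" for n
    using sq.B_lincomb_right[OF g(2,1) f, of 1 n "- 1"] eq[of n] by simp
  moreover have "\<bar>LINT x|M. f x * (\<phi> n x - g x)\<bar> \<le> sq.N M f * sq.N M (\<lambda>x. \<phi> n x - g x)" for n
    using sq.Cauchy_Schwarz[OF f sqint_lincomb[OF g(2,1), of 1 n "- 1"]] eq[of n] by simp
  ultimately show "\<forall>\<^sub>F n in sequentially. norm ((LINT x|M. f x * \<phi> n x) - (LINT x|M. f x * g x))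
      \<le> sq.N M f * sq.N M (\<lambda>x. \<phi> n x - g x)" by simp
  show "(\<lambda>n. sq.N M f * sq.N M (\<lambda>x. \<phi> n x - g x)) \<longlonglongrightarrow> 0"
    using tendsto_mult[OF tendsto_const lim] by simp
qed

text \<open>Completeness of Lebesgue measure, transferred to \<open>S\<close> by extension with
  0.\<close>

lemma borel_measurable_lebesgue_on_AE:
  fixes f g :: "real \<Rightarrow> real"
  assumes f: "f \<in> borel_measurable (lebesgue_on S)" and S: "S \<in> sets lebesgue"
    and eq: "AE x in lebesgue_on S. f x = g x"
  shows "g \<in> borel_measurable (lebesgue_on S)"
proof -
  have "(\<lambda>x. if x \<in> S then f x else 0) \<in> borel_measurable lebesgue"
    using f S by (simp add: borel_measurable_if)
  moreover have "AE x in lebesgue. (if x \<in> S then f x else 0) = (if x \<in> S then g x else 0)"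
    using eq S by (auto simp: AE_restrict_space_iff elim!: eventually_mono)
  ultimately have "(\<lambda>x. if x \<in> S then g x else 0) \<in> borel_measurable lebesgue"
    by (rule borel_measurable_AE)
  then show ?thesis using S by (simp add: borel_measurable_if)
qed

lemma sqint_AE_cong:
  fixes f g :: "real \<Rightarrow> real"
  assumes f: "f \<in> sqint (lebesgue_on S)" and S: "S \<in> sets lebesgue"
    and eq: "AE x in lebesgue_on S. f x = g x"
  shows "g \<in> sqint (lebesgue_on S)"
proof -
  have m: "g \<in> borel_measurable (lebesgue_on S)"
    by (rule borel_measurable_lebesgue_on_AE[OF _ S eq]) (use f in \<open>simp add: sqint_def\<close>)
  have "integrable (lebesgue_on S) (\<lambda>x. (g x)\<^sup>2) \<longleftrightarrow> integrable (lebesgue_on S) (\<lambda>x. (f x)\<^sup>2)"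
    by (rule integrable_cong_AE) (use m f eq in \<open>auto simp: sqint_def elim: eventually_mono\<close>)
  then show ?thesis using m f by (simp add: sqint_def)
qed

section \<open>The weighted Sobolev space\<close>

abbreviation LI :: "real measure" where "LI \<equiv> lebesgue_on {0<..<1}"

lemma L2_sqint: "L2 = sqint LI"
  by (simp add: L2_def sqint_def)

lemma norm_L2_N: "norm_L2 = sq.N LI"
  by (simp add: norm_L2_def sq_N fun_eq_iff)

lemma continuous_measurable_LI:
  assumes "continuous_on {0<..<1} f"
  shows "f \<in> borel_measurable LI"
  by (rule continuous_imp_measurable_on_sets_lebesgue[OF assms]) simp

lemma finite_measure_LI: "finite_measure LI"
  by (rule finite_measureI) (simp add: emeasure_restrict_space)

lemma sqint_bounded:
  assumes "f \<in> borel_measurable LI" "\<And>x. \<bar>f x\<bar> \<le> C"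
  shows "f \<in> sqint LI"
proof -
  have "(\<lambda>x. 1) \<in> sqint LI"
    using finite_measure.integrable_const[OF finite_measure_LI] by (simp add: sqint_def)
  from sqint_bounded_mult(1)[OF this assms(1), of C] show ?thesis using assms(2) by simp
qed

lemma test_function_bounded:
  assumes "test_function \<Omega> \<phi>"
  shows "\<exists>C. \<forall>x. \<bar>\<phi> x\<bar> \<le> C" "\<exists>C. \<forall>x. \<bar>deriv \<phi> x\<bar> \<le> C"
proof -
  obtain K where K: "compact K" "\<And>x. x \<notin> K \<Longrightarrow> \<phi> x = 0" "\<And>x. x \<notin> K \<Longrightarrow> deriv \<phi> x = 0"
    using test_function_support[OF assms] by blast
  have *: "\<exists>C. \<forall>x. \<bar>f x\<bar> \<le> C" if f: "continuous_on K f" and z: "\<And>x. x \<notin> K \<Longrightarrow> f x = 0"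
    for f :: "real \<Rightarrow> real"
  proof -
    have "bounded (f ` K)" by (intro compact_imp_bounded compact_continuous_image f K)
    then obtain C where C: "C > 0" "\<And>x. x \<in> K \<Longrightarrow> \<bar>f x\<bar> \<le> C" by (auto simp: bounded_pos)
    have "\<bar>f x\<bar> \<le> C" for x
    proof (cases "x \<in> K")
      case True then show ?thesis by (rule C)
    next
      case False then show ?thesis using z[OF False] C(1) by simp
    qed
    then show ?thesis by blast
  qed
  note s = test_function_smooth[OF assms]
  show "\<exists>C. \<forall>x. \<bar>\<phi> x\<bar> \<le> C" by (rule *[OF smooth_continuous_on[OF s] K(2)])
  show "\<exists>C. \<forall>x. \<bar>deriv \<phi> x\<bar> \<le> C" by (rule *[OF smooth_continuous_on[OF smooth_deriv[OF s]] K(3)])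
qed

lemma test_function_sqint:
  assumes "test_function \<Omega> \<phi>"
  shows "\<phi> \<in> sqint LI" "deriv \<phi> \<in> sqint LI"
proof -
  note s = test_function_smooth[OF assms]
  show "\<phi> \<in> sqint LI"
    using test_function_bounded(1)[OF assms] sqint_bounded
      continuous_measurable_LI[OF smooth_continuous_on[OF s]] by blast
  show "deriv \<phi> \<in> sqint LI"
    using test_function_bounded(2)[OF assms] sqint_bounded
      continuous_measurable_LI[OF smooth_continuous_on[OF smooth_deriv[OF s]]] by blast
qed

text \<open>Membership in \<open>H1\<close> yields some square integrable weak derivative. The
  representative selected by \<open>weak_deriv\<close> agrees with it almost everywhere and inherits
  its integrability.\<close>

lemma H1D:
  assumes "p \<in> H1"
  shows "p \<in> sqint LI" "has_weak_deriv p (weak_deriv p)" "weak_deriv p \<in> sqint LI"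
proof -
  obtain g where g: "g \<in> L2" "has_weak_deriv p g" using assms by (auto simp: H1_def)
  show "p \<in> sqint LI" using assms by (auto simp: H1_def L2_sqint)
  show "has_weak_deriv p (weak_deriv p)" by (rule weak_deriv_eq(1)[OF g(2)])
  have "AE x in LI. g x = weak_deriv p x" using weak_deriv_eq(2)[OF g(2)] by eventually_elim simp
  then show "weak_deriv p \<in> sqint LI"
    using g(1) unfolding L2_sqint by (rule sqint_AE_cong[rotated 2]) simp
qed

lemma H1_lincomb:
  assumes "p \<in> H1" "q \<in> H1"
  shows "(\<lambda>x. c * p x + d * q x) \<in> H1"
  using has_weak_deriv_lincomb[OF H1D(2)[OF assms(1)] H1D(2)[OF assms(2)], of c d]
    sqint_lincomb[OF H1D(3)[OF assms(1)] H1D(3)[OF assms(2)], of c d]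
    sqint_lincomb[OF H1D(1)[OF assms(1)] H1D(1)[OF assms(2)], of c d]
  by (auto simp: H1_def L2_sqint)

lemma weak_deriv_lincomb:
  assumes "p \<in> H1" "q \<in> H1"
  shows "AE x in LI. weak_deriv (\<lambda>x. c * p x + d * q x) x = c * weak_deriv p x + d * weak_deriv q x"
  by (rule weak_deriv_eq(2)[OF has_weak_deriv_lincomb[OF H1D(2)[OF assms(1)] H1D(2)[OF assms(2)]]])

lemma H10D: "p \<in> H10 \<Longrightarrow> p \<in> H1"
  by (simp add: H10_def)

lemma H10_lincomb:
  assumes p: "p \<in> H10" and q: "q \<in> H10"
  shows "(\<lambda>x. c * p x + d * q x) \<in> H10"
proof -
  note H = H10D[OF p] H10D[OF q]
  obtain \<phi> where \<phi>: "\<And>n. test_function \<Omega> (\<phi> n)" "(\<lambda>n. norm_L2 (\<lambda>x. \<phi> n x - p x)) \<longlonglongrightarrow> 0"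
     "(\<lambda>n. norm_L2 (\<lambda>x. deriv (\<phi> n) x - weak_deriv p x)) \<longlonglongrightarrow> 0"
    using p by (auto simp: H10_def)
  obtain \<psi> where \<psi>: "\<And>n. test_function \<Omega> (\<psi> n)" "(\<lambda>n. norm_L2 (\<lambda>x. \<psi> n x - q x)) \<longlonglongrightarrow> 0"
     "(\<lambda>n. norm_L2 (\<lambda>x. deriv (\<psi> n) x - weak_deriv q x)) \<longlonglongrightarrow> 0"
    using q by (auto simp: H10_def)
  define r where "r = (\<lambda>x. c * p x + d * q x)"
  define \<zeta> where "\<zeta> = (\<lambda>n x. c * \<phi> n x + d * \<psi> n x)"
  have \<zeta>: "test_function \<Omega> (\<zeta> n)" for n
    unfolding \<zeta>_def by (rule test_function_lincomb[OF \<phi>(1) \<psi>(1)])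
  have r: "r \<in> H1" unfolding r_def by (rule H1_lincomb[OF H])
  have d1: "(\<lambda>x. f x - g x) \<in> sqint LI" if "f \<in> sqint LI" "g \<in> sqint LI" for f g
    using sqint_lincomb[OF that, of 1 "- 1"] by simp
  \<comment> \<open>Equality of \<open>h n\<close> with the combination is asked only almost
    everywhere, since \<open>weak_deriv\<close> selects representatives and is linear only up to
    null sets.\<close>
  have lim: "(\<lambda>n. norm_L2 (h n)) \<longlonglongrightarrow> 0"
    if f: "\<And>n. f n \<in> sqint LI" "(\<lambda>n. norm_L2 (f n)) \<longlonglongrightarrow> 0"
     and g: "\<And>n. g n \<in> sqint LI" "(\<lambda>n. norm_L2 (g n)) \<longlonglongrightarrow> 0"
     and h: "\<And>n. h n \<in> sqint LI" "\<And>n. AE x in LI. h n x = c * f n x + d * g n x"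
    for f g h :: "nat \<Rightarrow> real \<Rightarrow> real"
  proof (rule Lim_null_comparison)
    have "norm_L2 (h n) \<le> \<bar>c\<bar> * norm_L2 (f n) + \<bar>d\<bar> * norm_L2 (g n)" for n
      using sq_N_cong[OF h(1) sqint_lincomb[OF f(1) g(1)] h(2)] sq.N_lincomb[OF f(1)[of n] g(1)[of n], of c d]
      by (simp add: norm_L2_N)
    moreover have "norm_L2 (h n) \<ge> 0" for n using sq.N_nonneg[OF h(1)] by (simp add: norm_L2_N)
    ultimately show "\<forall>\<^sub>F n in sequentially. norm (norm_L2 (h n)) \<le> \<bar>c\<bar> * norm_L2 (f n) + \<bar>d\<bar> * norm_L2 (g n)"
      by simp
    show "(\<lambda>n. \<bar>c\<bar> * norm_L2 (f n) + \<bar>d\<bar> * norm_L2 (g n)) \<longlonglongrightarrow> 0"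
      using tendsto_add[OF tendsto_mult[OF tendsto_const f(2)] tendsto_mult[OF tendsto_const g(2)]] by simp
  qed
  have "(\<lambda>n. norm_L2 (\<lambda>x. \<zeta> n x - r x)) \<longlonglongrightarrow> 0"
  proof (rule lim[OF _ \<phi>(2) _ \<psi>(2)])
    show "(\<lambda>x. \<phi> n x - p x) \<in> sqint LI" "(\<lambda>x. \<psi> n x - q x) \<in> sqint LI"
      "(\<lambda>x. \<zeta> n x - r x) \<in> sqint LI" for n
      by (intro d1 test_function_sqint(1) \<phi>(1) \<psi>(1) \<zeta> H1D(1) H r)+
    show "AE x in LI. \<zeta> n x - r x = c * (\<phi> n x - p x) + d * (\<psi> n x - q x)" for n
      by (simp add: \<zeta>_def r_def algebra_simps)
  qed
  moreover have "(\<lambda>n. norm_L2 (\<lambda>x. deriv (\<zeta> n) x - weak_deriv r x)) \<longlonglongrightarrow> 0"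
  proof (rule lim[OF _ \<phi>(3) _ \<psi>(3)])
    show "(\<lambda>x. deriv (\<phi> n) x - weak_deriv p x) \<in> sqint LI"
      "(\<lambda>x. deriv (\<psi> n) x - weak_deriv q x) \<in> sqint LI"
      "(\<lambda>x. deriv (\<zeta> n) x - weak_deriv r x) \<in> sqint LI" for n
      by (intro d1 test_function_sqint(2) \<phi>(1) \<psi>(1) \<zeta> H1D(3) H r)+
    show "AE x in LI. deriv (\<zeta> n) x - weak_deriv r x =
        c * (deriv (\<phi> n) x - weak_deriv p x) + d * (deriv (\<psi> n) x - weak_deriv q x)" for n
      using weak_deriv_lincomb[OF H, of c d]
    proof eventually_elim
      case (elim x)
      then show ?case
        unfolding \<zeta>_def r_def
        using deriv_lincomb[OF test_function_smooth[OF \<phi>(1)[of n]] test_function_smooth[OF \<psi>(1)[of n]], of c d x]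
        by (simp add: algebra_simps)
    qed
  qed
  ultimately show ?thesis
    using r \<zeta> unfolding H10_def r_def[symmetric] by blast
qed

text \<open>\<open>B0\<close> and \<open>B1\<close> are the bilinear forms of the weighted norm and
  of the Dirichlet energy: on the diagonal at \<open>z\<close> they give the quantities
  \<open>f\<close> and \<open>D\<close> of the overview.\<close>

definition B0 :: "(real \<Rightarrow> real) \<Rightarrow> (real \<Rightarrow> real) \<Rightarrow> (real \<Rightarrow> real) \<Rightarrow> real" where
  "B0 a p q = (LINT x|LI. p x * q x / a x)"

definition B1 :: "(real \<Rightarrow> real) \<Rightarrow> (real \<Rightarrow> real) \<Rightarrow> real" where
  "B1 p q = (LINT x|LI. weak_deriv p x * weak_deriv q x)"

locale weight =
  fixes a :: "real \<Rightarrow> real"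
  assumes a_cont: "continuous_on {0..1} a" and a_pos: "\<And>x. x \<in> {0<..<1} \<Longrightarrow> a x > 0"
begin

lemma a_measurable: "a \<in> borel_measurable LI"
  by (rule continuous_measurable_LI[OF continuous_on_subset[OF a_cont]]) auto

text \<open>Division by \<open>sqrt a\<close> carries the weighted inner product to the unweighted
  one, so that the facts about \<open>sqint LI\<close> become available for
  \<open>B0\<close>.\<close>

lemma L2w_iff: "p \<in> L2w a \<longleftrightarrow> p \<in> sqint LI \<and> (\<lambda>x. p x / sqrt (a x)) \<in> sqint LI"
proof -
  have "(\<lambda>x. p x / sqrt (a x)) \<in> borel_measurable LI" if "p \<in> borel_measurable LI"
    by (intro borel_measurable_divide that borel_measurable_continuous_on[OF _ a_measurable]
        continuous_on_real_sqrt continuous_on_id)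
  moreover have "integrable LI (\<lambda>x. (p x / sqrt (a x))\<^sup>2) \<longleftrightarrow> integrable LI (\<lambda>x. (p x)\<^sup>2 / a x)"
    by (rule Bochner_Integration.integrable_cong)
      (simp_all add: power_divide less_imp_le[OF a_pos])
  ultimately show ?thesis by (auto simp: L2w_def L2_sqint sqint_def)
qed

lemma L2w_lincomb:
  assumes "p \<in> L2w a" "q \<in> L2w a"
  shows "(\<lambda>x. c * p x + d * q x) \<in> L2w a"
proof -
  have "(\<lambda>x. c * (p x / sqrt (a x)) + d * (q x / sqrt (a x))) \<in> sqint LI"
    by (rule sqint_lincomb) (use assms in \<open>auto simp: L2w_iff\<close>)
  then show ?thesis
    using assms sqint_lincomb[of p LI q c d] by (simp add: L2w_iff add_divide_distrib)
qed

lemma H1wD: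
  assumes "p \<in> H1w a"
  shows "p \<in> H10" "p \<in> H1" "p \<in> L2w a" "(\<lambda>x. p x / sqrt (a x)) \<in> sqint LI"
  using assms H10D by (auto simp: H1w_def L2w_iff)

lemma H1w_lincomb:
  assumes "p \<in> H1w a" "q \<in> H1w a"
  shows "(\<lambda>x. c * p x + d * q x) \<in> H1w a"
  using assms L2w_lincomb H10_lincomb by (auto simp: H1w_def)

lemma B0_sqrt: "B0 a p q = (LINT x|LI. (p x / sqrt (a x)) * (q x / sqrt (a x)))"
  unfolding B0_def
  by (rule Bochner_Integration.integral_cong) (simp_all add: less_imp_le[OF a_pos])

sublocale b0: semi_inner "H1w a" "B0 a"
proof
  fix p q r :: "real \<Rightarrow> real" and c d :: real
  assume p: "p \<in> H1w a" and q: "q \<in> H1w a"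
  show "(\<lambda>x. c * p x + d * q x) \<in> H1w a" by (rule H1w_lincomb[OF p q])
  show "B0 a p q = B0 a q p" by (simp add: B0_def mult.commute)
  assume r: "r \<in> H1w a"
  show "B0 a (\<lambda>x. c * p x + d * q x) r = c * B0 a p r + d * B0 a q r"
    unfolding B0_sqrt
    using sq.B_lincomb[OF H1wD(4)[OF p] H1wD(4)[OF q] H1wD(4)[OF r], of c d]
    by (simp add: add_divide_distrib)
next
  fix p assume "p \<in> H1w a"
  then show "0 \<le> B0 a p p" unfolding B0_sqrt by (intro sq.B_nonneg H1wD(4))
qed

sublocale b1: semi_inner "H1w a" B1
proof
  fix p q r :: "real \<Rightarrow> real" and c d :: real
  assume p: "p \<in> H1w a" and q: "q \<in> H1w a"
  show "(\<lambda>x. c * p x + d * q x) \<in> H1w a" by (rule H1w_lincomb[OF p q])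
  show "B1 p q = B1 q p" by (simp add: B1_def mult.commute)
  assume r: "r \<in> H1w a"
  note W = H1D(3)[OF H1wD(2)]
  have "B1 (\<lambda>x. c * p x + d * q x) r =
      (LINT x|LI. (c * weak_deriv p x + d * weak_deriv q x) * weak_deriv r x)"
    unfolding B1_def
  proof (rule integral_cong_AE)
    show "(\<lambda>x. weak_deriv (\<lambda>x. c * p x + d * q x) x * weak_deriv r x) \<in> borel_measurable LI"
      using sqint_mult_integrable[OF W[OF H1w_lincomb[OF p q]] W[OF r]] by (rule borel_measurable_integrable)
    show "(\<lambda>x. (c * weak_deriv p x + d * weak_deriv q x) * weak_deriv r x) \<in> borel_measurable LI"
      using sqint_mult_integrable[OF sqint_lincomb[OF W[OF p] W[OF q]] W[OF r]]
      by (rule borel_measurable_integrable)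
    show "AE x in LI. weak_deriv (\<lambda>x. c * p x + d * q x) x * weak_deriv r x =
        (c * weak_deriv p x + d * weak_deriv q x) * weak_deriv r x"
      using weak_deriv_lincomb[OF H1wD(2)[OF p] H1wD(2)[OF q], of c d] by eventually_elim simp
  qed
  then show "B1 (\<lambda>x. c * p x + d * q x) r = c * B1 p r + d * B1 q r"
    unfolding B1_def using sq.B_lincomb[OF W[OF p] W[OF q] W[OF r], of c d] by simp
next
  fix p assume "p \<in> H1w a"
  then show "0 \<le> B1 p p" unfolding B1_def by (intro sq.B_nonneg H1D(3) H1wD(2))
qed

sublocale h: semi_inner "H1w a" "\<lambda>p q. B0 a p q + B1 p q"
proof
  fix p q r :: "real \<Rightarrow> real" and c d :: real
  assume p: "p \<in> H1w a" and q: "q \<in> H1w a"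
  show "(\<lambda>x. c * p x + d * q x) \<in> H1w a" by (rule H1w_lincomb[OF p q])
  show "B0 a p q + B1 p q = B0 a q p + B1 q p" using b0.B_commute[OF p q] b1.B_commute[OF p q] by simp
  assume r: "r \<in> H1w a"
  show "B0 a (\<lambda>x. c * p x + d * q x) r + B1 (\<lambda>x. c * p x + d * q x) r =
      c * (B0 a p r + B1 p r) + d * (B0 a q r + B1 q r)"
    using b0.B_lincomb[OF p q r] b1.B_lincomb[OF p q r] by (simp add: algebra_simps)
next
  fix p assume "p \<in> H1w a"
  then show "0 \<le> B0 a p p + B1 p p" using b0.B_nonneg b1.B_nonneg by fastforce
qed

lemma norm_L2w_N: "norm_L2w a p = b0.N p"
  by (simp add: norm_L2w_def b0.N_def B0_def power2_eq_square)

lemma norm_H1w_N: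
  assumes "p \<in> H1w a"
  shows "norm_H1w a p = h.N p"
proof -
  have "(norm_L2 (weak_deriv p))\<^sup>2 = B1 p p"
    unfolding norm_L2_N B1_def by (rule sq.N_square[OF H1D(3)[OF H1wD(2)[OF assms]]])
  then show ?thesis
    unfolding norm_H1w_def norm_L2w_N b0.N_square[OF assms] by (simp add: h.N_def)
qed

lemma N_le_H1w:
  assumes "p \<in> H1w a"
  shows "b0.N p \<le> h.N p" "b1.N p \<le> h.N p"
  using b0.B_nonneg[OF assms] b1.B_nonneg[OF assms]
  by (auto simp: b0.N_def b1.N_def h.N_def)

lemma B0_bound: "p \<in> H1w a \<Longrightarrow> q \<in> H1w a \<Longrightarrow> \<bar>B0 a p q\<bar> \<le> h.N p * h.N q"
  by (rule order_trans[OF b0.Cauchy_Schwarz])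
    (auto intro!: mult_mono N_le_H1w b0.N_nonneg h.N_nonneg)

lemma B1_bound: "p \<in> H1w a \<Longrightarrow> q \<in> H1w a \<Longrightarrow> \<bar>B1 p q\<bar> \<le> h.N p * h.N q"
  by (rule order_trans[OF b1.Cauchy_Schwarz])
    (auto intro!: mult_mono N_le_H1w b1.N_nonneg h.N_nonneg)

end

section \<open>Decay of \<open>H10\<close> functions in boundary layers\<close>

definition margin :: "real \<Rightarrow> real set" where
  "margin r = {0<..r} \<union> {1 - r..<1}"

lemma margin_sets: "margin r \<in> sets lebesgue"
  unfolding margin_def by auto

lemma indicator_measurable_LI: "A \<in> sets lebesgue \<Longrightarrow> indicat_real A \<in> borel_measurable LI"
  by (intro measurable_restrict_space1 borel_measurable_indicator)

lemmas indicator_margin_measurable = indicator_measurable_LI[OF margin_sets]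

lemma integral_indicator_LI:
  fixes f :: "real \<Rightarrow> real"
  assumes "A \<subseteq> \<Omega>" "A \<in> sets lebesgue"
  shows "(LINT x|LI. indicat_real A x * f x) = (LINT x|lebesgue_on A. f x)"
proof -
  have "indicat_real A x * f x = (if x \<in> A then f x else 0)" for x by simp
  then show ?thesis using integral_restrict[OF assms, of f] by simp
qed

text \<open>A test function vanishes at 0 and 1. Its value at \<open>x\<close> is therefore an
  integral of the derivative over an interval ending at the boundary, and Cauchy-Schwarz against the
  indicator of that interval gives the distance to the boundary as a factor.\<close>

lemma test_function_pointwise:
  assumes \<phi>: "test_function \<Omega> \<phi>" and x: "x \<in> {0<..<1}"
  shows "(\<phi> x)\<^sup>2 \<le> x * (sq.N LI (deriv \<phi>))\<^sup>2" "(\<phi> x)\<^sup>2 \<le> (1 - x) * (sq.N LI (deriv \<phi>))\<^sup>2"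
proof -
  note s = test_function_smooth[OF \<phi>] and d = test_function_sqint(2)[OF \<phi>]
  obtain K where K: "K \<subseteq> \<Omega>" "\<And>x. x \<notin> K \<Longrightarrow> \<phi> x = 0"
    using test_function_support[OF \<phi>] by blast
  have bd: "\<phi> 0 = 0" "\<phi> 1 = 0" using K by force+
  have *: "(\<phi> r - \<phi> p)\<^sup>2 \<le> (r - p) * (sq.N LI (deriv \<phi>))\<^sup>2" if pr: "0 \<le> p" "p < r" "r \<le> 1" for p r
  proof -
    have i: "integrable (lebesgue_on {p<..<r}) (deriv \<phi>)"
    proof (rule integrable_lebesgue_on_subset)
      show "integrable (lebesgue_on {p..r}) (deriv \<phi>)"
        by (rule continuous_imp_integrable_real[OF smooth_continuous_on[OF smooth_deriv[OF s]]])
    qed auto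
    have "(deriv \<phi> has_integral \<phi> r - \<phi> p) {p..r}"
      using pr smooth_has_deriv[OF s]
      by (intro fundamental_theorem_of_calculus)
        (auto simp: has_real_derivative_iff_has_vector_derivative intro: has_vector_derivative_at_within)
    then have "\<phi> r - \<phi> p = (LINT x|lebesgue_on {p<..<r}. deriv \<phi> x)"
      using integral_Ioo_Icc[OF i] by (simp add: integral_unique)
    also have "\<dots> = (LINT x|LI. indicat_real {p<..<r} x * deriv \<phi> x)"
      by (rule integral_indicator_LI[symmetric]) (use pr in auto)
    finally have eq: "\<phi> r - \<phi> p = (LINT x|LI. indicat_real {p<..<r} x * deriv \<phi> x)" .
    have im: "indicat_real {p<..<r} \<in> sqint LI"
      by (rule sqint_bounded[where C=1]) (simp_all add: indicator_measurable_LI indicator_def)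
    have "sq.N LI (indicat_real {p<..<r}) = sqrt (r - p)"
    proof -
      have "(indicat_real {p<..<r} x)\<^sup>2 = indicat_real {p<..<r} x * 1" for x by (simp add: indicator_def)
      then have "(LINT x|LI. (indicat_real {p<..<r} x)\<^sup>2) = (LINT x|lebesgue_on {p<..<r}. 1)"
        using integral_indicator_LI[of "{p<..<r}" "\<lambda>x. 1"] pr by (simp add: subset_eq)
      then show ?thesis using pr by (simp add: sq_N measure_restrict_space)
    qed
    then have "\<bar>\<phi> r - \<phi> p\<bar> \<le> sqrt (r - p) * sq.N LI (deriv \<phi>)"
      using sq.Cauchy_Schwarz[OF im d] eq by simp
    then have "\<bar>\<phi> r - \<phi> p\<bar>\<^sup>2 \<le> (sqrt (r - p) * sq.N LI (deriv \<phi>))\<^sup>2"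
      by (rule power_mono) simp
    then show ?thesis using pr by (simp add: power_mult_distrib)
  qed
  show "(\<phi> x)\<^sup>2 \<le> x * (sq.N LI (deriv \<phi>))\<^sup>2" using *[of 0 x] x bd by simp
  show "(\<phi> x)\<^sup>2 \<le> (1 - x) * (sq.N LI (deriv \<phi>))\<^sup>2" using *[of x 1] x bd by simp
qed

text \<open>On each of the two layers the pointwise bound is at most r times the energy. Integration
  gives another factor r per layer, in total 2 r^2 times the energy, which is below the square of
  the right side. Adding the two indicators also covers overlapping layers.\<close>

lemma test_function_margin:
  assumes \<phi>: "test_function \<Omega> \<phi>" and r: "0 < r" "r < 1"
  shows "sq.N LI (\<lambda>x. indicator (margin r) x * \<phi> x) \<le> 2 * r * sq.N LI (deriv \<phi>)"
proof -
  let ?D = "(sq.N LI (deriv \<phi>))\<^sup>2"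
  note d = test_function_sqint[OF \<phi>]
  have D: "?D \<ge> 0" "0 \<le> r * ?D" using r by simp_all
  have m: "(\<lambda>x. indicat_real (margin r) x * \<phi> x) \<in> sqint LI"
    by (rule sqint_bounded_mult(1)[OF d(1) indicator_margin_measurable, of _ 1]) (simp add: indicator_def)
  have si: "integrable LI (\<lambda>x. indicat_real A x * (r * ?D))" "(LINT x|LI. indicat_real A x * (r * ?D)) = r * (r * ?D)"
    if A: "A = {0<..r} \<or> A = {1 - r..<1}" for A
  proof -
    have As: "A \<subseteq> {0<..<1}" "A \<in> sets lebesgue" "measure lebesgue A = r" using A r by auto
    show "integrable LI (\<lambda>x. indicat_real A x * (r * ?D))"
      using sqint_bounded[OF indicator_measurable_LI[OF As(2)], of 1]
        sqint_mult_integrable[of "indicat_real A" LI "\<lambda>x. r * ?D"] sqint_bounded[of "\<lambda>x. r * ?D" "\<bar>r * ?D\<bar>"]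
      by (simp add: indicator_def)
    show "(LINT x|LI. indicat_real A x * (r * ?D)) = r * (r * ?D)"
      unfolding integral_indicator_LI[OF As(1,2)] using As
      by (simp add: measure_restrict_space)
  qed
  have "(LINT x|LI. (indicat_real (margin r) x * \<phi> x)\<^sup>2) \<le>
      (LINT x|LI. indicat_real {0<..r} x * (r * ?D) + indicat_real {1 - r..<1} x * (r * ?D))"
  proof (rule integral_mono)
    show "integrable LI (\<lambda>x. (indicat_real (margin r) x * \<phi> x)\<^sup>2)" using m by (simp add: sqint_def)
    show "integrable LI (\<lambda>x. indicat_real {0<..r} x * (r * ?D) + indicat_real {1 - r..<1} x * (r * ?D))"
      using si(1)[of "{0<..r}"] si(1)[of "{1 - r..<1}"] by (intro Bochner_Integration.integrable_add) auto
    fix x assume "x \<in> space LI"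
    then have x: "x \<in> {0<..<1}" by simp
    show "(indicat_real (margin r) x * \<phi> x)\<^sup>2 \<le>
        indicat_real {0<..r} x * (r * ?D) + indicat_real {1 - r..<1} x * (r * ?D)"
    proof -
      consider "x \<in> {0<..r}" | "x \<in> {1 - r..<1}" | "x \<notin> margin r" by (auto simp: margin_def)
      then show ?thesis
      proof cases
        case 1
        then have "x * ?D \<le> r * ?D" by (intro mult_right_mono) auto
        then have "(\<phi> x)\<^sup>2 \<le> r * ?D" using test_function_pointwise(1)[OF \<phi> x] by linarith
        then show ?thesis using 1 by (auto simp: margin_def indicator_def; use D(2) in linarith)
      next
        case 2
        then have "(1 - x) * ?D \<le> r * ?D" by (intro mult_right_mono) auto
        then have "(\<phi> x)\<^sup>2 \<le> r * ?D" using test_function_pointwise(2)[OF \<phi> x] by linarith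
        then show ?thesis using 2 by (auto simp: margin_def indicator_def; use D(2) in linarith)
      next
        case 3
        then show ?thesis using r D by simp
      qed
    qed
  qed
  also have "\<dots> = 2 * (r * (r * ?D))"
    using si[of "{0<..r}"] si[of "{1 - r..<1}"]
    by (subst Bochner_Integration.integral_add) (simp_all del: Bochner_Integration.integral_mult_left_zero)
  also have "\<dots> \<le> (2 * r * sq.N LI (deriv \<phi>))\<^sup>2"
    using mult_nonneg_nonneg[of r "r * ?D"] D r by (simp add: power_mult_distrib power2_eq_square)
  finally show ?thesis
    unfolding sq_N using r by (intro real_le_lsqrt) (auto simp: integral_nonneg_AE)
qed

text \<open>All norms in \<open>test_function_margin\<close> pass to the limit of the approximating
  test functions. The point is the order \<open>r\<close>: it compensates the growth
  \<open>C / \<delta>\<close> of the derivative of a cutoff whose transitions lie in a layer of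
  width \<open>2 * \<delta>\<close>.\<close>

lemma H10_margin:
  assumes p: "p \<in> H10" and r: "0 < r" "r < 1"
  shows "sq.N LI (\<lambda>x. indicator (margin r) x * p x) \<le> 2 * r * sq.N LI (weak_deriv p)"
proof -
  note H = H1D[OF H10D[OF p]]
  obtain \<phi> where \<phi>: "\<And>n. test_function \<Omega> (\<phi> n)" "(\<lambda>n. sq.N LI (\<lambda>x. \<phi> n x - p x)) \<longlonglongrightarrow> 0"
     "(\<lambda>n. sq.N LI (\<lambda>x. deriv (\<phi> n) x - weak_deriv p x)) \<longlonglongrightarrow> 0"
    using p by (auto simp: H10_def norm_L2_N)
  note T = test_function_sqint[OF \<phi>(1)]
  let ?I = "indicat_real (margin r)"
  have I: "AE x in LI. \<bar>?I x\<bar> \<le> 1" by (simp add: indicator_def)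
  note Im = indicator_margin_measurable[of r]
  have d: "(\<lambda>x. \<phi> n x - p x) \<in> sqint LI" for n using sqint_lincomb[OF T(1)[of n] H(1), of 1 "- 1"] by simp
  have d': "(\<lambda>x. deriv (\<phi> n) x - weak_deriv p x) \<in> sqint LI" for n
    using sqint_lincomb[OF T(2)[of n] H(3), of 1 "- 1"] by simp
  have le: "sq.N LI (\<lambda>x. ?I x * p x) \<le> sq.N LI (\<lambda>x. \<phi> n x - p x) +
      2 * r * (sq.N LI (\<lambda>x. deriv (\<phi> n) x - weak_deriv p x) + sq.N LI (weak_deriv p))" for n
  proof -
    have "sq.N LI (\<lambda>x. ?I x * p x) = sq.N LI (\<lambda>x. 1 * (?I x * \<phi> n x) + (- 1) * (?I x * (\<phi> n x - p x)))"
      by (simp add: algebra_simps)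
    also have "\<dots> \<le> sq.N LI (\<lambda>x. ?I x * \<phi> n x) + sq.N LI (\<lambda>x. ?I x * (\<phi> n x - p x))"
      using sq.N_lincomb[OF sqint_bounded_mult(1)[OF T(1)[of n] Im I] sqint_bounded_mult(1)[OF d[of n] Im I], of 1 "- 1"]
      by simp
    also have "sq.N LI (\<lambda>x. ?I x * (\<phi> n x - p x)) \<le> 1 * sq.N LI (\<lambda>x. \<phi> n x - p x)"
      by (rule sq_N_bounded_mult[OF d Im I]) simp
    also have "sq.N LI (\<lambda>x. ?I x * \<phi> n x) \<le> 2 * r * sq.N LI (deriv (\<phi> n))"
      by (rule test_function_margin[OF \<phi>(1) r])
    also have "sq.N LI (deriv (\<phi> n)) \<le> sq.N LI (\<lambda>x. deriv (\<phi> n) x - weak_deriv p x) + sq.N LI (weak_deriv p)"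
      using sq.N_lincomb[OF d'[of n] H(3), of 1 1] by simp
    finally show ?thesis using r by simp
  qed
  have "(\<lambda>n. sq.N LI (\<lambda>x. \<phi> n x - p x) +
      2 * r * (sq.N LI (\<lambda>x. deriv (\<phi> n) x - weak_deriv p x) + sq.N LI (weak_deriv p)))
      \<longlonglongrightarrow> 0 + 2 * r * (0 + sq.N LI (weak_deriv p))"
    by (intro tendsto_add tendsto_mult tendsto_const \<phi>)
  then show ?thesis
    using LIMSEQ_le_const[of _ _ "sq.N LI (\<lambda>x. ?I x * p x)"] le by fastforce
qed

context weight
begin

text \<open>The approximating test functions converge to \<open>p\<close> only in the unweighted norm, while \<open>y'\<close> is
  square integrable only with the degenerate weight. Hence the passage to the limit is done under a
  cutoff; the boundary layer term then vanishes because \<open>p\<close> is small there by \<open>H10_margin\<close>.\<close>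

lemma weighted_integration_by_parts:
  assumes p: "p \<in> H1w a" and y: "y \<in> sqint LI" "has_weak_deriv y y'"
    and y': "y' \<in> borel_measurable LI" "(\<lambda>x. sqrt (a x) * y' x) \<in> sqint LI"
  shows "(LINT x|LI. weak_deriv p x * y x) = - (LINT x|LI. p x * y' x)"
    and "integrable LI (\<lambda>x. p x * y' x)"
proof -
  note H = H1D[OF H1wD(2)[OF p]]
  obtain C where C: "C > 0" "\<And>\<delta> x. \<delta> > 0 \<Longrightarrow> \<bar>deriv (cutoff 0 1 \<delta>) x\<bar> \<le> C / \<delta>"
    using deriv_cutoff_bound by blast
  have cut_m: "cutoff 0 1 \<delta> \<in> borel_measurable LI" "deriv (cutoff 0 1 \<delta>) \<in> borel_measurable LI" for \<delta>
    by (intro continuous_measurable_LI smooth_continuous_on smooth_deriv smooth_cutoff)+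
  have cut_b: "AE x in LI. \<bar>cutoff 0 1 \<delta> x\<bar> \<le> 1" for \<delta>
    using cutoff_nonneg cutoff_le_1 by simp
  have py': "integrable LI (\<lambda>x. p x * y' x)"
  proof -
    have "integrable LI (\<lambda>x. (p x / sqrt (a x)) * (sqrt (a x) * y' x))"
      by (rule sqint_mult_integrable[OF H1wD(4)[OF p] y'(2)])
    moreover have "integrable LI (\<lambda>x. (p x / sqrt (a x)) * (sqrt (a x) * y' x)) \<longleftrightarrow> integrable LI (\<lambda>x. p x * y' x)"
      by (rule Bochner_Integration.integrable_cong) (use a_pos in \<open>auto simp: less_imp_neq[THEN not_sym]\<close>)
    ultimately show ?thesis by simp
  qed
  then show "integrable LI (\<lambda>x. p x * y' x)" .
  \<comment> \<open>Where the cutoff does not vanish, \<open>a\<close> has a positive lower bound by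
    compactness, so \<open>y'\<close> becomes square integrable without weight.\<close>
  have cut_y': "(\<lambda>x. cutoff 0 1 \<delta> x * y' x) \<in> sqint LI" if \<delta>: "\<delta> > 0" for \<delta>
  proof -
    have "\<exists>m>0. \<forall>x\<in>{\<delta>..1 - \<delta>}. m \<le> a x"
    proof (cases "{\<delta>..1 - \<delta>} = {}")
      case False
      have "continuous_on {\<delta>..1 - \<delta>} a"
        by (rule continuous_on_subset[OF a_cont]) (use \<delta> in auto)
      then obtain x0 where x0: "x0 \<in> {\<delta>..1 - \<delta>}" "\<And>x. x \<in> {\<delta>..1 - \<delta>} \<Longrightarrow> a x0 \<le> a x"
        using continuous_attains_inf[OF compact_Icc False] by blast
      then show ?thesis using a_pos[of x0] \<delta> by (intro exI[of _ "a x0"]) auto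
    qed (auto intro: exI[of _ 1])
    then obtain m where m: "m > 0" "\<And>x. x \<in> {\<delta>..1 - \<delta>} \<Longrightarrow> m \<le> a x" by blast
    have sa: "(\<lambda>x. sqrt (a x)) \<in> borel_measurable LI"
      by (intro borel_measurable_continuous_on[OF _ a_measurable] continuous_on_real_sqrt continuous_on_id)
    have "(\<lambda>x. (cutoff 0 1 \<delta> x / sqrt (a x)) * (sqrt (a x) * y' x)) \<in> sqint LI"
    proof (rule sqint_bounded_mult(1)[OF y'(2)])
      show "(\<lambda>x. cutoff 0 1 \<delta> x / sqrt (a x)) \<in> borel_measurable LI"
        by (intro borel_measurable_divide cut_m sa)
      have "\<bar>cutoff 0 1 \<delta> x / sqrt (a x)\<bar> \<le> 1 / sqrt m" if "x \<in> {0<..<1}" for x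
      proof (cases "x \<in> {\<delta>..1 - \<delta>}")
        case True
        then show ?thesis
          using m a_pos[OF that] cutoff_nonneg[of 0 1 \<delta> x] cutoff_le_1[of 0 1 \<delta> x]
          by (auto simp: abs_of_pos intro!: frac_le)
      next
        case False
        then have "cutoff 0 1 \<delta> x = 0" using \<delta> by (intro cutoff_eq_0) auto
        then show ?thesis using m by simp
      qed
      then show "AE x in LI. \<bar>cutoff 0 1 \<delta> x / sqrt (a x)\<bar> \<le> 1 / sqrt m" by (intro AE_I2) simp
    qed
    then show ?thesis
    proof (rule sqint_AE_cong)
      show "AE x in LI. (cutoff 0 1 \<delta> x / sqrt (a x)) * (sqrt (a x) * y' x) = cutoff 0 1 \<delta> x * y' x"
        by (rule AE_I2) (use a_pos in \<open>auto simp: less_imp_neq[THEN not_sym]\<close>)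
    qed simp
  qed
  have cut_y: "(\<lambda>x. cutoff 0 1 \<delta> x * y x) \<in> sqint LI" for \<delta>
    by (rule sqint_bounded_mult(1)[OF y(1) cut_m(1) cut_b])
  have dcut: "(\<lambda>x. deriv (cutoff 0 1 \<delta>) x * f x) \<in> sqint LI" if "\<delta> > 0" "f \<in> sqint LI" for \<delta> f
    by (rule sqint_bounded_mult(1)[OF that(2) cut_m(2), of _ "C / \<delta>"]) (use C(2)[OF that(1)] in simp)
  \<comment> \<open>Integration by parts at fixed \<open>\<delta>\<close>: the product of the cutoff
    and a test function is again a test function, and every term is continuous in the unweighted
    norms as the test functions approach \<open>p\<close>.\<close>
  have B: "(LINT x|LI. (deriv (cutoff 0 1 \<delta>) x * y x) * p x) +
      (LINT x|LI. (weak_deriv p x * y x) * cutoff 0 1 \<delta> x) = - (LINT x|LI. (p x * y' x) * cutoff 0 1 \<delta> x)"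
    if \<delta>: "\<delta> > 0" for \<delta>
  proof -
    let ?\<zeta> = "cutoff 0 1 \<delta>"
    obtain \<phi> where \<phi>: "\<And>n. test_function \<Omega> (\<phi> n)" "(\<lambda>n. sq.N LI (\<lambda>x. \<phi> n x - p x)) \<longlonglongrightarrow> 0"
       "(\<lambda>n. sq.N LI (\<lambda>x. deriv (\<phi> n) x - weak_deriv p x)) \<longlonglongrightarrow> 0"
      using H1wD(1)[OF p] by (auto simp: H10_def norm_L2_N)
    note T = test_function_sqint[OF \<phi>(1)]
    have eq: "(LINT x|LI. (deriv ?\<zeta> x * y x) * \<phi> n x) + (LINT x|LI. (?\<zeta> x * y x) * deriv (\<phi> n) x)
        = - (LINT x|LI. (?\<zeta> x * y' x) * \<phi> n x)" for n
    proof -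
      note s = test_function_smooth[OF \<phi>(1)[of n]]
      have "deriv (\<lambda>x. ?\<zeta> x * \<phi> n x) x = deriv ?\<zeta> x * \<phi> n x + deriv (\<phi> n) x * ?\<zeta> x" for x
        by (rule DERIV_imp_deriv[OF DERIV_mult[OF smooth_has_deriv[OF smooth_cutoff] smooth_has_deriv[OF s]]])
      moreover have "(LINT x|LI. y x * deriv (\<lambda>x. ?\<zeta> x * \<phi> n x) x) = - (LINT x|LI. y' x * (?\<zeta> x * \<phi> n x))"
        using y(2) test_function_mult[OF \<phi>(1)[of n] smooth_cutoff[of 0 1 \<delta>]]
        unfolding has_weak_deriv_def by blast
      ultimately have "(LINT x|LI. y x * (deriv ?\<zeta> x * \<phi> n x + deriv (\<phi> n) x * ?\<zeta> x)) =
          - (LINT x|LI. y' x * (?\<zeta> x * \<phi> n x))" by simp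
      moreover have "(LINT x|LI. y x * (deriv ?\<zeta> x * \<phi> n x + deriv (\<phi> n) x * ?\<zeta> x)) =
          (LINT x|LI. (deriv ?\<zeta> x * y x) * \<phi> n x) + (LINT x|LI. (?\<zeta> x * y x) * deriv (\<phi> n) x)"
        using Bochner_Integration.integral_add[OF sqint_mult_integrable[OF dcut[OF \<delta> y(1)] T(1)[of n]]
            sqint_mult_integrable[OF cut_y T(2)[of n]]]
        by (simp add: algebra_simps)
      moreover have "(LINT x|LI. y' x * (?\<zeta> x * \<phi> n x)) = (LINT x|LI. (?\<zeta> x * y' x) * \<phi> n x)"
        by (simp add: mult_ac)
      ultimately show ?thesis by simp
    qed
    have "(\<lambda>n. (LINT x|LI. (deriv ?\<zeta> x * y x) * \<phi> n x) + (LINT x|LI. (?\<zeta> x * y x) * deriv (\<phi> n) x))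
        \<longlonglongrightarrow> (LINT x|LI. (deriv ?\<zeta> x * y x) * p x) + (LINT x|LI. (?\<zeta> x * y x) * weak_deriv p x)"
      by (intro tendsto_add sq_integral_tendsto dcut[OF \<delta>] cut_y T H \<phi> y)
    moreover have "(\<lambda>n. - (LINT x|LI. (?\<zeta> x * y' x) * \<phi> n x)) \<longlonglongrightarrow> - (LINT x|LI. (?\<zeta> x * y' x) * p x)"
      by (intro tendsto_minus sq_integral_tendsto cut_y'[OF \<delta>] T H \<phi>)
    ultimately have "(LINT x|LI. (deriv ?\<zeta> x * y x) * p x) + (LINT x|LI. (?\<zeta> x * y x) * weak_deriv p x)
        = - (LINT x|LI. (?\<zeta> x * y' x) * p x)"
      unfolding eq by (rule LIMSEQ_unique)
    then show ?thesis by (simp add: mult_ac)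
  qed
  \<comment> \<open>Spelled with \<open>1 - 0\<close> to be the sequence of
    \<open>integral_cutoff_tendsto\<close> for the unit interval.\<close>
  define \<delta> where "\<delta> = (\<lambda>n. (1 - 0) / (4 * real (Suc n)))"
  have \<delta>: "\<delta> n > 0" "2 * \<delta> n < 1" for n by (auto simp: \<delta>_def field_simps)
  have W: "(\<lambda>n. LINT x|LI. (weak_deriv p x * y x) * cutoff 0 1 (\<delta> n) x) \<longlonglongrightarrow> (LINT x|LI. weak_deriv p x * y x)"
    unfolding \<delta>_def by (rule integral_cutoff_tendsto[OF sqint_mult_integrable[OF H(3) y(1)]]) simp
  have R: "(\<lambda>n. LINT x|LI. (p x * y' x) * cutoff 0 1 (\<delta> n) x) \<longlonglongrightarrow> (LINT x|LI. p x * y' x)"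
    unfolding \<delta>_def by (rule integral_cutoff_tendsto[OF py']) simp
  \<comment> \<open>Cauchy-Schwarz on the layer of width \<open>2 * \<delta> n\<close>: the factor
    \<open>C / \<delta> n\<close> is absorbed by the factor \<open>4 * \<delta> n\<close> that
    \<open>H10_margin\<close> gives for \<open>p\<close>, and the norm of \<open>y\<close> over the
    shrinking layer tends to 0 by dominated convergence.\<close>
  have Z: "(\<lambda>n. LINT x|LI. (deriv (cutoff 0 1 (\<delta> n)) x * y x) * p x) \<longlonglongrightarrow> 0"
  proof (rule Lim_null_comparison)
    let ?I = "\<lambda>n. indicat_real (margin (2 * \<delta> n))"
    have I: "AE x in LI. \<bar>?I n x\<bar> \<le> 1" for n by (simp add: indicator_def)
    note Im = indicator_margin_measurable
    have "(LINT x|LI. (deriv (cutoff 0 1 (\<delta> n)) x * y x) * p x) =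
        (LINT x|LI. (deriv (cutoff 0 1 (\<delta> n)) x * (?I n x * p x)) * (?I n x * y x))" for n
    proof (rule Bochner_Integration.integral_cong[OF refl])
      fix x assume "x \<in> space LI"
      then have "x \<notin> margin (2 * \<delta> n) \<Longrightarrow> deriv (cutoff 0 1 (\<delta> n)) x = 0"
        using \<delta>[of n] by (intro deriv_cutoff_eq_0) (auto simp: margin_def)
      then show "deriv (cutoff 0 1 (\<delta> n)) x * y x * p x =
          deriv (cutoff 0 1 (\<delta> n)) x * (?I n x * p x) * (?I n x * y x)"
        by (cases "x \<in> margin (2 * \<delta> n)") auto
    qed
    moreover have "\<bar>LINT x|LI. (deriv (cutoff 0 1 (\<delta> n)) x * (?I n x * p x)) * (?I n x * y x)\<bar>
        \<le> 4 * C * sq.N LI (weak_deriv p) * sq.N LI (\<lambda>x. ?I n x * y x)" for n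
    proof -
      have Ip: "(\<lambda>x. ?I n x * p x) \<in> sqint LI" by (rule sqint_bounded_mult(1)[OF H(1) Im I])
      have Iy: "(\<lambda>x. ?I n x * y x) \<in> sqint LI" by (rule sqint_bounded_mult(1)[OF y(1) Im I])
      have "sq.N LI (\<lambda>x. deriv (cutoff 0 1 (\<delta> n)) x * (?I n x * p x)) \<le> C / \<delta> n * sq.N LI (\<lambda>x. ?I n x * p x)"
        by (rule sq_N_bounded_mult[OF Ip cut_m(2)]) (use C \<delta>[of n] in auto)
      also have "\<dots> \<le> C / \<delta> n * (2 * (2 * \<delta> n) * sq.N LI (weak_deriv p))"
        by (intro mult_left_mono H10_margin[OF H1wD(1)[OF p]]) (use C \<delta>[of n] in auto)
      also have "\<dots> = 4 * C * sq.N LI (weak_deriv p)" using \<delta>[of n] by simp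
      finally have "sq.N LI (\<lambda>x. deriv (cutoff 0 1 (\<delta> n)) x * (?I n x * p x)) * sq.N LI (\<lambda>x. ?I n x * y x)
         \<le> 4 * C * sq.N LI (weak_deriv p) * sq.N LI (\<lambda>x. ?I n x * y x)"
        by (rule mult_right_mono) (rule sq.N_nonneg[OF Iy])
      then show ?thesis using sq.Cauchy_Schwarz[OF dcut[OF \<delta>(1)[of n] Ip] Iy] by linarith
    qed
    ultimately show "\<forall>\<^sub>F n in sequentially. norm (LINT x|LI. (deriv (cutoff 0 1 (\<delta> n)) x * y x) * p x)
        \<le> 4 * C * sq.N LI (weak_deriv p) * sq.N LI (\<lambda>x. ?I n x * y x)" by simp
    have "(\<lambda>n. LINT x|LI. (?I n x * y x)\<^sup>2) \<longlonglongrightarrow> (LINT x|LI. 0)"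
    proof (rule integral_dominated_convergence[where w="\<lambda>x. (y x)\<^sup>2"])
      show "integrable LI (\<lambda>x. (y x)\<^sup>2)" using y(1) by (simp add: sqint_def)
      show "(\<lambda>x. (?I n x * y x)\<^sup>2) \<in> borel_measurable LI" for n
        using sqint_bounded_mult(1)[OF y(1) Im I, of n] unfolding sqint_def
        by (intro borel_measurable_power) blast
      show "AE x in LI. norm ((?I n x * y x)\<^sup>2) \<le> (y x)\<^sup>2" for n by (simp add: indicator_def)
      show "AE x in LI. (\<lambda>n. (?I n x * y x)\<^sup>2) \<longlonglongrightarrow> 0"
      proof (rule AE_I2)
        fix x assume "x \<in> space LI"
        then have x: "0 < x" "x < 1" by auto
        have "(\<lambda>n. 1 / 4 * inverse (real (Suc n))) \<longlonglongrightarrow> 1 / 4 * 0"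
          by (intro tendsto_mult tendsto_const LIMSEQ_inverse_real_of_nat)
        then have "\<forall>\<^sub>F n in sequentially. 1 / 4 * inverse (real (Suc n)) < min x (1 - x) / 2"
          by (rule order_tendstoD) (use x in simp)
        then have "\<forall>\<^sub>F n in sequentially. (?I n x * y x)\<^sup>2 = 0"
        proof eventually_elim
          case (elim n)
          have "\<delta> n = 1 / 4 * inverse (real (Suc n))" by (simp add: \<delta>_def field_simps)
          then have "x \<notin> margin (2 * \<delta> n)"
            using elim by (auto simp: margin_def min_def split: if_splits)
          then show ?case by simp
        qed
        then show "(\<lambda>n. (?I n x * y x)\<^sup>2) \<longlonglongrightarrow> 0" by (rule tendsto_eventually)
      qed
    qed simp
    then have "(\<lambda>n. sq.N LI (\<lambda>x. ?I n x * y x)) \<longlonglongrightarrow> sqrt 0"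
      unfolding sq_N by (intro tendsto_real_sqrt) simp
    then show "(\<lambda>n. 4 * C * sq.N LI (weak_deriv p) * sq.N LI (\<lambda>x. ?I n x * y x)) \<longlonglongrightarrow> 0"
      by (intro tendsto_mult_right_zero) simp
  qed
  have "(\<lambda>n. (LINT x|LI. (deriv (cutoff 0 1 (\<delta> n)) x * y x) * p x) +
      (LINT x|LI. (weak_deriv p x * y x) * cutoff 0 1 (\<delta> n) x)) \<longlonglongrightarrow> 0 + (LINT x|LI. weak_deriv p x * y x)"
    by (rule tendsto_add[OF Z W])
  moreover have "(\<lambda>n. - (LINT x|LI. (p x * y' x) * cutoff 0 1 (\<delta> n) x)) \<longlonglongrightarrow> - (LINT x|LI. p x * y' x)"
    by (rule tendsto_minus[OF R])
  ultimately have "0 + (LINT x|LI. weak_deriv p x * y x) = - (LINT x|LI. p x * y' x)"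
    unfolding B[OF \<delta>(1)] by (rule LIMSEQ_unique)
  then show "(LINT x|LI. weak_deriv p x * y x) = - (LINT x|LI. p x * y' x)" by simp
qed

end

section \<open>Functionals and Bochner integrals\<close>

abbreviation LT :: "real \<Rightarrow> real measure" where "LT T \<equiv> lebesgue_on {0<..<T}"

text \<open>Bounded linear functionals reduce integrals with values in \<open>X\<close> to scalar
  ones. Requiring \<open>C > 0\<close> permits division by \<open>C\<close> in
  \<open>has_integral_into_functional\<close>.\<close>

definition functional :: "(real \<Rightarrow> real) set \<Rightarrow> ((real \<Rightarrow> real) \<Rightarrow> real) \<Rightarrow> real \<Rightarrow> ((real \<Rightarrow> real) \<Rightarrow> real) \<Rightarrow> bool" where
  "functional X Nm C l \<longleftrightarrow> C > 0 \<and>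
    (\<forall>p\<in>X. \<forall>q\<in>X. \<forall>c d. l (\<lambda>x. c * p x + d * q x) = c * l p + d * l q) \<and> (\<forall>p\<in>X. \<bar>l p\<bar> \<le> C * Nm p)"

lemma measurable_LT_AE_lim:
  fixes u :: "nat \<Rightarrow> real \<Rightarrow> real"
  assumes "\<And>n. u n \<in> borel_measurable (LT T)" "AE t in LT T. (\<lambda>n. u n t) \<longlonglongrightarrow> v t"
  shows "v \<in> borel_measurable (LT T)"
proof (rule borel_measurable_lebesgue_on_AE)
  show "(\<lambda>t. lim (\<lambda>n. u n t)) \<in> borel_measurable (LT T)"
    by (rule borel_measurable_lim_metric) (rule assms(1))
  show "AE t in LT T. lim (\<lambda>n. u n t) = v t"
    using assms(2) by eventually_elim (rule limI)
qed simp

lemma integrable_const_LT: "T > 0 \<Longrightarrow> integrable (LT T) (\<lambda>x. c :: real)"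
  by (rule finite_measure.integrable_const, rule finite_measureI) (simp add: emeasure_restrict_space)

locale function_space =
  fixes X :: "(real \<Rightarrow> real) set" and Nm :: "(real \<Rightarrow> real) \<Rightarrow> real"
  assumes X_lincomb: "p \<in> X \<Longrightarrow> q \<in> X \<Longrightarrow> (\<lambda>x. c * p x + d * q x) \<in> X"
begin

lemma X_diff: "p \<in> X \<Longrightarrow> q \<in> X \<Longrightarrow> (\<lambda>x. p x - q x) \<in> X"
  using X_lincomb[of p q 1 "- 1"] by simp

lemma X_scale: "p \<in> X \<Longrightarrow> (\<lambda>x. c * p x) \<in> X"
  using X_lincomb[of p p c 0] by simp

lemma X_sum:
  assumes "finite W" "W \<subseteq> X" "p \<in> X"
  shows "(\<lambda>x. \<Sum>w\<in>W. m w * w x) \<in> X"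
  using assms(1,2)
proof induction
  case empty
  show ?case using X_scale[OF assms(3), of 0] by simp
next
  case (insert w W)
  then show ?case using X_lincomb[of w "\<lambda>x. \<Sum>w\<in>W. m w * w x" "m w" 1] by simp
qed

lemma functional_lincomb:
  assumes "functional X Nm C l" "p \<in> X" "q \<in> X"
  shows "l (\<lambda>x. c * p x + d * q x) = c * l p + d * l q"
  using assms unfolding functional_def by blast

lemma functional_diff:
  assumes "functional X Nm C l" "p \<in> X" "q \<in> X"
  shows "l (\<lambda>x. p x - q x) = l p - l q"
proof -
  show ?thesis using functional_lincomb[OF assms, of 1 "- 1"] by simp
qed

lemma functional_scale:
  assumes "functional X Nm C l" "p \<in> X"
  shows "l (\<lambda>x. c * p x) = c * l p"
proof -
  show ?thesis using functional_lincomb[OF assms(1,2,2), of c 0] by simp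
qed

lemma functional_bound: "functional X Nm C l \<Longrightarrow> p \<in> X \<Longrightarrow> \<bar>l p\<bar> \<le> C * Nm p"
  unfolding functional_def by blast

lemma functional_diff_bound:
  assumes "functional X Nm C l" "p \<in> X" "q \<in> X"
  shows "\<bar>l p - l q\<bar> \<le> C * Nm (\<lambda>x. p x - q x)"
  using functional_bound[OF assms(1) X_diff[OF assms(2,3)]] functional_diff[OF assms] by simp

lemma functional_sum:
  assumes "functional X Nm C l" "finite W" "W \<subseteq> X" "p \<in> X"
  shows "l (\<lambda>x. \<Sum>w\<in>W. m w * w x) = (\<Sum>w\<in>W. m w * l w)"
  using assms(2,3)
proof induction
  case empty
  show ?case using functional_scale[OF assms(1,4), of 0] by simp
next
  case (insert w W)
  have "l (\<lambda>x. m w * w x + 1 * (\<Sum>w\<in>W. m w * w x)) = m w * l w + 1 * l (\<lambda>x. \<Sum>w\<in>W. m w * w x)"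
    by (rule functional_lincomb[OF assms(1)], use insert in simp, rule X_sum[OF insert(1) _ assms(4)], use insert in simp)
  then show ?case using insert by simp
qed

text \<open>The functional may vary with \<open>t\<close> under a common bound, because later the
  derivative at time \<open>t\<close> is paired with the solution at the same time. On a simple
  function the composition is a finite sum of indicators times \<open>L t w\<close>; the common
  bound carries measurability to the limit.\<close>

lemma strongly_measurable_functional:
  assumes f: "strongly_measurable T X Nm f"
    and L: "\<And>t. t \<in> {0<..<T} \<Longrightarrow> functional X Nm C (L t)"
    and m: "\<And>w. w \<in> X \<Longrightarrow> (\<lambda>t. L t w) \<in> borel_measurable (LT T)"
  shows "(\<lambda>t. L t (f t)) \<in> borel_measurable (LT T)"
proof -
  obtain s where s: "\<And>n. simple_into T X (s n)"
    and lim: "AE t in LT T. f t \<in> X \<and> (\<lambda>n. Nm (\<lambda>x. f t x - s n t x)) \<longlonglongrightarrow> 0"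
    using f unfolding strongly_measurable_def by blast
  have "(\<lambda>t. L t (s n t)) \<in> borel_measurable (LT T)" for n
  proof -
    let ?W = "s n ` {0<..<T}"
    have sf: "simple_function (LT T) (s n)" and sX: "?W \<subseteq> X"
      using s[of n] by (auto simp: simple_into_def)
    have fin: "finite ?W" using simple_functionD(1)[OF sf] by simp
    have A: "s n -` {w} \<inter> {0<..<T} \<in> sets (LT T)" for w using simple_functionD(2)[OF sf, of "{w}"] by simp
    have "(\<lambda>t. \<Sum>w\<in>?W. indicat_real (s n -` {w} \<inter> {0<..<T}) t * L t w) \<in> borel_measurable (LT T)"
      by (intro borel_measurable_sum borel_measurable_times borel_measurable_indicator A m) (use sX in auto)
    moreover have "(\<Sum>w\<in>?W. indicat_real (s n -` {w} \<inter> {0<..<T}) t * L t w) = L t (s n t)"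
      if t: "t \<in> {0<..<T}" for t
    proof -
      have "(\<Sum>w\<in>?W. indicat_real (s n -` {w} \<inter> {0<..<T}) t * L t w) = (\<Sum>w\<in>?W. if w = s n t then L t w else 0)"
        by (rule sum.cong) (use t in auto)
      then show ?thesis using fin t by simp
    qed
    ultimately show ?thesis by (subst measurable_cong[where g="\<lambda>t. \<Sum>w\<in>?W. indicat_real (s n -` {w} \<inter> {0<..<T}) t * L t w"]) auto
  qed
  moreover have "AE t in LT T. (\<lambda>n. L t (s n t)) \<longlonglongrightarrow> L t (f t)"
  proof (rule lebesgue_on_mono[OF lim])
    fix t assume ft: "f t \<in> X \<and> (\<lambda>n. Nm (\<lambda>x. f t x - s n t x)) \<longlonglongrightarrow> 0" and t: "t \<in> {0<..<T}"
    have sX: "s n t \<in> X" for n using s[of n] t by (auto simp: simple_into_def)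
    have "\<bar>L t (f t) - L t (s n t)\<bar> \<le> C * Nm (\<lambda>x. f t x - s n t x)" for n
      by (rule functional_diff_bound[OF L[OF t]]) (use ft sX in auto)
    then have "\<forall>\<^sub>F n in sequentially. norm (L t (s n t) - L t (f t)) \<le> C * Nm (\<lambda>x. f t x - s n t x)"
      by (simp add: abs_minus_commute)
    moreover have "(\<lambda>n. C * Nm (\<lambda>x. f t x - s n t x)) \<longlonglongrightarrow> 0"
      using ft by (intro tendsto_mult_right_zero) auto
    ultimately have "(\<lambda>n. L t (s n t) - L t (f t)) \<longlonglongrightarrow> 0"
      by (rule Lim_null_comparison)
    then show "(\<lambda>n. L t (s n t)) \<longlonglongrightarrow> L t (f t)" by (rule LIM_zero_cancel)
  qed
  ultimately show ?thesis by (rule measurable_LT_AE_lim)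
qed

lemma simple_functional_integral:
  assumes s: "simple_into T X s" and l: "functional X Nm C l" and "T > 0"
  shows "integrable (LT T) (\<lambda>t. l (s t))" "(LINT t|LT T. l (s t)) = l (simple_integral_into T s)"
    "simple_integral_into T s \<in> X"
proof -
  let ?W = "s ` {0<..<T}"
  have sf: "simple_function (LT T) s" and sX: "?W \<subseteq> X" using s by (auto simp: simple_into_def)
  have fin: "finite ?W" using simple_functionD(1)[OF sf] by simp
  \<comment> \<open>A member of \<open>X\<close> for \<open>X_sum\<close>: it makes the empty sum,
    the zero function, a member of \<open>X\<close>.\<close>
  have "s (T / 2) \<in> X" using sX \<open>T > 0\<close> by auto
  define A where "A = (\<lambda>w. {t\<in>{0<..<T}. s t = w})"
  have A: "A w \<in> sets (LT T)" for w
  proof -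
    have "A w = s -` {w} \<inter> space (LT T)" by (auto simp: A_def)
    then show ?thesis using simple_functionD(2)[OF sf, of "{w}"] by simp
  qed
  have mA: "measure (LT T) (A w) = measure lebesgue (A w)" for w
    by (rule measure_restrict_space) (auto simp: A_def)
  have fm: "emeasure (LT T) (A w) < \<infinity>" for w
  proof -
    have "emeasure (LT T) (A w) \<le> emeasure (LT T) (space (LT T))" by (rule emeasure_space)
    also have "\<dots> < \<infinity>" using \<open>T > 0\<close> by (simp add: emeasure_restrict_space)
    finally show ?thesis .
  qed
  have eq: "(\<Sum>w\<in>?W. indicat_real (A w) t * l w) = l (s t)" if t: "t \<in> {0<..<T}" for t
  proof -
    have "(\<Sum>w\<in>?W. indicat_real (A w) t * l w) = (\<Sum>w\<in>?W. if w = s t then l w else 0)"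
      by (rule sum.cong) (use t in \<open>auto simp: A_def\<close>)
    then show ?thesis using fin t by simp
  qed
  have i: "integrable (LT T) (\<lambda>t. indicat_real (A w) t * l w)" for w
    by (rule integrable_mult_left, rule integrable_real_indicator[OF A fm])
  have "integrable (LT T) (\<lambda>t. \<Sum>w\<in>?W. indicat_real (A w) t * l w)"
    by (rule Bochner_Integration.integrable_sum) (rule i)
  moreover have "integrable (LT T) (\<lambda>t. \<Sum>w\<in>?W. indicat_real (A w) t * l w) \<longleftrightarrow> integrable (LT T) (\<lambda>t. l (s t))"
    by (rule Bochner_Integration.integrable_cong) (use eq in auto)
  ultimately show "integrable (LT T) (\<lambda>t. l (s t))" by simp
  have "(LINT t|LT T. l (s t)) = (LINT t|LT T. (\<Sum>w\<in>?W. indicat_real (A w) t * l w))"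
    by (rule Bochner_Integration.integral_cong) (use eq in auto)
  also have "\<dots> = (\<Sum>w\<in>?W. measure (LT T) (A w) * l w)"
  proof (subst Bochner_Integration.integral_sum[OF i])
    have "A w \<inter> {0<..<T} = A w" for w by (auto simp: A_def)
    then show "(\<Sum>w\<in>?W. LINT t|LT T. indicat_real (A w) t * l w) = (\<Sum>w\<in>?W. measure (LT T) (A w) * l w)"
      by simp
  qed
  also have "\<dots> = (\<Sum>w\<in>?W. measure lebesgue {t\<in>{0<..<T}. s t = w} * l w)"
    unfolding mA by (simp add: A_def)
  also have "\<dots> = l (simple_integral_into T s)"
    unfolding simple_integral_into_def
    by (rule functional_sum[OF l fin sX \<open>s (T / 2) \<in> X\<close>, symmetric])
  finally show "(LINT t|LT T. l (s t)) = l (simple_integral_into T s)" .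
  show "simple_integral_into T s \<in> X"
    unfolding simple_integral_into_def by (rule X_sum[OF fin sX \<open>s (T / 2) \<in> X\<close>])
qed

text \<open>A bounded functional commutes with integrals of simple functions, and \<open>l\<close>
  applied to the approximations converges in the scalar L1 sense because the error is at most
  \<open>C\<close> times the seminorm of the difference.\<close>

lemma has_integral_into_functional:
  assumes g: "has_integral_into T X Nm g I" and l: "functional X Nm C l" and "T > 0"
  shows "integrable (LT T) (\<lambda>t. l (g t))" "(LINT t|LT T. l (g t)) = l I"
proof -
  have sm: "strongly_measurable T X Nm g" and I: "I \<in> X"
    using g by (auto simp: has_integral_into_def)
  obtain s where s: "\<And>n. simple_into T X (s n)"
    and lim: "(\<lambda>n. \<integral>\<^sup>+ t. ennreal (Nm (\<lambda>x. g t x - s n t x)) \<partial>LT T) \<longlonglongrightarrow> 0"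
    and Il: "(\<lambda>n. Nm (\<lambda>x. simple_integral_into T (s n) x - I x)) \<longlonglongrightarrow> 0"
    using g unfolding has_integral_into_def by blast
  note S = simple_functional_integral[OF s l \<open>T > 0\<close>]
  have C: "C > 0" using l by (simp add: functional_def)
  have gm: "(\<lambda>t. l (g t)) \<in> borel_measurable (LT T)"
    by (rule strongly_measurable_functional[OF sm l]) simp
  have gX: "AE t in LT T. g t \<in> X"
    using sm unfolding strongly_measurable_def by (auto elim: eventually_mono)
  have sm': "(\<lambda>t. l (s n t)) \<in> borel_measurable (LT T)" for n
    by (rule borel_measurable_integrable[OF S(1)])
  have le: "(\<integral>\<^sup>+ t. ennreal (norm (l (s n t) - l (g t))) \<partial>LT T) \<le> ennreal C * (\<integral>\<^sup>+ t. ennreal (Nm (\<lambda>x. g t x - s n t x)) \<partial>LT T)" for n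
  proof -
    \<comment> \<open>The constant is pulled out of the scalar integrand, whose measurability is
      established. The seminorm of the difference has no such guarantee and is therefore only
      compared by monotonicity.\<close>
    have "(\<integral>\<^sup>+ t. ennreal (norm (l (s n t) - l (g t))) \<partial>LT T) =
        (\<integral>\<^sup>+ t. ennreal C * ennreal (norm (l (s n t) - l (g t)) / C) \<partial>LT T)"
      using C by (intro nn_integral_cong) (simp add: ennreal_mult'[symmetric])
    also have "\<dots> = ennreal C * (\<integral>\<^sup>+ t. ennreal (norm (l (s n t) - l (g t)) / C) \<partial>LT T)"
      using gm sm'[of n]
      by (intro nn_integral_cmult measurable_compose[OF _ measurable_ennreal] borel_measurable_divide
          borel_measurable_const) simp
    also have "\<dots> \<le> ennreal C * (\<integral>\<^sup>+ t. ennreal (Nm (\<lambda>x. g t x - s n t x)) \<partial>LT T)"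
    proof (intro mult_left_mono nn_integral_mono_AE)
      show "AE t in LT T. ennreal (norm (l (s n t) - l (g t)) / C) \<le> ennreal (Nm (\<lambda>x. g t x - s n t x))"
      proof (rule lebesgue_on_mono[OF gX])
        fix t assume gt: "g t \<in> X" and t: "t \<in> {0<..<T}"
        have "s n t \<in> X" using s[of n] t by (auto simp: simple_into_def)
        then have "\<bar>l (g t) - l (s n t)\<bar> \<le> C * Nm (\<lambda>x. g t x - s n t x)"
          by (rule functional_diff_bound[OF l gt])
        then show "ennreal (norm (l (s n t) - l (g t)) / C) \<le> ennreal (Nm (\<lambda>x. g t x - s n t x))"
          using C by (intro ennreal_leI) (simp add: pos_divide_le_eq abs_minus_commute mult.commute)
      qed
    qed simp
    finally show ?thesis .
  qed
  have "(\<lambda>n. ennreal C * (\<integral>\<^sup>+ t. ennreal (Nm (\<lambda>x. g t x - s n t x)) \<partial>LT T)) \<longlonglongrightarrow> ennreal C * 0"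
    by (rule ennreal_tendsto_cmult[OF _ lim]) simp
  then have lim0: "(\<lambda>n. ennreal C * (\<integral>\<^sup>+ t. ennreal (Nm (\<lambda>x. g t x - s n t x)) \<partial>LT T)) \<longlonglongrightarrow> 0" by simp
  have L1: "(\<lambda>n. \<integral>\<^sup>+ t. ennreal (norm (l (s n t) - l (g t))) \<partial>LT T) \<longlonglongrightarrow> 0"
    by (rule tendsto_sandwich[OF _ _ tendsto_const lim0]) (use le in auto)
  \<comment> \<open>A single index with finite L1 distance suffices for integrability: the limit
    differs from an integrable function by an integrable one.\<close>
  have "\<forall>\<^sub>F n in sequentially. (\<integral>\<^sup>+ t. ennreal (norm (l (s n t) - l (g t))) \<partial>LT T) < 1"
    using L1 by (rule order_tendstoD) simp
  then obtain n where n: "(\<integral>\<^sup>+ t. ennreal (norm (l (s n t) - l (g t))) \<partial>LT T) < 1"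
    by (auto simp: eventually_sequentially)
  have "integrable (LT T) (\<lambda>t. l (s n t) - l (g t))"
    unfolding integrable_iff_bounded
  proof
    show "(\<lambda>t. l (s n t) - l (g t)) \<in> borel_measurable (LT T)" using gm sm'[of n] by simp
    show "(\<integral>\<^sup>+ t. ennreal (norm (l (s n t) - l (g t))) \<partial>LT T) < \<infinity>"
      by (rule less_trans[OF n]) simp
  qed
  from Bochner_Integration.integrable_diff[OF S(1)[of n] this]
  show int: "integrable (LT T) (\<lambda>t. l (g t))" by simp
  have "(\<lambda>n. LINT t|LT T. l (s n t)) \<longlonglongrightarrow> (LINT t|LT T. l (g t))"
    by (rule tendsto_L1_int[OF S(1) int L1])
  moreover have "(\<lambda>n. LINT t|LT T. l (s n t)) \<longlonglongrightarrow> l I"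
  proof (rule LIM_zero_cancel, rule Lim_null_comparison)
    show "\<forall>\<^sub>F n in sequentially. norm ((LINT t|LT T. l (s n t)) - l I) \<le> C * Nm (\<lambda>x. simple_integral_into T (s n) x - I x)"
      unfolding S(2) real_norm_def by (intro always_eventually allI functional_diff_bound[OF l S(3) I])
    show "(\<lambda>n. C * Nm (\<lambda>x. simple_integral_into T (s n) x - I x)) \<longlonglongrightarrow> 0"
      by (rule tendsto_mult_right_zero[OF Il])
  qed
  ultimately show "(LINT t|LT T. l (g t)) = l I" by (rule LIMSEQ_unique)
qed

lemma strongly_measurable_AE: "strongly_measurable T X Nm f \<Longrightarrow> AE t in LT T. f t \<in> X"
  unfolding strongly_measurable_def by (auto elim: eventually_mono)

text \<open>Under \<open>l\<close>, the common value \<open>I\<close> of the two integrals in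
  \<open>has_time_deriv\<close> becomes the weak derivative identity for the scalar function
  \<open>l (f t)\<close>. That function is continuous by \<open>C_time\<close>, so
  \<open>du_Bois_Reymond\<close> yields increments between arbitrary times.\<close>

lemma functional_time_derivative:
  assumes f: "f \<in> C_time T X Nm" and f': "strongly_measurable T X Nm f'" "integrable (LT T) (\<lambda>t. (Nm (f' t))\<^sup>2)"
    and td: "has_time_deriv T X Nm f f'" and l: "functional X Nm C l" and st: "0 \<le> s" "s < t" "t \<le> T"
  shows "l (f t) - l (f s) = integral {s..t} (\<lambda>\<tau>. l (f' \<tau>))" "integrable (LT T) (\<lambda>\<tau>. l (f' \<tau>))"
proof -
  have "T > 0" using st by linarith
  have C: "C > 0" using l by (simp add: functional_def)
  have fX: "f \<tau> \<in> X" if "\<tau> \<in> {0..T}" for \<tau> using f that by (auto simp: C_time_def)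
  note f'X = strongly_measurable_AE[OF f'(1)]
  show int: "integrable (LT T) (\<lambda>\<tau>. l (f' \<tau>))"
  proof (rule Bochner_Integration.integrable_bound)
    \<comment> \<open>On a bounded interval square integrability gives integrability through x \<le>
      1 + x^2.\<close>
    show "integrable (LT T) (\<lambda>\<tau>. C * (1 + (Nm (f' \<tau>))\<^sup>2))" by (rule integrable_mult_right[OF Bochner_Integration.integrable_add[OF integrable_const_LT[OF \<open>T > 0\<close>] f'(2)]])
    show "(\<lambda>\<tau>. l (f' \<tau>)) \<in> borel_measurable (LT T)"
      by (rule strongly_measurable_functional[OF f'(1) l]) simp
    show "AE \<tau> in LT T. norm (l (f' \<tau>)) \<le> norm (C * (1 + (Nm (f' \<tau>))\<^sup>2))"
      using f'X
    proof eventually_elim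
      case (elim \<tau>)
      have "0 \<le> (Nm (f' \<tau>) - 1)\<^sup>2 + (Nm (f' \<tau>))\<^sup>2 + 1" by simp
      then have "Nm (f' \<tau>) \<le> 1 + (Nm (f' \<tau>))\<^sup>2" by (simp add: power2_diff)
      then have "\<bar>l (f' \<tau>)\<bar> \<le> C * (1 + (Nm (f' \<tau>))\<^sup>2)"
        using functional_bound[OF l elim] C by (meson less_imp_le mult_left_mono order_trans)
      then show ?case by simp
    qed
  qed
  show "l (f t) - l (f s) = integral {s..t} (\<lambda>\<tau>. l (f' \<tau>))"
  proof (rule du_Bois_Reymond[OF _ int _ st])
    show "continuous_on {0..T} (\<lambda>\<tau>. l (f \<tau>))"
      unfolding continuous_on_def
    proof
      fix \<tau> assume \<tau>: "\<tau> \<in> {0..T}"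
      have "((\<lambda>s. Nm (\<lambda>x. f s x - f \<tau> x)) \<longlongrightarrow> 0) (at \<tau> within {0..T})"
        using f \<tau> by (auto simp: C_time_def)
      from tendsto_mult_right_zero[OF this, of C]
      have "((\<lambda>s. l (f s) - l (f \<tau>)) \<longlongrightarrow> 0) (at \<tau> within {0..T})"
      proof (rule Lim_null_comparison[rotated])
        have "\<forall>\<^sub>F s in at \<tau> within {0..T}. s \<in> {0..T}" by (simp add: eventually_at_filter)
        then show "\<forall>\<^sub>F s in at \<tau> within {0..T}. norm (l (f s) - l (f \<tau>)) \<le> C * Nm (\<lambda>x. f s x - f \<tau> x)"
          by eventually_elim (simp add: functional_diff_bound[OF l fX fX[OF \<tau>]])
      qed
      then show "((\<lambda>\<tau>. l (f \<tau>)) \<longlongrightarrow> l (f \<tau>)) (at \<tau> within {0..T})" by (rule LIM_zero_cancel)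
    qed
    fix \<phi> assume "test_function {0<..<T} \<phi>"
    then obtain I where I: "has_integral_into T X Nm (\<lambda>t x. deriv \<phi> t * f t x) I"
        "has_integral_into T X Nm (\<lambda>t x. - \<phi> t * f' t x) I"
      using td unfolding has_time_deriv_def by blast
    have "(LINT t|LT T. deriv \<phi> t * l (f t)) = (LINT t|LT T. l (\<lambda>x. deriv \<phi> t * f t x))"
      by (rule Bochner_Integration.integral_cong) (use functional_scale[OF l fX] in auto)
    also have "\<dots> = (LINT t|LT T. l (\<lambda>x. - \<phi> t * f' t x))"
      using has_integral_into_functional(2)[OF I(1) l \<open>T > 0\<close>] has_integral_into_functional(2)[OF I(2) l \<open>T > 0\<close>] by simp
    also have "\<dots> = (LINT t|LT T. - (\<phi> t * l (f' t)))"
    proof (rule integral_cong_AE)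
      show "(\<lambda>t. l (\<lambda>x. - \<phi> t * f' t x)) \<in> borel_measurable (LT T)"
        by (rule borel_measurable_integrable[OF has_integral_into_functional(1)[OF I(2) l \<open>T > 0\<close>]])
      have "\<phi> \<in> borel_measurable (LT T)"
        by (rule continuous_imp_measurable_on_sets_lebesgue[OF smooth_continuous_on[OF test_function_smooth]])
          (use \<open>test_function {0<..<T} \<phi>\<close> in auto)
      then show "(\<lambda>t. - (\<phi> t * l (f' t))) \<in> borel_measurable (LT T)"
        using borel_measurable_integrable[OF int] by simp
      show "AE t in LT T. l (\<lambda>x. - \<phi> t * f' t x) = - (\<phi> t * l (f' t))"
        using f'X
      proof eventually_elim
        case (elim t)
        then show ?case using functional_scale[OF l elim, of "- \<phi> t"] by simp
      qed
    qed
    finally show "(LINT t|LT T. deriv \<phi> t * l (f t)) = - (LINT t|LT T. \<phi> t * l (f' t))" by simp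
  qed
qed

end

section \<open>Absolutely continuous functions on a time interval\<close>

lemma LT_integrable_on:
  fixes f :: "real \<Rightarrow> real"
  assumes "integrable (LT T) f" "0 \<le> s" "t \<le> T"
  shows "integrable (lebesgue_on {s<..<t}) f" "f absolutely_integrable_on {s..t}" "f integrable_on {s..t}"
proof -
  show i: "integrable (lebesgue_on {s<..<t}) f"
    by (rule integrable_lebesgue_on_subset[OF assms(1)]) (use assms in auto)
  then have "f absolutely_integrable_on {s<..<t}"
    by (simp add: set_integrable_def integrable_restrict_space)
  then show a: "f absolutely_integrable_on {s..t}"
    by (simp add: absolutely_integrable_on_Icc_iff_Ioo)
  then show "f integrable_on {s..t}" by (rule set_lebesgue_integral_eq_integral(1))
qed

lemma LT_integral_mono:
  fixes f g :: "real \<Rightarrow> real"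
  assumes f: "integrable (LT T) f" and g: "integrable (LT T) g"
    and le: "AE x in LT T. x \<in> {s..t} \<longrightarrow> f x \<le> g x" and st: "0 \<le> s" "t \<le> T"
  shows "integral {s..t} f \<le> integral {s..t} g"
proof -
  have "AE x in lebesgue. x \<in> {0<..<T} \<longrightarrow> x \<in> {s..t} \<longrightarrow> f x \<le> g x"
    using le by (simp add: AE_restrict_space_iff)
  then have "AE x in lebesgue. x \<in> {s<..<t} \<longrightarrow> f x \<le> g x"
    by eventually_elim (use st in auto)
  then have "AE x in lebesgue_on {s<..<t}. f x \<le> g x" by (simp add: AE_restrict_space_iff)
  then have "(LINT x|lebesgue_on {s<..<t}. f x) \<le> (LINT x|lebesgue_on {s<..<t}. g x)"
    by (intro integral_mono_AE LT_integrable_on(1)[OF f st] LT_integrable_on(1)[OF g st])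
  then show ?thesis
    using integral_Ioo_Icc[OF LT_integrable_on(1)[OF f st]] integral_Ioo_Icc[OF LT_integrable_on(1)[OF g st]] by simp
qed

lemma LT_integral_cong:
  fixes f g :: "real \<Rightarrow> real"
  assumes "integrable (LT T) f" "integrable (LT T) g" "AE x in LT T. f x = g x" "0 \<le> s" "t \<le> T"
  shows "integral {s..t} f = integral {s..t} g"
  using assms by (intro antisym LT_integral_mono[of T]) (auto elim: eventually_mono)

lemma LT_integral_le_const:
  fixes f :: "real \<Rightarrow> real"
  assumes "integrable (LT T) f" "AE x in LT T. x \<in> {s..t} \<longrightarrow> f x \<le> c" "0 \<le> s" "s \<le> t" "t \<le> T" "T > 0"
  shows "integral {s..t} f \<le> c * (t - s)"
  using LT_integral_mono[OF assms(1) integrable_const_LT[OF assms(6)] assms(2,3,5)] assms(4) by (simp add: mult.commute)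

lemma LT_integrable_continuous_mult:
  fixes f m :: "real \<Rightarrow> real"
  assumes f: "integrable (LT T) f" and m: "continuous_on {0..T} m"
  shows "integrable (LT T) (\<lambda>x. m x * f x)"
proof -
  have "bounded (m ` {0..T})" by (intro compact_imp_bounded compact_continuous_image m) simp
  then obtain C where C: "\<forall>x\<in>{0..T}. \<bar>m x\<bar> \<le> C" by (auto simp: bounded_iff)
  have mm: "m \<in> borel_measurable (LT T)"
    by (rule continuous_imp_measurable_on_sets_lebesgue[OF continuous_on_subset[OF m]]) auto
  show ?thesis
  proof (rule Bochner_Integration.integrable_bound)
    show "integrable (LT T) (\<lambda>x. C * \<bar>f x\<bar>)" by (rule integrable_mult_right[OF integrable_abs[OF f]])
    show "(\<lambda>x. m x * f x) \<in> borel_measurable (LT T)"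
      by (rule borel_measurable_times[OF mm borel_measurable_integrable[OF f]])
    show "AE x in LT T. norm (m x * f x) \<le> norm (C * \<bar>f x\<bar>)"
    proof (rule AE_I2)
      fix x assume "x \<in> space (LT T)"
      then have "x \<in> {0..T}" by simp
      then have "\<bar>m x\<bar> \<le> C" using C by blast
      then have "\<bar>m x\<bar> \<le> \<bar>C\<bar>" by linarith
      then have "\<bar>m x\<bar> * \<bar>f x\<bar> \<le> \<bar>C\<bar> * \<bar>f x\<bar>" by (rule mult_right_mono) simp
      then show "norm (m x * f x) \<le> norm (C * \<bar>f x\<bar>)" by (simp add: abs_mult)
    qed
  qed
qed

text \<open>Replaces the chain rule for absolutely continuous functions: local estimates with a uniformly
  small relative error are summed up over a fine partition.\<close>

lemma local_comparison:
  fixes \<phi> h k :: "real \<Rightarrow> real"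
  assumes "s0 \<le> t0" and h: "h integrable_on {s0..t0}" and k: "k integrable_on {s0..t0}"
    and loc: "\<And>\<delta>. \<delta> > 0 \<Longrightarrow> \<exists>\<eta>>0. \<forall>s t. s0 \<le> s \<longrightarrow> s < t \<longrightarrow> t \<le> t0 \<longrightarrow> t - s < \<eta> \<longrightarrow>
      \<phi> t - \<phi> s \<le> integral {s..t} h + \<delta> * integral {s..t} k"
  shows "\<phi> t0 - \<phi> s0 \<le> integral {s0..t0} h"
proof -
  have main: "\<phi> t0 - \<phi> s0 \<le> integral {s0..t0} h + \<delta> * integral {s0..t0} k" if "\<delta> > 0" for \<delta>
  proof (cases "s0 = t0")
    case False
    then have "s0 < t0" using assms(1) by simp
    obtain \<eta> where \<eta>: "\<eta> > 0" and le: "\<And>s t. s0 \<le> s \<Longrightarrow> s < t \<Longrightarrow> t \<le> t0 \<Longrightarrow> t - s < \<eta> \<Longrightarrow>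
        \<phi> t - \<phi> s \<le> integral {s..t} h + \<delta> * integral {s..t} k"
      using loc[OF \<open>\<delta> > 0\<close>] by blast
    obtain n where n: "(t0 - s0) / \<eta> < real n" using reals_Archimedean2 by blast
    have "0 < (t0 - s0) / \<eta>" using \<open>s0 < t0\<close> \<eta> by simp
    then have n0: "real n > 0" using n by linarith
    define r where "r = (t0 - s0) / real n"
    have r: "0 < r" "r < \<eta>" "real n * r = t0 - s0"
      using n n0 \<eta> \<open>s0 < t0\<close> by (simp_all add: r_def field_simps)
    have "i \<le> n \<Longrightarrow> \<phi> (s0 + real i * r) - \<phi> s0 \<le>
        integral {s0..s0 + real i * r} h + \<delta> * integral {s0..s0 + real i * r} k" for i
    proof (induction i)
      case 0
      show ?case by simp
    next
      case (Suc i)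
      let ?p = "s0 + real i * r" and ?q = "s0 + real (Suc i) * r"
      have "real (Suc i) * r \<le> real n * r" using Suc.prems r(1) by (intro mult_right_mono) auto
      then have q: "?q \<le> t0" using r(3) by simp
      have p: "s0 \<le> ?p" "?p < ?q" "?q - ?p < \<eta>" using r by (simp_all add: algebra_simps)
      have sub: "h integrable_on {s0..?q}" "k integrable_on {s0..?q}"
        by (rule integrable_subinterval_real[OF h] integrable_subinterval_real[OF k], use q in auto)+
      have "\<phi> ?q - \<phi> ?p \<le> integral {?p..?q} h + \<delta> * integral {?p..?q} k"
        by (rule le[OF p(1,2) q p(3)])
      moreover have "\<phi> ?p - \<phi> s0 \<le> integral {s0..?p} h + \<delta> * integral {s0..?p} k"
        using Suc by simp
      moreover have "integral {s0..?q} h = integral {s0..?p} h + integral {?p..?q} h"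
        using Henstock_Kurzweil_Integration.integral_combine[OF p(1) less_imp_le[OF p(2)] sub(1)] by simp
      moreover have "integral {s0..?q} k = integral {s0..?p} k + integral {?p..?q} k"
        using Henstock_Kurzweil_Integration.integral_combine[OF p(1) less_imp_le[OF p(2)] sub(2)] by simp
      ultimately show ?case by (simp only: distrib_left)
    qed
    from this[of n] show ?thesis using r(3) by simp
  qed simp
  show ?thesis
  proof (rule field_le_epsilon)
    fix e :: real assume "e > 0"
    define K where "K = \<bar>integral {s0..t0} k\<bar> + 1"
    have K: "K > 0" "integral {s0..t0} k \<le> K" by (simp_all add: K_def)
    have "e / K * integral {s0..t0} k \<le> e / K * K"
      using K \<open>e > 0\<close> by (intro mult_left_mono) auto
    then show "\<phi> t0 - \<phi> s0 \<le> integral {s0..t0} h + e"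
      using main[of "e / K"] K \<open>e > 0\<close> by simp
  qed
qed

lemma local_comparison_eq:
  fixes \<phi> h k :: "real \<Rightarrow> real"
  assumes "s0 \<le> t0" and h: "h integrable_on {s0..t0}" and k: "k integrable_on {s0..t0}"
    and loc: "\<And>\<delta>. \<delta> > 0 \<Longrightarrow> \<exists>\<eta>>0. \<forall>s t. s0 \<le> s \<longrightarrow> s < t \<longrightarrow> t \<le> t0 \<longrightarrow> t - s < \<eta> \<longrightarrow>
      \<bar>\<phi> t - \<phi> s - integral {s..t} h\<bar> \<le> \<delta> * integral {s..t} k"
  shows "\<phi> t0 - \<phi> s0 = integral {s0..t0} h"
proof (rule antisym)
  show "\<phi> t0 - \<phi> s0 \<le> integral {s0..t0} h"
  proof (rule local_comparison[OF assms(1) h k])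
    fix \<delta> :: real assume "\<delta> > 0"
    from loc[OF this] show "\<exists>\<eta>>0. \<forall>s t. s0 \<le> s \<longrightarrow> s < t \<longrightarrow> t \<le> t0 \<longrightarrow> t - s < \<eta> \<longrightarrow>
        \<phi> t - \<phi> s \<le> integral {s..t} h + \<delta> * integral {s..t} k"
    proof (elim exE conjE, intro exI conjI allI impI)
      fix \<eta> s t
      assume "\<forall>s t. s0 \<le> s \<longrightarrow> s < t \<longrightarrow> t \<le> t0 \<longrightarrow> t - s < \<eta> \<longrightarrow> \<bar>\<phi> t - \<phi> s - integral {s..t} h\<bar> \<le> \<delta> * integral {s..t} k"
        and "s0 \<le> s" "s < t" "t \<le> t0" "t - s < \<eta>"
      then have "\<bar>\<phi> t - \<phi> s - integral {s..t} h\<bar> \<le> \<delta> * integral {s..t} k" by blast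
      then show "\<phi> t - \<phi> s \<le> integral {s..t} h + \<delta> * integral {s..t} k" by (simp add: abs_le_iff)
    qed
  qed
  have "- \<phi> t0 - - \<phi> s0 \<le> integral {s0..t0} (\<lambda>x. - h x)"
  proof (rule local_comparison[OF assms(1) integrable_neg[OF h] k])
    fix \<delta> :: real assume "\<delta> > 0"
    from loc[OF this] show "\<exists>\<eta>>0. \<forall>s t. s0 \<le> s \<longrightarrow> s < t \<longrightarrow> t \<le> t0 \<longrightarrow> t - s < \<eta> \<longrightarrow>
        - \<phi> t - - \<phi> s \<le> integral {s..t} (\<lambda>x. - h x) + \<delta> * integral {s..t} k"
    proof (elim exE conjE, intro exI conjI allI impI)
      fix \<eta> s t
      assume "\<forall>s t. s0 \<le> s \<longrightarrow> s < t \<longrightarrow> t \<le> t0 \<longrightarrow> t - s < \<eta> \<longrightarrow> \<bar>\<phi> t - \<phi> s - integral {s..t} h\<bar> \<le> \<delta> * integral {s..t} k"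
        and "s0 \<le> s" "s < t" "t \<le> t0" "t - s < \<eta>"
      then have "\<bar>\<phi> t - \<phi> s - integral {s..t} h\<bar> \<le> \<delta> * integral {s..t} k" by blast
      then show "- \<phi> t - - \<phi> s \<le> integral {s..t} (\<lambda>x. - h x) + \<delta> * integral {s..t} k" by (simp add: abs_le_iff)
    qed
  qed
  then show "integral {s0..t0} h \<le> \<phi> t0 - \<phi> s0" by simp
qed

text \<open>Concavity of the logarithm places the increment of \<open>ln g\<close> between the
  increment of \<open>g\<close> divided by \<open>g t\<close> and the same divided by
  \<open>g s\<close>. As \<open>1 / g\<close> is uniformly continuous, on short intervals both are
  within \<open>\<delta>\<close> times the integral of \<open>\<bar>g'\<bar>\<close> of the integral
  of \<open>g' / g\<close>.\<close>

lemma ln_primitive: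
  fixes g g' :: "real \<Rightarrow> real"
  assumes g': "integrable (LT T) g'" and FTC: "\<And>s t. 0 \<le> s \<Longrightarrow> s < t \<Longrightarrow> t \<le> T \<Longrightarrow> g t - g s = integral {s..t} g'"
    and pos: "\<And>t. t \<in> {0..T} \<Longrightarrow> g t > 0" and g: "continuous_on {0..T} g"
    and st0: "0 \<le> s0" "s0 \<le> t0" "t0 \<le> T"
  shows "ln (g t0) - ln (g s0) = integral {s0..t0} (\<lambda>\<tau>. 1 / g \<tau> * g' \<tau>)"
proof (rule local_comparison_eq[OF st0(2), where k="\<lambda>\<tau>. \<bar>g' \<tau>\<bar>"])
  have inv: "continuous_on {0..T} (\<lambda>\<tau>. 1 / g \<tau>)"
    by (intro continuous_on_divide continuous_on_const g ballI) (use pos in force)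
  have q: "integrable (LT T) (\<lambda>\<tau>. 1 / g \<tau> * g' \<tau>)" by (rule LT_integrable_continuous_mult[OF g' inv])
  have ab: "integrable (LT T) (\<lambda>\<tau>. \<bar>g' \<tau>\<bar>)" by (rule integrable_abs[OF g'])
  show "(\<lambda>\<tau>. 1 / g \<tau> * g' \<tau>) integrable_on {s0..t0}" "(\<lambda>\<tau>. \<bar>g' \<tau>\<bar>) integrable_on {s0..t0}"
    by (rule LT_integrable_on(3)[OF q st0(1,3)] LT_integrable_on(3)[OF ab st0(1,3)])+
  fix \<delta> :: real assume "\<delta> > 0"
  then obtain \<eta> where \<eta>: "\<eta> > 0" "\<And>x y. x \<in> {0..T} \<Longrightarrow> y \<in> {0..T} \<Longrightarrow> \<bar>x - y\<bar> < \<eta> \<Longrightarrow> \<bar>1 / g x - 1 / g y\<bar> < \<delta>"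
    using compact_uniformly_continuous[OF inv]
    unfolding uniformly_continuous_on_def dist_real_def by (metis compact_Icc)
  have ln_le: "ln x - ln y \<le> (x - y) / y" if "x > 0" "y > 0" for x y :: real
    using ln_le_minus_one[of "x / y"] that by (simp add: ln_div diff_divide_distrib)
  have "\<bar>ln (g t) - ln (g s) - integral {s..t} (\<lambda>\<tau>. 1 / g \<tau> * g' \<tau>)\<bar> \<le> \<delta> * integral {s..t} (\<lambda>\<tau>. \<bar>g' \<tau>\<bar>)"
    if st: "s0 \<le> s" "s < t" "t \<le> t0" "t - s < \<eta>" for s t
  proof -
    have st': "0 \<le> s" "t \<le> T" "s \<in> {0..T}" "t \<in> {0..T}" using st st0 by auto
    note I = LT_integrable_on(3)[OF _ st'(1,2)]
    have near: "\<bar>1 / g r * integral {s..t} g' - integral {s..t} (\<lambda>\<tau>. 1 / g \<tau> * g' \<tau>)\<bar> \<le> \<delta> * integral {s..t} (\<lambda>\<tau>. \<bar>g' \<tau>\<bar>)"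
      if r: "r \<in> {s..t}" for r
    proof -
      have "1 / g r * integral {s..t} g' - integral {s..t} (\<lambda>\<tau>. 1 / g \<tau> * g' \<tau>) =
          integral {s..t} (\<lambda>\<tau>. 1 / g r * g' \<tau> - 1 / g \<tau> * g' \<tau>)"
        unfolding integral_diff[OF integrable_on_mult_right[OF I[OF g'], of "1 / g r"] I[OF q]]
          Henstock_Kurzweil_Integration.integral_mult_right ..
      also have "norm \<dots> \<le> integral {s..t} (\<lambda>\<tau>. \<delta> * \<bar>g' \<tau>\<bar>)"
      proof (rule integral_norm_bound_integral)
        show "(\<lambda>\<tau>. 1 / g r * g' \<tau> - 1 / g \<tau> * g' \<tau>) integrable_on {s..t}"
          by (intro integrable_diff integrable_on_mult_right[OF I[OF g']] I[OF q])
        show "(\<lambda>\<tau>. \<delta> * \<bar>g' \<tau>\<bar>) integrable_on {s..t}" by (intro integrable_on_mult_right[OF I[OF ab]])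
        fix \<tau> assume "\<tau> \<in> {s..t}"
        then have "\<bar>r - \<tau>\<bar> < \<eta>" "r \<in> {0..T}" "\<tau> \<in> {0..T}" using r st st' by (auto simp: abs_less_iff)
        then have "\<bar>1 / g r - 1 / g \<tau>\<bar> \<le> \<delta>" using \<eta>(2)[of r \<tau>] by simp
        then have "\<bar>1 / g r - 1 / g \<tau>\<bar> * \<bar>g' \<tau>\<bar> \<le> \<delta> * \<bar>g' \<tau>\<bar>" by (rule mult_right_mono) simp
        then show "norm (1 / g r * g' \<tau> - 1 / g \<tau> * g' \<tau>) \<le> \<delta> * \<bar>g' \<tau>\<bar>"
          unfolding left_diff_distrib[symmetric] real_norm_def abs_mult .
      qed
      finally show ?thesis by simp
    qed
    have eq: "integral {s..t} g' = g t - g s" by (rule FTC[OF st'(1) st(2) st'(2), symmetric])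
    have "ln (g t) - ln (g s) \<le> 1 / g s * integral {s..t} g'"
      unfolding eq using ln_le[OF pos[OF st'(4)] pos[OF st'(3)]] by simp
    moreover have "1 / g t * integral {s..t} g' \<le> ln (g t) - ln (g s)"
      unfolding eq using ln_le[OF pos[OF st'(3)] pos[OF st'(4)]] by (simp add: diff_divide_distrib)
    ultimately show ?thesis using near[of s] near[of t] st(2) by (simp only: abs_le_iff atLeastAtMost_iff) linarith
  qed
  then show "\<exists>\<eta>>0. \<forall>s t. s0 \<le> s \<longrightarrow> s < t \<longrightarrow> t \<le> t0 \<longrightarrow> t - s < \<eta> \<longrightarrow>
      \<bar>ln (g t) - ln (g s) - integral {s..t} (\<lambda>\<tau>. 1 / g \<tau> * g' \<tau>)\<bar> \<le> \<delta> * integral {s..t} (\<lambda>\<tau>. \<bar>g' \<tau>\<bar>)"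
    using \<eta>(1) by blast
qed

lemma LT_primitive_continuous:
  fixes g g' :: "real \<Rightarrow> real"
  assumes g': "integrable (LT T) g'" and FTC: "\<And>s t. 0 \<le> s \<Longrightarrow> s < t \<Longrightarrow> t \<le> T \<Longrightarrow> g t - g s = integral {s..t} g'"
  shows "continuous_on {0..T} g"
proof -
  have "continuous_on {0..T} (\<lambda>t. g 0 + integral {0..t} g')"
    by (intro continuous_on_add continuous_on_const indefinite_integral_continuous_1
        LT_integrable_on(3)[OF g']) simp_all
  moreover have "g 0 + integral {0..t} g' = g t" if "t \<in> {0..T}" for t
    using FTC[of 0 t] that by (cases "t = 0") auto
  ultimately show ?thesis by (rule continuous_on_eq)
qed

text \<open>The function \<open>D / (f + e)\<close> is the regularized frequency; its logarithmic derivative is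
  bounded, which makes \<open>ln (f + e)\<close> convex up to controlled errors.\<close>

lemma log_convexity_regularized:
  fixes f f' D D' :: "real \<Rightarrow> real"
  assumes f': "integrable (LT T) f'" and f: "\<And>s t. 0 \<le> s \<Longrightarrow> s < t \<Longrightarrow> t \<le> T \<Longrightarrow> f t - f s = integral {s..t} f'"
    and D': "integrable (LT T) D'" and D: "\<And>s t. 0 \<le> s \<Longrightarrow> s < t \<Longrightarrow> t \<le> T \<Longrightarrow> D t - D s = integral {s..t} D'"
    and nonneg: "\<And>t. t \<in> {0..T} \<Longrightarrow> 0 \<le> f t" "\<And>t. t \<in> {0..T} \<Longrightarrow> 0 \<le> D t"
    and freq: "AE t in LT T. D' t * (f t + e) - D t * f' t \<le> c * (f t + D t) * (f t + e)"
    and bd: "AE t in LT T. f' t \<le> - D t + (1 + 2 * c) * f t \<and> - 3 * D t - (1 + 2 * c) * f t \<le> f' t"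
    and c: "c \<ge> 0" and e: "e > 0" and t0: "0 < t0" "t0 < T"
    and \<mu>: "\<mu> = t0 * exp (- c * T) / (3 * T * exp (c * T))"
  shows "(1 + \<mu>) * ln (f t0 + e) \<le> ln (f 0 + e) + \<mu> * ln (f T + e) + (1 + \<mu>) * (T * (2 + 2 * c))"
proof -
  have T: "T > 0" using t0 by simp
  define g where "g = (\<lambda>t. f t + e)"
  \<comment> \<open>Adding \<open>g\<close> to \<open>D\<close> keeps the logarithm defined where
    \<open>D\<close> vanishes; the quotient \<open>E / g\<close> is the regularized frequency plus
    1.\<close>
  define E where "E = (\<lambda>t. D t + g t)"
  define E' where "E' = (\<lambda>t. D' t + f' t)"
  have gF: "g t - g s = integral {s..t} f'" if "0 \<le> s" "s < t" "t \<le> T" for s t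
    using f[OF that] by (simp add: g_def)
  have EF: "E t - E s = integral {s..t} E'" if "0 \<le> s" "s < t" "t \<le> T" for s t
    using f[OF that] D[OF that] integral_add[OF LT_integrable_on(3)[OF D' that(1,3)] LT_integrable_on(3)[OF f' that(1,3)]]
    by (simp add: E_def E'_def g_def)
  have E': "integrable (LT T) E'" unfolding E'_def by (rule Bochner_Integration.integrable_add[OF D' f'])
  have pos: "g t > 0" "E t > 0" "E t \<ge> g t" if "t \<in> {0..T}" for t
    using nonneg[OF that] e by (auto simp: g_def E_def)
  have gc: "continuous_on {0..T} g" by (rule LT_primitive_continuous[OF f' gF])
  have Ec: "continuous_on {0..T} E" by (rule LT_primitive_continuous[OF E' EF])
  have lng: "ln (g t) - ln (g s) = integral {s..t} (\<lambda>\<tau>. 1 / g \<tau> * f' \<tau>)" if "0 \<le> s" "s \<le> t" "t \<le> T" for s t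
    by (rule ln_primitive[OF f' _ _ gc that]) (use gF pos in auto)
  have lnE: "ln (E t) - ln (E s) = integral {s..t} (\<lambda>\<tau>. 1 / E \<tau> * E' \<tau>)" if "0 \<le> s" "s \<le> t" "t \<le> T" for s t
    by (rule ln_primitive[OF E' _ _ Ec that]) (use EF pos in auto)
  have qg: "integrable (LT T) (\<lambda>\<tau>. 1 / g \<tau> * f' \<tau>)"
    by (rule LT_integrable_continuous_mult[OF f' continuous_on_divide[OF continuous_on_const gc]]) (use pos(1) in force)
  have qE: "integrable (LT T) (\<lambda>\<tau>. 1 / E \<tau> * E' \<tau>)"
    by (rule LT_integrable_continuous_mult[OF E' continuous_on_divide[OF continuous_on_const Ec]]) (use pos(2) in force)
  define M where "M = (\<lambda>t. E t / g t)"
  have M1: "M t \<ge> 1" if "t \<in> {0..T}" for t using pos[OF that] by (simp add: M_def)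
  have Mmono: "M t \<le> M s * exp (c * T)" if st: "0 \<le> s" "s \<le> t" "t \<le> T" for s t
  proof -
    have "(ln (E t) - ln (E s)) - (ln (g t) - ln (g s)) =
        integral {s..t} (\<lambda>\<tau>. 1 / E \<tau> * E' \<tau> - 1 / g \<tau> * f' \<tau>)"
      using lnE[OF st] lng[OF st]
      by (subst integral_diff[OF LT_integrable_on(3)[OF qE st(1,3)] LT_integrable_on(3)[OF qg st(1,3)]]) simp
    also have "\<dots> \<le> c * (t - s)"
    proof (rule LT_integral_le_const[OF Bochner_Integration.integrable_diff[OF qE qg] _ st T])
      show "AE \<tau> in LT T. \<tau> \<in> {s..t} \<longrightarrow> 1 / E \<tau> * E' \<tau> - 1 / g \<tau> * f' \<tau> \<le> c"
      proof (rule lebesgue_on_mono[OF freq], intro impI)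
        fix \<tau> assume fr: "D' \<tau> * (f \<tau> + e) - D \<tau> * f' \<tau> \<le> c * (f \<tau> + D \<tau>) * (f \<tau> + e)" and \<tau>: "\<tau> \<in> {0<..<T}"
        then have \<tau>': "\<tau> \<in> {0..T}" by auto
        \<comment> \<open>In \<open>E' g - E f'\<close> the products \<open>g f'\<close> cancel,
          which leaves exactly the expression bounded by \<open>freq\<close>.\<close>
        have "1 / E \<tau> * E' \<tau> - 1 / g \<tau> * f' \<tau> = (D' \<tau> * g \<tau> - D \<tau> * f' \<tau>) / (E \<tau> * g \<tau>)"
          using pos[OF \<tau>'] by (simp add: field_simps E'_def) (simp add: E_def algebra_simps)
        also have "\<dots> \<le> c"
        proof -
          have "D' \<tau> * g \<tau> - D \<tau> * f' \<tau> \<le> c * (f \<tau> + D \<tau>) * g \<tau>" using fr by (simp add: g_def)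
          also have "\<dots> \<le> c * E \<tau> * g \<tau>"
            using c e pos[OF \<tau>'] by (intro mult_right_mono mult_left_mono) (auto simp: E_def g_def)
          finally show ?thesis using pos[OF \<tau>'] by (simp add: pos_divide_le_eq mult.assoc)
        qed
        finally show "1 / E \<tau> * E' \<tau> - 1 / g \<tau> * f' \<tau> \<le> c" .
      qed
    qed
    also have "c * (t - s) \<le> c * T" using c st by (intro mult_left_mono) auto
    finally have "ln (M t) \<le> ln (M s) + c * T"
      using pos[of s] pos[of t] st by (simp add: M_def ln_div)
    also have "\<dots> = ln (M s * exp (c * T))"
      using M1[of s] st by (subst ln_mult) auto
    finally show ?thesis using M1[of s] M1[of t] st by (subst (asm) ln_le_cancel_iff) auto
  qed
  \<comment> \<open>The frequency is frozen at \<open>t0\<close>: by \<open>Mmono\<close>,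
    \<open>M\<close> is at least \<open>m * exp (- c * T)\<close> before \<open>t0\<close> and at
    most \<open>m * exp (c * T)\<close> after it. The unknown \<open>m\<close> is eliminated at the
    end.\<close>
  define m where "m = M t0"
  \<comment> \<open>Divide by \<open>g\<close> and insert \<open>D = (M - 1) g\<close>. The upper
    constant is 1 + 2c from \<open>f\<close> plus 1 from the shift in \<open>M\<close>.\<close>
  have low: "1 / g \<tau> * f' \<tau> \<le> 2 + 2 * c - M \<tau>" "- 3 * M \<tau> - (1 + 2 * c) \<le> 1 / g \<tau> * f' \<tau>"
    if b: "f' \<tau> \<le> - D \<tau> + (1 + 2 * c) * f \<tau> \<and> - 3 * D \<tau> - (1 + 2 * c) * f \<tau> \<le> f' \<tau>" and \<tau>: "\<tau> \<in> {0<..<T}" for \<tau>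
  proof -
    have \<tau>': "\<tau> \<in> {0..T}" using \<tau> by auto
    have fg: "(1 + 2 * c) * f \<tau> \<le> (1 + 2 * c) * g \<tau>" using c e by (intro mult_left_mono) (auto simp: g_def)
    have Mg: "M \<tau> * g \<tau> = D \<tau> + g \<tau>" using pos[OF \<tau>'] by (simp add: M_def E_def)
    have "f' \<tau> \<le> (2 + 2 * c - M \<tau>) * g \<tau>" using b fg Mg by (simp add: algebra_simps)
    then show "1 / g \<tau> * f' \<tau> \<le> 2 + 2 * c - M \<tau>" using pos[OF \<tau>'] by (simp add: pos_divide_le_eq)
    have "(- 3 * M \<tau> - (1 + 2 * c)) * g \<tau> \<le> f' \<tau>" using b fg Mg pos[OF \<tau>'] by (simp add: algebra_simps)
    then show "- 3 * M \<tau> - (1 + 2 * c) \<le> 1 / g \<tau> * f' \<tau>" using pos[OF \<tau>'] by (simp add: pos_le_divide_eq)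
  qed
  have "ln (g t0) - ln (g 0) \<le> (2 + 2 * c - m * exp (- c * T)) * (t0 - 0)"
    unfolding lng[of 0 t0, OF order_refl less_imp_le[OF t0(1)] less_imp_le[OF t0(2)]]
  proof (rule LT_integral_le_const[OF qg])
    show "AE \<tau> in LT T. \<tau> \<in> {0..t0} \<longrightarrow> 1 / g \<tau> * f' \<tau> \<le> 2 + 2 * c - m * exp (- c * T)"
    proof (rule lebesgue_on_mono[OF bd], intro impI)
      fix \<tau> assume b: "f' \<tau> \<le> - D \<tau> + (1 + 2 * c) * f \<tau> \<and> - 3 * D \<tau> - (1 + 2 * c) * f \<tau> \<le> f' \<tau>"
        and \<tau>: "\<tau> \<in> {0<..<T}" "\<tau> \<in> {0..t0}"
      have "m \<le> M \<tau> * exp (c * T)" unfolding m_def using \<tau> t0 by (intro Mmono) auto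
      then have "m * exp (- c * T) \<le> M \<tau> * exp (c * T) * exp (- c * T)" by (rule mult_right_mono) simp
      then have "m * exp (- c * T) \<le> M \<tau>" by (simp add: mult.assoc flip: exp_add)
      then show "1 / g \<tau> * f' \<tau> \<le> 2 + 2 * c - m * exp (- c * T)" using low(1)[OF b \<tau>(1)] by linarith
    qed
  qed (use t0 in auto)
  then have 1: "ln (g t0) \<le> ln (g 0) + T * (2 + 2 * c) - t0 * exp (- c * T) * m"
    using mult_right_mono[of t0 T "2 + 2 * c"] t0 c by (simp add: algebra_simps)
  have "ln (g t0) - ln (g T) = integral {t0..T} (\<lambda>\<tau>. - (1 / g \<tau> * f' \<tau>))"
    using lng[of t0 T] t0 by simp
  also have "\<dots> \<le> (3 * (m * exp (c * T)) + (1 + 2 * c)) * (T - t0)"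
  proof (rule LT_integral_le_const)
    show "integrable (LT T) (\<lambda>\<tau>. - (1 / g \<tau> * f' \<tau>))" using qg by (rule Bochner_Integration.integrable_minus)
    show "AE \<tau> in LT T. \<tau> \<in> {t0..T} \<longrightarrow> - (1 / g \<tau> * f' \<tau>) \<le> 3 * (m * exp (c * T)) + (1 + 2 * c)"
    proof (rule lebesgue_on_mono[OF bd], intro impI)
      fix \<tau> assume b: "f' \<tau> \<le> - D \<tau> + (1 + 2 * c) * f \<tau> \<and> - 3 * D \<tau> - (1 + 2 * c) * f \<tau> \<le> f' \<tau>"
        and \<tau>: "\<tau> \<in> {0<..<T}" "\<tau> \<in> {t0..T}"
      have "M \<tau> \<le> m * exp (c * T)" unfolding m_def using \<tau> t0 by (intro Mmono) auto
      then show "- (1 / g \<tau> * f' \<tau>) \<le> 3 * (m * exp (c * T)) + (1 + 2 * c)" using low(2)[OF b \<tau>(1)] by linarith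
    qed
  qed (use t0 in auto)
  also have "\<dots> \<le> (3 * (m * exp (c * T)) + (1 + 2 * c)) * T"
    using M1[of t0] t0 c by (intro mult_left_mono add_nonneg_nonneg) (auto simp: m_def)
  finally have 2: "ln (g t0) - ln (g T) - T * (1 + 2 * c) \<le> 3 * T * exp (c * T) * m"
    by (simp add: algebra_simps)
  have \<mu>0: "\<mu> > 0" unfolding \<mu> using t0 by simp
  \<comment> \<open>The weight \<open>\<mu>\<close> is the ratio of the two coefficients of
    \<open>m\<close>, so that \<open>m\<close> cancels when this inequality is added to the one on
    the interval from 0 to \<open>t0\<close>.\<close>
  have "\<mu> * (ln (g t0) - ln (g T) - T * (1 + 2 * c)) \<le> \<mu> * (3 * T * exp (c * T) * m)"
    using 2 \<mu>0 by (intro mult_left_mono) auto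
  also have "\<dots> = t0 * exp (- c * T) * m" unfolding \<mu> using T by simp
  finally have 3: "\<mu> * (ln (g t0) - ln (g T) - T * (1 + 2 * c)) \<le> t0 * exp (- c * T) * m" .
  have "\<mu> * (T * (1 + 2 * c)) \<le> \<mu> * (T * (2 + 2 * c))"
    using \<mu>0 T by (intro mult_left_mono) auto
  then have "(1 + \<mu>) * ln (g t0) \<le> ln (g 0) + \<mu> * ln (g T) + (1 + \<mu>) * (T * (2 + 2 * c))"
    using 1 3 by (simp add: algebra_simps)
  then show ?thesis by (simp add: g_def)
qed

text \<open>Exponentiate the regularized inequality and let \<open>e\<close> tend to 0 from the
  right; neither \<open>c\<close> nor \<open>\<mu>\<close> depends on \<open>e\<close>. The two
  exponents are positive, so the powers remain continuous at base 0, and \<open>f T = 0\<close>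
  forces \<open>f t0 = 0\<close>.\<close>

lemma log_convexity:
  fixes f f' D D' :: "real \<Rightarrow> real"
  assumes f': "integrable (LT T) f'" and f: "\<And>s t. 0 \<le> s \<Longrightarrow> s < t \<Longrightarrow> t \<le> T \<Longrightarrow> f t - f s = integral {s..t} f'"
    and D': "integrable (LT T) D'" and D: "\<And>s t. 0 \<le> s \<Longrightarrow> s < t \<Longrightarrow> t \<le> T \<Longrightarrow> D t - D s = integral {s..t} D'"
    and nonneg: "\<And>t. t \<in> {0..T} \<Longrightarrow> 0 \<le> f t" "\<And>t. t \<in> {0..T} \<Longrightarrow> 0 \<le> D t"
    and freq: "\<And>e. e > 0 \<Longrightarrow> AE t in LT T. D' t * (f t + e) - D t * f' t \<le> c * (f t + D t) * (f t + e)"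
    and bd: "AE t in LT T. f' t \<le> - D t + (1 + 2 * c) * f t \<and> - 3 * D t - (1 + 2 * c) * f t \<le> f' t"
    and c: "c \<ge> 0" and t0: "0 < t0" "t0 < T"
    and \<mu>: "\<mu> = t0 * exp (- c * T) / (3 * T * exp (c * T))"
  shows "f t0 \<le> exp (T * (2 + 2 * c)) * (f 0 powr (1 / (1 + \<mu>)) * f T powr (\<mu> / (1 + \<mu>)))"
proof -
  have \<mu>0: "\<mu> > 0" unfolding \<mu> using t0 by simp
  let ?\<alpha> = "1 / (1 + \<mu>)" and ?\<beta> = "\<mu> / (1 + \<mu>)" and ?C = "T * (2 + 2 * c)"
  have le: "f t0 + e \<le> exp ?C * ((f 0 + e) powr ?\<alpha> * (f T + e) powr ?\<beta>)" if e: "e > 0" for e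
  proof -
    have pos: "f 0 + e > 0" "f t0 + e > 0" "f T + e > 0"
      using nonneg(1)[of 0] nonneg(1)[of t0] nonneg(1)[of T] t0 e by auto
    have "(1 + \<mu>) * ln (f t0 + e) \<le> ln (f 0 + e) + \<mu> * ln (f T + e) + (1 + \<mu>) * ?C"
      by (rule log_convexity_regularized[OF f' f D' D nonneg freq[OF e] bd c e t0 \<mu>])
    then have "(1 + \<mu>) * ln (f t0 + e) \<le> (1 + \<mu>) * (?\<alpha> * ln (f 0 + e) + ?\<beta> * ln (f T + e) + ?C)"
      using \<mu>0 by (simp add: distrib_left)
    then have "ln (f t0 + e) \<le> ?\<alpha> * ln (f 0 + e) + ?\<beta> * ln (f T + e) + ?C"
      using \<mu>0 by (simp add: mult_le_cancel_left_pos)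
    then have "exp (ln (f t0 + e)) \<le> exp (?\<alpha> * ln (f 0 + e) + ?\<beta> * ln (f T + e) + ?C)" by simp
    then show ?thesis using pos by (simp add: powr_def exp_add mult_ac)
  qed
  have lim: "((\<lambda>e. e) \<longlongrightarrow> 0) (at_right (0::real))" by (rule tendsto_ident_at)
  have "((\<lambda>e. exp ?C * ((f 0 + e) powr ?\<alpha> * (f T + e) powr ?\<beta>)) \<longlongrightarrow>
      exp ?C * ((f 0 + 0) powr ?\<alpha> * (f T + 0) powr ?\<beta>)) (at_right 0)"
    using nonneg(1)[of 0] nonneg(1)[of T] t0 \<mu>0
    by (intro tendsto_mult tendsto_const tendsto_powr' tendsto_add lim)
      (auto simp: eventually_at_filter)
  moreover have "((\<lambda>e. f t0 + e) \<longlongrightarrow> f t0 + 0) (at_right 0)"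
    by (intro tendsto_add tendsto_const lim)
  moreover have "\<forall>\<^sub>F e in at_right 0. f t0 + e \<le> exp ?C * ((f 0 + e) powr ?\<alpha> * (f T + e) powr ?\<beta>)"
    using le by (auto simp: eventually_at_filter)
  ultimately have "f t0 + 0 \<le> exp ?C * ((f 0 + 0) powr ?\<alpha> * (f T + 0) powr ?\<beta>)"
    by (rule tendsto_le[rotated 1, OF _ _ _]) simp_all
  then show ?thesis by simp
qed

text \<open>\<open>Nm\<close> is not the seminorm of \<open>B\<close> but merely dominates it.
  Continuity in time and time derivatives refer to \<open>norm_H1w\<close>, and one product rule
  then serves both \<open>B0\<close> and \<open>B1\<close>.\<close>

locale dominated_form = function_space X Nm + semi_inner X B
  for X :: "(real \<Rightarrow> real) set" and Nm :: "(real \<Rightarrow> real) \<Rightarrow> real" and B +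
  assumes B_bound: "p \<in> X \<Longrightarrow> q \<in> X \<Longrightarrow> \<bar>B p q\<bar> \<le> Nm p * Nm q"
    and Nm_nonneg: "p \<in> X \<Longrightarrow> 0 \<le> Nm p"
    and Nm_lincomb: "p \<in> X \<Longrightarrow> q \<in> X \<Longrightarrow> Nm (\<lambda>x. c * p x + d * q x) \<le> \<bar>c\<bar> * Nm p + \<bar>d\<bar> * Nm q"
begin

lemma Nm_diff_le: "p \<in> X \<Longrightarrow> q \<in> X \<Longrightarrow> Nm (\<lambda>x. p x - q x) \<le> Nm p + Nm q"
  using Nm_lincomb[of p q 1 "- 1"] by simp

lemma Nm_triangle:
  assumes "p \<in> X" "q \<in> X" "r \<in> X"
  shows "Nm (\<lambda>x. p x - r x) \<le> Nm (\<lambda>x. p x - q x) + Nm (\<lambda>x. q x - r x)"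
  using Nm_lincomb[OF X_diff[OF assms(1,2)] X_diff[OF assms(2,3)], of 1 1] by simp

lemma Nm_minus_commute:
  assumes "p \<in> X" "q \<in> X"
  shows "Nm (\<lambda>x. p x - q x) = Nm (\<lambda>x. q x - p x)"
  using Nm_lincomb[OF X_diff[OF assms] X_diff[OF assms], of "- 1" 0]
    Nm_lincomb[OF X_diff[OF assms(2,1)] X_diff[OF assms(2,1)], of "- 1" 0] by simp

lemma C_timeD:
  assumes "z \<in> C_time T X Nm" "t \<in> {0..T}"
  shows "z t \<in> X" "((\<lambda>s. Nm (\<lambda>x. z s x - z t x)) \<longlongrightarrow> 0) (at t within {0..T})"
  using assms by (auto simp: C_time_def)

lemma C_time_diff:
  assumes u: "u \<in> C_time T X Nm" and v: "v \<in> C_time T X Nm"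
  shows "(\<lambda>t x. u t x - v t x) \<in> C_time T X Nm"
  unfolding C_time_def
proof (intro CollectI ballI conjI)
  fix t assume t: "t \<in> {0..T}"
  note U = C_timeD[OF u] and V = C_timeD[OF v]
  show "(\<lambda>x. u t x - v t x) \<in> X" by (rule X_diff[OF U(1)[OF t] V(1)[OF t]])
  have "((\<lambda>s. Nm (\<lambda>x. u s x - u t x) + Nm (\<lambda>x. v s x - v t x)) \<longlongrightarrow> 0) (at t within {0..T})"
    using tendsto_add[OF U(2)[OF t] V(2)[OF t]] by simp
  then show "((\<lambda>s. Nm (\<lambda>x. (u s x - v s x) - (u t x - v t x))) \<longlongrightarrow> 0) (at t within {0..T})"
  proof (rule Lim_null_comparison[rotated])
    have "norm (Nm (\<lambda>x. (u s x - v s x) - (u t x - v t x))) \<le> Nm (\<lambda>x. u s x - u t x) + Nm (\<lambda>x. v s x - v t x)"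
      if s: "s \<in> {0..T}" for s
    proof -
      note d = X_diff[OF U(1)[OF s] U(1)[OF t]] X_diff[OF V(1)[OF s] V(1)[OF t]]
      have eq: "(\<lambda>x. (u s x - v s x) - (u t x - v t x)) = (\<lambda>x. (u s x - u t x) - (v s x - v t x))" by auto
      show ?thesis unfolding eq using Nm_diff_le[OF d] Nm_nonneg[OF X_diff[OF d]] by simp
    qed
    then show "\<forall>\<^sub>F s in at t within {0..T}. norm (Nm (\<lambda>x. (u s x - v s x) - (u t x - v t x)))
        \<le> Nm (\<lambda>x. u s x - u t x) + Nm (\<lambda>x. v s x - v t x)" by (auto simp: eventually_at_filter)
  qed
qed

text \<open>Heine-Cantor for values in a seminormed set: \<open>\<eta>\<close> is a Lebesgue number
  of the cover by intervals on which \<open>z\<close> stays within \<epsilon>/2 of its value at the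
  center.\<close>

lemma C_time_uniform:
  assumes z: "z \<in> C_time T X Nm" and "\<epsilon> > 0"
  shows "\<exists>\<eta>>0. \<forall>s\<in>{0..T}. \<forall>t\<in>{0..T}. \<bar>s - t\<bar> < \<eta> \<longrightarrow> Nm (\<lambda>x. z s x - z t x) < \<epsilon>"
proof -
  have "\<exists>d>0. \<forall>s\<in>{0..T}. \<bar>s - t\<bar> < d \<longrightarrow> Nm (\<lambda>x. z s x - z t x) < \<epsilon> / 2" if t: "t \<in> {0..T}" for t
  proof -
    have "\<forall>\<^sub>F s in at t within {0..T}. Nm (\<lambda>x. z s x - z t x) < \<epsilon> / 2"
      using C_timeD(2)[OF z t] by (rule order_tendstoD) (use \<open>\<epsilon> > 0\<close> in simp)
    then obtain d where d: "d > 0" "\<And>s. s \<in> {0..T} \<Longrightarrow> s \<noteq> t \<Longrightarrow> \<bar>s - t\<bar> < d \<Longrightarrow> Nm (\<lambda>x. z s x - z t x) < \<epsilon> / 2"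
      unfolding eventually_at dist_real_def by blast
    \<comment> \<open>The limit says nothing about \<open>s = t\<close> itself; there the difference
      is the zero function, handled by the coefficients 0 and 0.\<close>
    have "Nm (\<lambda>x. z t x - z t x) \<le> 0"
      using Nm_lincomb[OF C_timeD(1)[OF z t] C_timeD(1)[OF z t], of 0 0] by simp
    then show ?thesis using d \<open>\<epsilon> > 0\<close> by (metis half_gt_zero le_less_trans)
  qed
  then obtain d where d: "\<And>t. t \<in> {0..T} \<Longrightarrow> d t > 0"
    "\<And>t s. t \<in> {0..T} \<Longrightarrow> s \<in> {0..T} \<Longrightarrow> \<bar>s - t\<bar> < d t \<Longrightarrow> Nm (\<lambda>x. z s x - z t x) < \<epsilon> / 2" by metis
  have cov: "{0..T} \<subseteq> \<Union> ((\<lambda>t. ball t (d t)) ` {0..T})" using d(1) by force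
  obtain \<eta> where \<eta>: "\<eta> > 0" "\<And>x. x \<in> {0..T} \<Longrightarrow> \<exists>G\<in>(\<lambda>t. ball t (d t)) ` {0..T}. ball x \<eta> \<subseteq> G"
    using Heine_Borel_lemma[OF compact_Icc cov] by auto
  have "Nm (\<lambda>x. z s x - z t x) < \<epsilon>" if st: "s \<in> {0..T}" "t \<in> {0..T}" "\<bar>s - t\<bar> < \<eta>" for s t
  proof -
    obtain r where r: "r \<in> {0..T}" "ball s \<eta> \<subseteq> ball r (d r)" using \<eta>(2)[OF st(1)] by auto
    have "s \<in> ball r (d r)" "t \<in> ball r (d r)" using r(2) \<eta>(1) st(3) by (auto simp: subset_eq dist_real_def)
    then have "Nm (\<lambda>x. z s x - z r x) < \<epsilon> / 2" "Nm (\<lambda>x. z t x - z r x) < \<epsilon> / 2"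
      using d(2)[OF r(1)] st by (auto simp: dist_real_def abs_minus_commute)
    moreover have "Nm (\<lambda>x. z s x - z t x) \<le> Nm (\<lambda>x. z s x - z r x) + Nm (\<lambda>x. z r x - z t x)"
      by (rule Nm_triangle) (use C_timeD(1)[OF z] st r in auto)
    moreover have "Nm (\<lambda>x. z r x - z t x) = Nm (\<lambda>x. z t x - z r x)"
      by (rule Nm_minus_commute) (use C_timeD(1)[OF z] st r in auto)
    ultimately show ?thesis by simp
  qed
  then show ?thesis using \<eta>(1) by blast
qed

lemma C_time_bounded:
  assumes z: "z \<in> C_time T X Nm" and "T > 0"
  shows "\<exists>R>0. \<forall>t\<in>{0..T}. Nm (z t) \<le> R"
proof -
  have "continuous_on {0..T} (\<lambda>t. Nm (z t))"
    unfolding continuous_on_def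
  proof
    fix t assume t: "t \<in> {0..T}"
    have "((\<lambda>s. Nm (z s) - Nm (z t)) \<longlongrightarrow> 0) (at t within {0..T})"
    proof (rule Lim_null_comparison[OF _ C_timeD(2)[OF z t]])
      have "norm (Nm (z s) - Nm (z t)) \<le> Nm (\<lambda>x. z s x - z t x)" if s: "s \<in> {0..T}" for s
      proof -
        note zs = C_timeD(1)[OF z s] and zt = C_timeD(1)[OF z t]
        have "Nm (z s) \<le> Nm (\<lambda>x. z s x - z t x) + Nm (z t)"
          using Nm_lincomb[OF X_diff[OF zs zt] zt, of 1 1] by simp
        moreover have "Nm (z t) \<le> Nm (\<lambda>x. z t x - z s x) + Nm (z s)"
          using Nm_lincomb[OF X_diff[OF zt zs] zs, of 1 1] by simp
        ultimately show ?thesis using Nm_minus_commute[OF zs zt] by simp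
      qed
      then show "\<forall>\<^sub>F s in at t within {0..T}. norm (Nm (z s) - Nm (z t)) \<le> Nm (\<lambda>x. z s x - z t x)"
        by (auto simp: eventually_at_filter)
    qed
    then show "((\<lambda>t. Nm (z t)) \<longlongrightarrow> Nm (z t)) (at t within {0..T})" by (rule LIM_zero_cancel)
  qed
  then have "bounded ((\<lambda>t. Nm (z t)) ` {0..T})"
    by (rule compact_imp_bounded[OF compact_continuous_image[OF _ compact_Icc]])
  then obtain R where R: "R > 0" "\<forall>t\<in>{0..T}. \<bar>Nm (z t)\<bar> \<le> R" by (auto simp: bounded_pos)
  then show ?thesis by (meson abs_le_D1)
qed

lemma functional_B:
  assumes w: "w \<in> X" and C: "Nm w \<le> C" "C > 0"
  shows "functional X Nm C (\<lambda>p. B p w)"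
  unfolding functional_def
proof (intro conjI ballI allI)
  fix p q c d assume p: "p \<in> X" and q: "q \<in> X"
  show "B (\<lambda>x. c * p x + d * q x) w = c * B p w + d * B q w" by (rule B_lincomb[OF p q w])
next
  fix p assume p: "p \<in> X"
  have "Nm p * Nm w \<le> Nm p * C" by (rule mult_left_mono[OF C(1) Nm_nonneg[OF p]])
  then show "\<bar>B p w\<bar> \<le> C * Nm p" using B_bound[OF p w] by (simp add: mult.commute)
qed (rule C(2))

text \<open>By symmetry the increment of \<open>B (z t) (z t)\<close> is the form at
  \<open>z t - z s\<close> and \<open>z t + z s\<close>. With the second argument held fixed,
  \<open>functional_time_derivative\<close> applies to \<open>u\<close> and \<open>v\<close>
  separately; uniform continuity then replaces the fixed argument by \<open>2 * z \<tau>\<close>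
  with a small relative error, and \<open>local_comparison_eq\<close> sums these errors.\<close>

lemma quadratic_time_derivative:
  assumes u: "u \<in> C_time T X Nm" "strongly_measurable T X Nm u'" "integrable (LT T) (\<lambda>t. (Nm (u' t))\<^sup>2)"
      "has_time_deriv T X Nm u u'"
    and v: "v \<in> C_time T X Nm" "strongly_measurable T X Nm v'" "integrable (LT T) (\<lambda>t. (Nm (v' t))\<^sup>2)"
      "has_time_deriv T X Nm v v'"
    and "T > 0"
    and z: "z = (\<lambda>t x. u t x - v t x)" and z': "z' = (\<lambda>t x. u' t x - v' t x)"
  shows "integrable (LT T) (\<lambda>t. 2 * B (z' t) (z t))"
    and "\<And>s t. 0 \<le> s \<Longrightarrow> s < t \<Longrightarrow> t \<le> T \<Longrightarrow>
      B (z t) (z t) - B (z s) (z s) = integral {s..t} (\<lambda>\<tau>. 2 * B (z' \<tau>) (z \<tau>))"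
proof -
  have zC: "z \<in> C_time T X Nm" unfolding z by (rule C_time_diff[OF u(1) v(1)])
  note Z = C_timeD[OF zC]
  have AEX: "AE \<tau> in LT T. u' \<tau> \<in> X \<and> v' \<tau> \<in> X"
    using strongly_measurable_AE[OF u(2)] strongly_measurable_AE[OF v(2)] by eventually_elim simp
  obtain R where R: "R > 0" "\<And>t. t \<in> {0..T} \<Longrightarrow> Nm (z t) \<le> R"
    using C_time_bounded[OF zC \<open>T > 0\<close>] by blast
  \<comment> \<open>An integrable majorant of \<open>Nm (z' \<tau>)\<close>, from x \<le> 1 + x^2
    applied to both solutions.\<close>
  define k where "k = (\<lambda>\<tau>. 2 + (Nm (u' \<tau>))\<^sup>2 + (Nm (v' \<tau>))\<^sup>2)"
  have k: "integrable (LT T) k"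
    unfolding k_def
    by (intro Bochner_Integration.integrable_add u(3) v(3) integrable_const_LT \<open>T > 0\<close>)
  have Nk: "z' \<tau> \<in> X \<and> Nm (z' \<tau>) \<le> k \<tau>" if "u' \<tau> \<in> X \<and> v' \<tau> \<in> X" for \<tau>
  proof -
    have sq: "x \<le> 1 + x\<^sup>2" for x :: real
    proof -
      have "0 \<le> (x - 1)\<^sup>2 + x\<^sup>2 + 1" by simp
      then show ?thesis by (simp add: power2_diff)
    qed
    show ?thesis
      using that X_diff Nm_diff_le[of "u' \<tau>" "v' \<tau>"] sq[of "Nm (u' \<tau>)"] sq[of "Nm (v' \<tau>)"]
      by (auto simp: z' k_def)
  qed
  \<comment> \<open>Here \<open>c\<close> stands for a constant \<open>w\<close> as well as for the
    trajectory \<open>z\<close>; both pairings are needed.\<close>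
  have meas: "(\<lambda>t. B (z' t) (c t)) \<in> borel_measurable (LT T)"
    if c: "\<And>t. t \<in> {0<..<T} \<Longrightarrow> c t \<in> X \<and> Nm (c t) \<le> S" and "S > 0"
      and m: "\<And>w. w \<in> X \<Longrightarrow> (\<lambda>t. B w (c t)) \<in> borel_measurable (LT T)" for c S
  proof (rule borel_measurable_lebesgue_on_AE)
    have "functional X Nm S (\<lambda>p. B p (c t))" if "t \<in> {0<..<T}" for t
      by (rule functional_B) (use c[OF that] \<open>S > 0\<close> in auto)
    then show "(\<lambda>t. B (u' t) (c t) - B (v' t) (c t)) \<in> borel_measurable (LT T)"
      using strongly_measurable_functional[OF u(2), of S "\<lambda>t p. B p (c t)"]
        strongly_measurable_functional[OF v(2), of S "\<lambda>t p. B p (c t)"] m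
      by (intro borel_measurable_diff) auto
    show "AE t in LT T. B (u' t) (c t) - B (v' t) (c t) = B (z' t) (c t)"
    proof (rule lebesgue_on_mono[OF AEX])
      fix t assume uv: "u' t \<in> X \<and> v' t \<in> X" and "t \<in> {0<..<T}"
      then have "c t \<in> X" using c by blast
      then show "B (u' t) (c t) - B (v' t) (c t) = B (z' t) (c t)"
        using B_lincomb[of "u' t" "v' t" "c t" 1 "- 1"] uv by (simp add: z')
    qed
  qed simp
  have int: "integrable (LT T) (\<lambda>t. B (z' t) (c t))"
    if c: "\<And>t. t \<in> {0<..<T} \<Longrightarrow> c t \<in> X \<and> Nm (c t) \<le> S" and "S > 0"
      and m: "\<And>w. w \<in> X \<Longrightarrow> (\<lambda>t. B w (c t)) \<in> borel_measurable (LT T)" for c S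
  proof (rule Bochner_Integration.integrable_bound[OF integrable_mult_right[OF k] meas[OF c \<open>S > 0\<close> m]])
    show "AE t in LT T. norm (B (z' t) (c t)) \<le> norm (S * k t)"
    proof (rule lebesgue_on_mono[OF AEX])
      fix t assume uv: "u' t \<in> X \<and> v' t \<in> X" and t: "t \<in> {0<..<T}"
      note n = Nk[OF uv] c[OF t]
      have "\<bar>B (z' t) (c t)\<bar> \<le> Nm (z' t) * Nm (c t)" using B_bound n by blast
      also have "\<dots> \<le> k t * S" using n \<open>S > 0\<close> Nm_nonneg[of "z' t"] Nm_nonneg[of "c t"] by (intro mult_mono) auto
      finally show "norm (B (z' t) (c t)) \<le> norm (S * k t)" by (simp add: mult.commute)
    qed
  qed
  have intw: "integrable (LT T) (\<lambda>t. B (z' t) w)" if w: "w \<in> X" for w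
    by (rule int[of _ "Nm w + 1"]) (use w Nm_nonneg[OF w] in auto)
  have contB: "continuous_on {0..T} (\<lambda>t. B w (z t))" if w: "w \<in> X" for w
    unfolding continuous_on_def
  proof
    fix t assume t: "t \<in> {0..T}"
    have "((\<lambda>s. B w (z s) - B w (z t)) \<longlongrightarrow> 0) (at t within {0..T})"
    proof (rule Lim_null_comparison[OF _ tendsto_mult_right_zero[OF Z(2)[OF t], of "Nm w"]])
      have "norm (B w (z s) - B w (z t)) \<le> Nm w * Nm (\<lambda>x. z s x - z t x)" if s: "s \<in> {0..T}" for s
        using B_bound[OF w X_diff[OF Z(1)[OF s] Z(1)[OF t]]] B_lincomb_right[OF Z(1)[OF s] Z(1)[OF t] w, of 1 "- 1"]
        by simp
      then show "\<forall>\<^sub>F s in at t within {0..T}. norm (B w (z s) - B w (z t)) \<le> Nm w * Nm (\<lambda>x. z s x - z t x)"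
        by (auto simp: eventually_at_filter)
    qed
    then show "((\<lambda>t. B w (z t)) \<longlongrightarrow> B w (z t)) (at t within {0..T})" by (rule LIM_zero_cancel)
  qed
  have intz: "integrable (LT T) (\<lambda>t. B (z' t) (z t))"
  proof (rule int[OF _ R(1)])
    show "z t \<in> X \<and> Nm (z t) \<le> R" if "t \<in> {0<..<T}" for t using Z(1)[of t] R(2)[of t] that by auto
    show "(\<lambda>t. B w (z t)) \<in> borel_measurable (LT T)" if "w \<in> X" for w
      by (rule continuous_imp_measurable_on_sets_lebesgue[OF continuous_on_subset[OF contB[OF that]]]) auto
  qed
  then show intz2: "integrable (LT T) (\<lambda>t. 2 * B (z' t) (z t))" by (rule integrable_mult_right)
  have weak: "B (z t) w - B (z s) w = integral {s..t} (\<lambda>\<tau>. B (z' \<tau>) w)"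
    if w: "w \<in> X" and st: "0 \<le> s" "s < t" "t \<le> T" for w s t
  proof -
    have l: "functional X Nm (Nm w + 1) (\<lambda>p. B p w)"
      by (rule functional_B[OF w]) (use Nm_nonneg[OF w] in auto)
    note U = functional_time_derivative[OF u l st] and V = functional_time_derivative[OF v l st]
    have lin: "B (\<lambda>x. p x - q x) w = B p w - B q w" if "p \<in> X" "q \<in> X" for p q
      using B_lincomb[OF that w, of 1 "- 1"] by simp
    have "B (z t) w - B (z s) w = (B (u t) w - B (u s) w) - (B (v t) w - B (v s) w)"
      using C_timeD(1)[OF u(1)] C_timeD(1)[OF v(1)] st by (simp add: z lin)
    also have "\<dots> = integral {s..t} (\<lambda>\<tau>. B (u' \<tau>) w - B (v' \<tau>) w)"
      unfolding U(1) V(1)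
      by (rule integral_diff[symmetric]) (use LT_integrable_on(3) U(2) V(2) st in auto)
    also have "\<dots> = integral {s..t} (\<lambda>\<tau>. B (z' \<tau>) w)"
    proof (rule LT_integral_cong[OF Bochner_Integration.integrable_diff[OF U(2) V(2)] intw[OF w] _ st(1,3)])
      show "AE \<tau> in LT T. B (u' \<tau>) w - B (v' \<tau>) w = B (z' \<tau>) w"
        using AEX by eventually_elim (simp add: z' lin)
    qed
    finally show ?thesis .
  qed
  fix s0 t0 :: real assume st0: "0 \<le> s0" "s0 < t0" "t0 \<le> T"
  show "B (z t0) (z t0) - B (z s0) (z s0) = integral {s0..t0} (\<lambda>\<tau>. 2 * B (z' \<tau>) (z \<tau>))"
  proof (rule local_comparison_eq[OF less_imp_le[OF st0(2)] LT_integrable_on(3)[OF intz2 st0(1,3)] LT_integrable_on(3)[OF k st0(1,3)]])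
    fix \<delta> :: real assume "\<delta> > 0"
    \<comment> \<open>Half of \<open>\<delta>\<close>, because \<open>w\<close> minus
      \<open>2 * z \<tau>\<close> is the sum of the two differences \<open>z t - z \<tau>\<close>
      and \<open>z s - z \<tau>\<close>.\<close>
    obtain \<eta> where \<eta>: "\<eta> > 0" "\<And>s t. s \<in> {0..T} \<Longrightarrow> t \<in> {0..T} \<Longrightarrow> \<bar>s - t\<bar> < \<eta> \<Longrightarrow> Nm (\<lambda>x. z s x - z t x) < \<delta> / 2"
      using C_time_uniform[OF zC, of "\<delta> / 2"] \<open>\<delta> > 0\<close> by auto
    have "\<bar>B (z t) (z t) - B (z s) (z s) - integral {s..t} (\<lambda>\<tau>. 2 * B (z' \<tau>) (z \<tau>))\<bar> \<le> \<delta> * integral {s..t} k"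
      if st0': "s0 \<le> s" "s < t" "t \<le> t0" "t - s < \<eta>" for s t
    proof -
      have st: "0 \<le> s" "s < t" "t \<le> T" "t - s < \<eta>" using st0' st0 by auto
      have sX: "z s \<in> X" and tX: "z t \<in> X" using Z(1) st by auto
      define w where "w = (\<lambda>x. z t x + z s x)"
      have w: "w \<in> X" unfolding w_def using X_lincomb[OF tX sX, of 1 1] by simp
      have r: "B p w = B p (z t) + B p (z s)" if "p \<in> X" for p
        unfolding w_def using B_lincomb_right[OF tX sX that, of 1 1] by simp
      have "B (z t) (z t) - B (z s) (z s) = B (z t) w - B (z s) w"
        using r[OF tX] r[OF sX] B_commute[OF tX sX] by simp
      also have "\<dots> = integral {s..t} (\<lambda>\<tau>. B (z' \<tau>) w)" by (rule weak[OF w st(1-3)])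
      finally have eq: "B (z t) (z t) - B (z s) (z s) - integral {s..t} (\<lambda>\<tau>. 2 * B (z' \<tau>) (z \<tau>)) =
          integral {s..t} (\<lambda>\<tau>. B (z' \<tau>) w - 2 * B (z' \<tau>) (z \<tau>))"
        using integral_diff[OF LT_integrable_on(3)[OF intw[OF w] st(1,3)] LT_integrable_on(3)[OF intz2 st(1,3)]]
        by simp
      have bound: "AE \<tau> in LT T. \<tau> \<in> {s..t} \<longrightarrow> \<bar>B (z' \<tau>) w - 2 * B (z' \<tau>) (z \<tau>)\<bar> \<le> \<delta> * k \<tau>"
      proof (rule lebesgue_on_mono[OF AEX], intro impI)
        fix \<tau> assume uv: "u' \<tau> \<in> X \<and> v' \<tau> \<in> X" and \<tau>: "\<tau> \<in> {0<..<T}" "\<tau> \<in> {s..t}"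
        note n = Nk[OF uv]
        have \<tau>X: "z \<tau> \<in> X" using Z(1) \<tau> by auto
        have d: "(\<lambda>x. z t x - z \<tau> x) \<in> X" "(\<lambda>x. z s x - z \<tau> x) \<in> X"
          by (rule X_diff[OF tX \<tau>X] X_diff[OF sX \<tau>X])+
        have "B (z' \<tau>) w - 2 * B (z' \<tau>) (z \<tau>) = B (z' \<tau>) (\<lambda>x. z t x - z \<tau> x) + B (z' \<tau>) (\<lambda>x. z s x - z \<tau> x)"
          using r[of "z' \<tau>"] n B_lincomb_right[OF tX \<tau>X, of "z' \<tau>" 1 "- 1"] B_lincomb_right[OF sX \<tau>X, of "z' \<tau>" 1 "- 1"]
          by simp
        moreover have "\<bar>B (z' \<tau>) (\<lambda>x. z t x - z \<tau> x)\<bar> \<le> k \<tau> * (\<delta> / 2)"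
          by (rule order_trans[OF B_bound[OF _ d(1)] mult_mono])
            (use n \<eta>(2)[of t \<tau>] \<tau> st Nm_nonneg[of "z' \<tau>"] Nm_nonneg[OF d(1)] in auto)
        moreover have "\<bar>B (z' \<tau>) (\<lambda>x. z s x - z \<tau> x)\<bar> \<le> k \<tau> * (\<delta> / 2)"
          by (rule order_trans[OF B_bound[OF _ d(2)] mult_mono])
            (use n \<eta>(2)[of s \<tau>] \<tau> st Nm_nonneg[of "z' \<tau>"] Nm_nonneg[OF d(2)] in auto)
        ultimately have "\<bar>B (z' \<tau>) w - 2 * B (z' \<tau>) (z \<tau>)\<bar> \<le> k \<tau> * (\<delta> / 2) + k \<tau> * (\<delta> / 2)" by linarith
        then show "\<bar>B (z' \<tau>) w - 2 * B (z' \<tau>) (z \<tau>)\<bar> \<le> \<delta> * k \<tau>" by (simp add: mult.commute)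
      qed
      let ?e = "\<lambda>\<tau>. B (z' \<tau>) w - 2 * B (z' \<tau>) (z \<tau>)"
      have ei: "integrable (LT T) ?e" by (rule Bochner_Integration.integrable_diff[OF intw[OF w] intz2])
      have up: "sg * integral {s..t} ?e \<le> \<delta> * integral {s..t} k" if "\<bar>sg\<bar> = 1" for sg
      proof -
        have "integral {s..t} (\<lambda>\<tau>. sg * ?e \<tau>) \<le> integral {s..t} (\<lambda>\<tau>. \<delta> * k \<tau>)"
        proof (rule LT_integral_mono[OF integrable_mult_right[OF ei] integrable_mult_right[OF k] _ st(1,3)])
          show "AE \<tau> in LT T. \<tau> \<in> {s..t} \<longrightarrow> sg * ?e \<tau> \<le> \<delta> * k \<tau>"
            using bound
          proof eventually_elim
            case (elim \<tau>)
            have "sg * ?e \<tau> \<le> \<bar>sg * ?e \<tau>\<bar>" by simp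
            then have "sg * ?e \<tau> \<le> \<bar>?e \<tau>\<bar>" using that by (simp add: abs_mult)
            then show ?case using elim by auto
          qed
        qed
        then show ?thesis by (simp only: Henstock_Kurzweil_Integration.integral_mult_right)
      qed
      show ?thesis
        unfolding eq using up[of 1] up[of "- 1"] by (simp add: abs_le_iff)
    qed
    then show "\<exists>\<eta>>0. \<forall>s t. s0 \<le> s \<longrightarrow> s < t \<longrightarrow> t \<le> t0 \<longrightarrow> t - s < \<eta> \<longrightarrow>
        \<bar>B (z t) (z t) - B (z s) (z s) - integral {s..t} (\<lambda>\<tau>. 2 * B (z' \<tau>) (z \<tau>))\<bar> \<le> \<delta> * integral {s..t} k"
      using \<eta>(1) by blast
  qed
qed

end

section \<open>The parabolic equation\<close>

lemma (in weight) dominated_forms: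
  "dominated_form (H1w a) (norm_H1w a) (B0 a)" "dominated_form (H1w a) (norm_H1w a) B1"
proof -
  have N: "0 \<le> norm_H1w a p" if "p \<in> H1w a" for p
    using h.N_nonneg[OF that] norm_H1w_N[OF that] by simp
  have L: "norm_H1w a (\<lambda>x. c * p x + d * q x) \<le> \<bar>c\<bar> * norm_H1w a p + \<bar>d\<bar> * norm_H1w a q"
    if "p \<in> H1w a" "q \<in> H1w a" for p q c d
    using h.N_lincomb[OF that] norm_H1w_N[OF that(1)] norm_H1w_N[OF that(2)] norm_H1w_N[OF H1w_lincomb[OF that]] by simp
  have BB: "\<bar>B0 a p q\<bar> \<le> norm_H1w a p * norm_H1w a q" "\<bar>B1 p q\<bar> \<le> norm_H1w a p * norm_H1w a q"
    if "p \<in> H1w a" "q \<in> H1w a" for p q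
    using B0_bound[OF that] B1_bound[OF that] norm_H1w_N[OF that(1)] norm_H1w_N[OF that(2)] by simp_all
  show "dominated_form (H1w a) (norm_H1w a) (B0 a)"
    by unfold_locales (rule H1w_lincomb BB(1) N L; assumption)+
  show "dominated_form (H1w a) (norm_H1w a) B1"
    by unfold_locales (rule H1w_lincomb BB(2) N L; assumption)+
qed

text \<open>In terms of \<open>Z = p / sqrt a\<close>, \<open>W = - sqrt a * y'\<close> and \<open>F = pt / sqrt a + W\<close>, the two
  time derivatives are \<open>2 * \<langle>F - W, Z\<rangle>\<close> and \<open>2 * \<langle>F - W, W\<rangle>\<close>; completing the square with \<open>W - F / 2\<close>
  reduces the frequency bound to the Cauchy-Schwarz inequality.\<close>

lemma (in weight) energy_inequalities:
  assumes p: "p \<in> H1w a" and pt: "pt \<in> H1w a"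
    and y: "y \<in> sqint LI" "has_weak_deriv y y'" "AE x in LI. weak_deriv p x = y x"
    and y': "y' \<in> borel_measurable LI" "(\<lambda>x. sqrt (a x) * y' x) \<in> sqint LI"
    and le: "AE x in LI. \<bar>pt x - a x * y' x\<bar> \<le> L * (\<bar>p x\<bar> + sqrt (a x) * \<bar>y x\<bar>)" and "L > 0"
    and c: "c = L\<^sup>2"
  shows "\<And>e. e > 0 \<Longrightarrow> (2 * B1 pt p) * (B0 a p p + e) - B1 p p * (2 * B0 a pt p) \<le> c * (B0 a p p + B1 p p) * (B0 a p p + e)"
    and "2 * B0 a pt p \<le> - B1 p p + (1 + 2 * c) * B0 a p p"
    and "- 3 * B1 p p - (1 + 2 * c) * B0 a p p \<le> 2 * B0 a pt p"
proof -
  define Z where "Z = (\<lambda>x. p x / sqrt (a x))"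
  define S where "S = (\<lambda>x. pt x / sqrt (a x))"
  \<comment> \<open>The term with coefficient 0 gives \<open>W\<close> the shape required by
    \<open>i.lincomb\<close>.\<close>
  define W where "W = (\<lambda>x. (- 1) * (sqrt (a x) * y' x) + 0 * (sqrt (a x) * y' x))"
  define F where "F = (\<lambda>x. 1 * S x + 1 * W x)"
  define ip where "ip = (\<lambda>f g :: real \<Rightarrow> real. LINT x|LI. f x * g x)"
  interpret i: semi_inner "sqint LI" ip unfolding ip_def by (rule sq.semi_inner_axioms)
  have ZS: "Z \<in> sqint LI" "S \<in> sqint LI" unfolding Z_def S_def by (rule H1wD(4)[OF p] H1wD(4)[OF pt])+
  have WS: "W \<in> sqint LI" unfolding W_def by (rule i.lincomb[OF y'(2) y'(2)])
  have FS: "F \<in> sqint LI" unfolding F_def by (rule i.lincomb[OF ZS(2) WS])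
  have B0: "B0 a p p = ip Z Z" "B0 a pt p = ip S Z" by (simp_all add: B0_sqrt ip_def Z_def S_def)
  have B1: "B1 q p = - (LINT x|LI. q x * y' x)" if q: "q \<in> H1w a" for q
  proof -
    note dq = H1D(3)[OF H1wD(2)[OF q]] and dp = H1D(3)[OF H1wD(2)[OF p]]
    have "B1 q p = (LINT x|LI. weak_deriv q x * y x)"
      unfolding B1_def
    proof (rule integral_cong_AE)
      show "(\<lambda>x. weak_deriv q x * weak_deriv p x) \<in> borel_measurable LI" "(\<lambda>x. weak_deriv q x * y x) \<in> borel_measurable LI"
        by (intro borel_measurable_integrable sqint_mult_integrable dq dp y(1))+
      show "AE x in LI. weak_deriv q x * weak_deriv p x = weak_deriv q x * y x"
        using y(3) by eventually_elim simp
    qed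
    then show ?thesis using weighted_integration_by_parts(1)[OF q y(1,2) y'] by simp
  qed
  have WI: "- (LINT x|LI. q x * y' x) = ip (\<lambda>x. q x / sqrt (a x)) W" for q
  proof -
    have "(LINT x|LI. - (q x * y' x)) = (LINT x|LI. q x / sqrt (a x) * W x)"
      by (rule Bochner_Integration.integral_cong) (use a_pos in \<open>auto simp: W_def less_imp_neq[THEN not_sym]\<close>)
    then show ?thesis by (simp add: ip_def)
  qed
  have D: "B1 p p = ip Z W" "B1 pt p = ip S W"
    using B1[OF p] B1[OF pt] WI[of p] WI[of pt] by (simp_all add: Z_def S_def)
  have Dy: "B1 p p = (LINT x|LI. (y x)\<^sup>2)"
    unfolding B1_def
  proof (rule integral_cong_AE)
    show "(\<lambda>x. weak_deriv p x * weak_deriv p x) \<in> borel_measurable LI"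
      by (intro borel_measurable_integrable sqint_mult_integrable H1D(3)[OF H1wD(2)[OF p]])
    show "(\<lambda>x. (y x)\<^sup>2) \<in> borel_measurable LI"
      by (intro borel_measurable_power) (use y(1) in \<open>simp add: sqint_def\<close>)
    show "AE x in LI. weak_deriv p x * weak_deriv p x = (y x)\<^sup>2"
      using y(3) by eventually_elim (simp add: power2_eq_square)
  qed
  have SZ: "ip S Z = ip F Z - ip W Z"
    using i.B_lincomb[OF ZS(2) WS ZS(1), of 1 1] by (simp add: F_def)
  have SW: "ip S W = ip F W - ip W W"
    using i.B_lincomb[OF ZS(2) WS WS, of 1 1] by (simp add: F_def)
  \<comment> \<open>Pointwise, dividing the hypothesis \<open>le\<close> by
    \<open>sqrt (a x)\<close> gives \<bar>F\<bar> \<le> L (\<bar>Z\<bar> + \<bar>y\<bar>). The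
    squared norm of \<open>y\<close> is the Dirichlet energy, which integration by parts identifies
    with \<open>ip Z W\<close>.\<close>
  have FF: "ip F F \<le> 2 * c * (ip Z Z + ip Z W)"
  proof -
    have "ip F F = (LINT x|LI. (F x)\<^sup>2)" by (simp add: ip_def power2_eq_square)
    also have "\<dots> \<le> (LINT x|LI. 2 * c * ((Z x)\<^sup>2 + (y x)\<^sup>2))"
    proof (rule integral_mono_AE)
      show "integrable LI (\<lambda>x. (F x)\<^sup>2)" using FS by (simp add: sqint_def)
      show "integrable LI (\<lambda>x. 2 * c * ((Z x)\<^sup>2 + (y x)\<^sup>2))" using ZS y(1) by (simp add: sqint_def)
      show "AE x in LI. (F x)\<^sup>2 \<le> 2 * c * ((Z x)\<^sup>2 + (y x)\<^sup>2)"
      proof (rule lebesgue_on_mono[OF le])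
        fix x assume b: "\<bar>pt x - a x * y' x\<bar> \<le> L * (\<bar>p x\<bar> + sqrt (a x) * \<bar>y x\<bar>)" and x: "x \<in> {0<..<1}"
        define r where "r = sqrt (a x)"
        have r: "r > 0" "a x = r * r" using a_pos[OF x] by (simp_all add: r_def)
        have "F x = pt x / r - r * y' x" by (simp add: F_def S_def W_def r_def)
        also have "\<dots> = (pt x - a x * y' x) / r"
          unfolding r(2) using r(1) by (simp add: diff_divide_distrib)
        finally have "F x = (pt x - a x * y' x) / r" .
        then have "\<bar>F x\<bar> = \<bar>pt x - a x * y' x\<bar> / r" using r(1) by simp
        also have "\<dots> \<le> L * (\<bar>p x\<bar> + r * \<bar>y x\<bar>) / r"
          using r(1) by (intro divide_right_mono b[folded r_def]) auto
        also have "\<dots> = L * (\<bar>Z x\<bar> + \<bar>y x\<bar>)"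
          using r(1) unfolding Z_def r_def[symmetric] by (simp add: field_simps)
        finally have "\<bar>F x\<bar>\<^sup>2 \<le> (L * (\<bar>Z x\<bar> + \<bar>y x\<bar>))\<^sup>2" by (rule power_mono) simp
        also have "\<dots> = L\<^sup>2 * (\<bar>Z x\<bar> + \<bar>y x\<bar>)\<^sup>2" by (rule power_mult_distrib)
        also have "\<dots> \<le> L\<^sup>2 * (2 * ((Z x)\<^sup>2 + (y x)\<^sup>2))"
        proof (rule mult_left_mono)
          have "0 \<le> (\<bar>Z x\<bar> - \<bar>y x\<bar>)\<^sup>2" by simp
          then show "(\<bar>Z x\<bar> + \<bar>y x\<bar>)\<^sup>2 \<le> 2 * ((Z x)\<^sup>2 + (y x)\<^sup>2)"
            by (simp add: power2_sum power2_diff)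
        qed simp
        finally show "(F x)\<^sup>2 \<le> 2 * c * ((Z x)\<^sup>2 + (y x)\<^sup>2)" by (simp add: c algebra_simps)
      qed
    qed
    also have "\<dots> = 2 * c * ((LINT x|LI. (Z x)\<^sup>2) + (LINT x|LI. (y x)\<^sup>2))"
      using ZS y(1) by (simp add: sqint_def)
    also have "\<dots> = 2 * c * (ip Z Z + ip Z W)"
      using Dy D(1) by (simp add: ip_def power2_eq_square)
    finally show ?thesis .
  qed
  have c0: "c > 0" using \<open>L > 0\<close> by (simp add: c)
  note comm = i.B_commute[OF WS ZS(1)] i.B_commute[OF FS WS] i.B_commute[OF FS ZS(1)]
  define w where "w = (\<lambda>x. 1 * W x + (- 1 / 2) * F x)"
  have w: "w \<in> sqint LI" unfolding w_def by (rule i.lincomb[OF WS FS])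
  have ww: "ip w w = ip W W - ip F W + ip F F / 4"
    unfolding w_def i.B_lincomb_self[OF WS FS] using comm by (simp add: power2_eq_square)
  have wZ: "ip w Z = ip Z W - ip F Z / 2"
    unfolding w_def i.B_lincomb[OF WS FS ZS(1)] using comm by simp
  have CS: "(ip w Z)\<^sup>2 \<le> ip w w * ip Z Z" by (rule i.Cauchy_Schwarz_square[OF w ZS(1)])
  show "(2 * B1 pt p) * (B0 a p p + e) - B1 p p * (2 * B0 a pt p) \<le> c * (B0 a p p + B1 p p) * (B0 a p p + e)"
    if e: "e > 0" for e
  proof -
    \<comment> \<open>In terms of \<open>w\<close>: \<open>ip F W - ip W W\<close> equals
      \<open>ip F F / 4 - ip w w\<close>, and the remaining products are
      \<open>2 * (ip w Z)\<^sup>2 - (ip F Z)\<^sup>2 / 2\<close>. By Cauchy-Schwarz for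
      \<open>w\<close> and \<open>Z\<close>, only the term with \<open>ip F F\<close> can be
      positive.\<close>
    have id: "(2 * B1 pt p) * (B0 a p p + e) - B1 p p * (2 * B0 a pt p) =
        - 2 * (ip w w * ip Z Z - (ip w Z)\<^sup>2) - 2 * ip w w * e + ip F F / 2 * (ip Z Z + e) - (ip F Z)\<^sup>2 / 2"
      unfolding B0 D SZ SW ww wZ comm(1) by (simp add: power2_eq_square field_simps)
    also have "\<dots> \<le> ip F F / 2 * (ip Z Z + e)"
    proof -
      have "0 \<le> ip w w * e" using i.B_nonneg[OF w] e by simp
      moreover have "- 2 * (r - s) - 2 * t + u - v / 2 \<le> u" if "s \<le> r" "0 \<le> t" "0 \<le> v" for r s t u v :: real
        using that by (simp add: right_diff_distrib)
      ultimately show ?thesis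
        using CS zero_le_power2[of "ip F Z"] unfolding mult.assoc[of 2 "ip w w" e] by blast
    qed
    also have "\<dots> \<le> c * (ip Z Z + ip Z W) * (ip Z Z + e)"
      using FF i.B_nonneg[OF ZS(1)] e by (intro mult_right_mono) auto
    finally show ?thesis unfolding B0 D .
  qed
  have FZ: "\<bar>2 * ip F Z\<bar> \<le> ip Z W + (1 + 2 * c) * ip Z Z"
  proof -
    \<comment> \<open>Young's inequality with weight \<open>2 * c\<close>, chosen to match the
      factor in \<open>FF\<close>, so that after division by \<open>2 * c\<close> the energy
      \<open>ip Z W\<close> appears with coefficient 1.\<close>
    have "0 \<le> ip F F + s * (4 * c * ip F Z) + 4 * c\<^sup>2 * ip Z Z" if "\<bar>s\<bar> = 1" for s
    proof -
      have "s\<^sup>2 = 1" using that by (metis power2_abs one_power2)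
      then show ?thesis
        using i.B_nonneg[OF i.lincomb[OF FS ZS(1), of 1 "s * (2 * c)"]]
        unfolding i.B_lincomb_self[OF FS ZS(1)] by (simp add: power_mult_distrib mult_ac)
    qed
    from this[of 1] this[of "- 1"] have "4 * c * \<bar>ip F Z\<bar> \<le> ip F F + 4 * c\<^sup>2 * ip Z Z"
      by (cases "ip F Z \<ge> 0") auto
    also have "\<dots> \<le> 2 * c * (ip Z W + (1 + 2 * c) * ip Z Z)"
      using FF by (simp add: algebra_simps power2_eq_square)
    finally have "2 * c * \<bar>2 * ip F Z\<bar> \<le> 2 * c * (ip Z W + (1 + 2 * c) * ip Z Z)" by (simp add: abs_mult)
    then show ?thesis using c0 by (simp add: mult_le_cancel_left_pos)
  qed
  \<comment> \<open>Twice \<open>ip S Z\<close> is \<open>2 * ip F Z\<close> minus twice the energy;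
    the bound \<open>FZ\<close> shifts the coefficient -2 by 1 in either direction, to -1 and
    -3.\<close>
  show "2 * B0 a pt p \<le> - B1 p p + (1 + 2 * c) * B0 a p p"
    and "- 3 * B1 p p - (1 + 2 * c) * B0 a p p \<le> 2 * B0 a pt p"
    using FZ unfolding B0 D SZ comm(1) by (simp_all add: abs_le_iff)
qed

section \<open>Differences of powers\<close>

lemma rpow_mono: "0 \<le> r \<Longrightarrow> r \<le> s \<Longrightarrow> 0 \<le> p \<Longrightarrow> rpow r p \<le> rpow s p"
  by (simp add: rpow_def powr_mono2)

text \<open>Mean value theorem with the derivative estimated at the larger endpoint. The case
  \<open>s = 0\<close> is treated by hand because the derivative rule for \<open>powr\<close> is
  applied at positive points only. For \<open>q = 1\<close> the convention in \<open>rpow\<close>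
  makes the middle factor 1.\<close>

lemma rpow_diff_le:
  assumes "0 \<le> s" "s \<le> r" and q: "q \<ge> 1"
  shows "0 \<le> rpow r q - rpow s q" "rpow r q - rpow s q \<le> q * rpow r (q - 1) * (r - s)"
proof -
  show "0 \<le> rpow r q - rpow s q" using rpow_mono[of s r q] assms by simp
  have r1: "r powr (q - 1) = rpow r (q - 1)" if "r > 0" using that by (simp add: rpow_def)
  show "rpow r q - rpow s q \<le> q * rpow r (q - 1) * (r - s)"
  proof (cases "s = r")
    case False
    then have sr: "s < r" "r > 0" using assms by auto
    show ?thesis
    proof (cases "s = 0")
      case True
      have "r powr q = r powr (q - 1) * r" using sr powr_add[of r "q - 1" 1] by simp
      moreover have "1 * (r powr (q - 1) * r) \<le> q * (r powr (q - 1) * r)" using sr q by (intro mult_right_mono) auto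
      ultimately show ?thesis using True q sr r1 by (simp add: rpow_def mult.assoc split: if_splits)
    next
      case False
      then have s: "s > 0" using assms by simp
      have "\<exists>x>s. x < r \<and> r powr q - s powr q = (r - s) * (q * x powr (q - 1))"
        by (rule MVT2[OF sr(1)]) (use s in \<open>auto intro!: derivative_eq_intros\<close>)
      then obtain x where x: "s < x" "x < r" "r powr q - s powr q = (r - s) * (q * x powr (q - 1))" by blast
      have "x powr (q - 1) \<le> r powr (q - 1)" using x s q by (intro powr_mono2) auto
      then have "(r - s) * (q * x powr (q - 1)) \<le> (r - s) * (q * r powr (q - 1))"
        using sr q by (intro mult_left_mono) auto
      then show ?thesis using x(3) q sr r1 by (simp add: rpow_def mult_ac split: if_splits)
    qed
  qed simp
qed

text \<open>The larger of \<bar>r\<bar> and \<bar>s\<bar> determines the derivative bound, so a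
  common \<open>m\<close> is required for both. It will be \<open>rpow K (q - 1)\<close> in Case 1
  and \<open>K * sqrt a\<close> in Case 2.\<close>

lemma rpow_abs_diff_le:
  assumes q: "q \<ge> 1" and m: "rpow \<bar>r\<bar> (q - 1) \<le> m" "rpow \<bar>s\<bar> (q - 1) \<le> m"
  shows "\<bar>rpow \<bar>r\<bar> q - rpow \<bar>s\<bar> q\<bar> \<le> q * m * \<bar>r - s\<bar>"
proof -
  have *: "\<bar>rpow \<bar>r\<bar> q - rpow \<bar>s\<bar> q\<bar> \<le> q * m * \<bar>r - s\<bar>"
    if "\<bar>s\<bar> \<le> \<bar>r\<bar>" "rpow \<bar>r\<bar> (q - 1) \<le> m" for r s
  proof -
    have "\<bar>rpow \<bar>r\<bar> q - rpow \<bar>s\<bar> q\<bar> \<le> q * rpow \<bar>r\<bar> (q - 1) * (\<bar>r\<bar> - \<bar>s\<bar>)"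
      using rpow_diff_le[OF _ that(1) q] by simp
    also have "\<dots> \<le> q * m * \<bar>r - s\<bar>"
    proof (intro mult_mono mult_nonneg_nonneg)
      show r0: "0 \<le> rpow \<bar>r\<bar> (q - 1)" by (simp add: rpow_def)
      show "0 \<le> m" using r0 that(2) by (rule order_trans)
    qed (use that q abs_triangle_ineq2[of r s] in auto)
    finally show ?thesis .
  qed
  show ?thesis
    using *[of s r] *[of r s] m by (cases "\<bar>s\<bar> \<le> \<bar>r\<bar>") (auto simp: abs_minus_commute)
qed

section \<open>Almost everywhere bounds and time slices\<close>

lemma Linf_norm_AE:
  assumes "Linf_norm T f \<le> ereal C"
  shows "AE z in lebesgue_on (Q T). \<bar>f z\<bar> \<le> C"
  using esssup_AE[of "\<lambda>z. ereal \<bar>f z\<bar>" "lebesgue_on (Q T)"]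
proof eventually_elim
  case (elim z)
  then have "ereal \<bar>f z\<bar> \<le> ereal C" using assms unfolding Linf_norm_def by (rule order_trans)
  then show ?case by simp
qed

lemma Linf_bounded:
  assumes "f \<in> Linf T"
  shows "\<exists>C\<ge>0. AE z in lebesgue_on (Q T). \<bar>f z\<bar> \<le> C"
proof -
  have "Linf_norm T f \<le> ereal (max 0 (real_of_ereal (Linf_norm T f)))"
    using assms by (cases "Linf_norm T f") (auto simp: Linf_def)
  then show ?thesis using Linf_norm_AE by (intro exI[of _ "max 0 (real_of_ereal (Linf_norm T f))"]) auto
qed

text \<open>Planar Lebesgue measure is a completion, so the exceptional set is first enclosed in a
  null set \<open>N\<close> of the product of Borel measures, where Fubini applies. The order of the
  variables is then exchanged, since points are pairs \<open>(x, t)\<close> but slices are taken at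
  fixed \<open>t\<close>.\<close>

lemma AE_slice:
  assumes "AE z in lebesgue_on (Q T). P z"
  shows "AE t in LT T. AE x in LI. P (x, t)"
proof -
  have "Q T = box (0, 0) (1, T)" unfolding Q_def by (auto simp: box_def Basis_prod_def)
  then have Qs: "Q T \<in> sets lebesgue" by (metis borel_open open_box sets_completionI_sets sets_lborel)
  have "AE z in lebesgue. z \<in> Q T \<longrightarrow> P z" using assms Qs by (simp add: AE_restrict_space_iff)
  then have "AE z in (lborel :: (real \<times> real) measure). z \<in> Q T \<longrightarrow> P z" by (simp add: AE_completion_iff)
  then obtain N where N: "N \<in> null_sets (lborel :: (real \<times> real) measure)" "\<And>z. z \<notin> N \<Longrightarrow> z \<in> Q T \<Longrightarrow> P z"
    by (auto simp: eventually_ae_filter)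
  have Nm: "N \<in> null_sets (lborel \<Otimes>\<^sub>M lborel)" using N(1) by (simp add: lborel_prod)
  have "AE z in lborel \<Otimes>\<^sub>M lborel. z \<notin> N" by (rule AE_not_in[OF Nm])
  then have 1: "AE x in lborel. AE t in lborel. (x, t) \<notin> N" by (rule lborel_pair.AE_pair)
  have "{z \<in> space (lborel \<Otimes>\<^sub>M lborel). (fst z, snd z) \<notin> N} = space (lborel \<Otimes>\<^sub>M lborel) - N" by auto
  also have "\<dots> \<in> sets (lborel \<Otimes>\<^sub>M lborel)" by (rule sets.compl_sets[OF null_setsD2[OF Nm]])
  finally have "AE t in lborel. AE x in lborel. (x, t) \<notin> N"
    using lborel_pair.AE_commute[of "\<lambda>x t. (x, t) \<notin> N"] 1 by simp
  then have "AE t in lebesgue. AE x in lborel. (x, t) \<notin> N" by (rule AE_completion)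
  then have "AE t in lebesgue. t \<in> {0<..<T} \<longrightarrow> (AE x in LI. P (x, t))"
  proof eventually_elim
    case (elim t)
    show ?case
    proof
      assume t: "t \<in> {0<..<T}"
      have "AE x in lebesgue. (x, t) \<notin> N" using elim by (rule AE_completion)
      then have "AE x in lebesgue. x \<in> {0<..<1} \<longrightarrow> P (x, t)"
        by eventually_elim (use N(2) t in \<open>auto simp: Q_def\<close>)
      then show "AE x in LI. P (x, t)" by (simp add: AE_restrict_space_iff)
    qed
  qed
  then show ?thesis by (simp add: AE_restrict_space_iff)
qed

text \<open>Second derivatives come from two sources: \<open>H2w\<close> provides some
  \<open>g\<close> with weighted integrability, and \<open>is_dx\<close> provides the
  \<open>uxx\<close> of the equation. Uniqueness of weak derivatives identifies them almost
  everywhere on almost every slice.\<close>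

lemma solvesD:
  assumes "solves T a b c d q G u ut ux uxx" and a: "weight a" and "T > 0"
  shows "at_time u \<in> C_time T (H1w a) (norm_H1w a)"
    "strongly_measurable T (H1w a) (norm_H1w a) (at_time ut)"
    "integrable (LT T) (\<lambda>t. (norm_H1w a (at_time ut t))\<^sup>2)"
    "has_time_deriv T (H1w a) (norm_H1w a) (at_time u) (at_time ut)"
    and "AE t in LT T. at_time u t \<in> H1w a \<and> at_time ut t \<in> H1w a \<and>
      (\<exists>g. has_weak_deriv (weak_deriv (at_time u t)) g \<and> g \<in> borel_measurable LI \<and>
        (\<lambda>x. sqrt (a x) * g x) \<in> sqint LI \<and>
        (AE x in LI. weak_deriv (at_time u t) x = ux (x, t)) \<and> (AE x in LI. g x = uxx (x, t))) \<and>
      (AE x in LI. ut (x, t) - a x * uxx (x, t) + b (x, t) / q * rpow \<bar>ux (x, t)\<bar> q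
          + d (x, t) * ux (x, t) + c (x, t) * u (x, t) = G (x, t))" (is "AE t in LT T. ?P t")
proof -
  interpret weight a by (rule a)
  have S: "u \<in> solution_space T a" "is_dt T a u ut" "is_dx T u ux" "is_dx T ux uxx"
      "AE (x, t) in lebesgue_on (Q T). ut (x, t) - a x * uxx (x, t) + b (x, t) / q * rpow \<bar>ux (x, t)\<bar> q
          + d (x, t) * ux (x, t) + c (x, t) * u (x, t) = G (x, t)"
    using assms(1) by (auto simp: solves_def)
  show uC: "at_time u \<in> C_time T (H1w a) (norm_H1w a)" using S(1) by (simp add: solution_space_def)
  show sm: "strongly_measurable T (H1w a) (norm_H1w a) (at_time ut)"
    and "integrable (LT T) (\<lambda>t. (norm_H1w a (at_time ut t))\<^sup>2)"
    and "has_time_deriv T (H1w a) (norm_H1w a) (at_time u) (at_time ut)"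
    using S(2) by (auto simp: is_dt_def L2_time_def)
  have 1: "AE t in LT T. at_time ut t \<in> H1w a"
    using sm unfolding strongly_measurable_def by (auto elim: eventually_mono)
  have 2: "AE t in LT T. at_time u t \<in> H2w a"
    using S(1) unfolding solution_space_def L2_time_def strongly_measurable_def by (auto elim: eventually_mono)
  have 3: "AE t in LT T. has_weak_deriv (at_time u t) (at_time ux t)" "AE t in LT T. has_weak_deriv (at_time ux t) (at_time uxx t)"
    using S(3,4) by (auto simp: is_dx_def)
  have 4: "AE t in LT T. AE x in LI. ut (x, t) - a x * uxx (x, t) + b (x, t) / q * rpow \<bar>ux (x, t)\<bar> q
          + d (x, t) * ux (x, t) + c (x, t) * u (x, t) = G (x, t)"
    using AE_slice[OF S(5)] by simp
  show "AE t in LT T. ?P t"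
    using 1 2 3 4
  proof eventually_elim
    case (elim t)
    obtain g where g: "has_weak_deriv (weak_deriv (at_time u t)) g" "(\<lambda>x. a x * g x) \<in> L2w a"
      using elim(2) by (auto simp: H2w_def)
    have w: "AE x in LI. weak_deriv (at_time u t) x = at_time ux t x"
      by (rule weak_deriv_eq(2)[OF elim(3)])
    have gx: "AE x in LI. g x = at_time uxx t x"
      by (rule has_weak_deriv_unique[OF g(1) elim(4) w])
    \<comment> \<open>\<open>H2w\<close> records measurability only of \<open>a x * g x\<close>;
      division by the positive weight recovers it for \<open>g\<close>.\<close>
    have gm: "g \<in> borel_measurable LI"
    proof (rule borel_measurable_lebesgue_on_AE)
      have "(\<lambda>x. a x * g x) \<in> borel_measurable LI" using g(2) by (simp add: L2w_iff sqint_def)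
      then show "(\<lambda>x. a x * g x / a x) \<in> borel_measurable LI"
        by (rule borel_measurable_divide[OF _ a_measurable])
      show "AE x in LI. a x * g x / a x = g x"
        by (rule AE_I2) (use a_pos in \<open>auto simp: less_imp_neq[THEN not_sym]\<close>)
    qed simp
    have "(\<lambda>x. sqrt (a x) * g x) \<in> sqint LI"
    proof (rule sqint_AE_cong)
      show "(\<lambda>x. a x * g x / sqrt (a x)) \<in> sqint LI" using g(2) by (simp add: L2w_iff)
      show "AE x in LI. a x * g x / sqrt (a x) = sqrt (a x) * g x"
      proof (rule AE_I2)
        fix x assume "x \<in> space LI"
        then have "a x > 0" using a_pos by simp
        then have "a x / sqrt (a x) = sqrt (a x)" by (simp add: real_div_sqrt)
        then show "a x * g x / sqrt (a x) = sqrt (a x) * g x"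
          by (metis times_divide_eq_left)
      qed
    qed simp
    then show ?case
      using elim(1,2,5) g(1) gm w gx by (auto simp: H2w_def at_time_def)
  qed
qed

text \<open>The division of \<open>b\<close> by \<open>q\<close> absorbs the factor \<open>q\<close>
  from the mean value estimate. The required \<open>sqrt a\<close> comes from \<open>b\<close> in
  Case 1 and from the powers of the gradients in Case 2; adding the constants of both cases gives
  one factor valid in either.\<close>

lemma lower_order_bound:
  fixes u v a :: real
  assumes eqs: "ut - a * uxx + b / q * rpow \<bar>ux\<bar> q + d * ux + c * u = G"
      "vt - a * vxx + b / q * rpow \<bar>vx\<bar> q + d * vx + c * v = G"
    and q: "q \<ge> 1" and "a \<ge> 0" and K: "K > 0" and C: "0 \<le> Cb" "0 \<le> Cc" "0 \<le> C0"
    and bnd: "\<bar>b\<bar> \<le> Cb" "\<bar>c\<bar> \<le> Cc"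
    and cases: "(\<bar>b\<bar> + \<bar>d\<bar> \<le> C0 * sqrt a \<and> \<bar>ux\<bar> \<le> K \<and> \<bar>vx\<bar> \<le> K) \<or>
      (rpow \<bar>ux\<bar> (q - 1) \<le> K * sqrt a \<and> rpow \<bar>vx\<bar> (q - 1) \<le> K * sqrt a \<and> \<bar>d\<bar> \<le> C0 * sqrt a)"
  shows "\<bar>(ut - vt) - a * (uxx - vxx)\<bar> \<le>
    (Cc + C0 + C0 * rpow K (q - 1) + Cb * K) * (\<bar>u - v\<bar> + sqrt a * \<bar>ux - vx\<bar>)"
proof -
  let ?R = "rpow \<bar>ux\<bar> q - rpow \<bar>vx\<bar> q" and ?y = "\<bar>ux - vx\<bar>"
  have d: "\<bar>d\<bar> \<le> C0 * sqrt a" using cases by auto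
  have R0: "rpow K (q - 1) \<ge> 0" by (simp add: rpow_def)
  have b: "\<bar>b\<bar> / q * \<bar>?R\<bar> \<le> (C0 * rpow K (q - 1) + Cb * K) * (sqrt a * ?y)"
    using cases
  proof
    assume h: "\<bar>b\<bar> + \<bar>d\<bar> \<le> C0 * sqrt a \<and> \<bar>ux\<bar> \<le> K \<and> \<bar>vx\<bar> \<le> K"
    have "\<bar>?R\<bar> \<le> q * rpow K (q - 1) * ?y"
      by (rule rpow_abs_diff_le[OF q]) (use h q in \<open>auto intro!: rpow_mono\<close>)
    then have "\<bar>b\<bar> / q * \<bar>?R\<bar> \<le> \<bar>b\<bar> / q * (q * rpow K (q - 1) * ?y)" using q by (intro mult_left_mono) auto
    also have "\<dots> = \<bar>b\<bar> * (rpow K (q - 1) * ?y)" using q by simp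
    also have "\<dots> \<le> (C0 * sqrt a) * (rpow K (q - 1) * ?y)" using h R0 by (intro mult_right_mono) auto
    also have "\<dots> = (C0 * rpow K (q - 1)) * (sqrt a * ?y)" by simp
    also have "\<dots> \<le> (C0 * rpow K (q - 1) + Cb * K) * (sqrt a * ?y)"
      using C K \<open>a \<ge> 0\<close> by (intro mult_right_mono) auto
    finally show ?thesis .
  next
    assume h: "rpow \<bar>ux\<bar> (q - 1) \<le> K * sqrt a \<and> rpow \<bar>vx\<bar> (q - 1) \<le> K * sqrt a \<and> \<bar>d\<bar> \<le> C0 * sqrt a"
    have "\<bar>?R\<bar> \<le> q * (K * sqrt a) * ?y" by (rule rpow_abs_diff_le[OF q]) (use h in auto)
    then have "\<bar>b\<bar> / q * \<bar>?R\<bar> \<le> \<bar>b\<bar> / q * (q * (K * sqrt a) * ?y)" using q by (intro mult_left_mono) auto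
    also have "\<dots> = \<bar>b\<bar> * (K * sqrt a * ?y)" using q by simp
    also have "\<dots> \<le> Cb * (K * sqrt a * ?y)" using bnd K \<open>a \<ge> 0\<close> by (intro mult_right_mono) auto
    also have "\<dots> = (Cb * K) * (sqrt a * ?y)" by simp
    also have "\<dots> \<le> (C0 * rpow K (q - 1) + Cb * K) * (sqrt a * ?y)"
      using C R0 \<open>a \<ge> 0\<close> by (intro mult_right_mono) auto
    finally show ?thesis .
  qed
  have "(ut - vt) - a * (uxx - vxx) = - (b / q * ?R) - d * (ux - vx) - c * (u - v)"
    using eqs by (simp add: algebra_simps)
  also have "\<bar>\<dots>\<bar> \<le> \<bar>b / q * ?R\<bar> + \<bar>d * (ux - vx)\<bar> + \<bar>c * (u - v)\<bar>" by linarith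
  also have "\<dots> = \<bar>b\<bar> / q * \<bar>?R\<bar> + \<bar>d\<bar> * ?y + \<bar>c\<bar> * \<bar>u - v\<bar>" using q by (simp add: abs_mult)
  also have "\<dots> \<le> (C0 * rpow K (q - 1) + Cb * K) * (sqrt a * ?y) + (C0 * sqrt a) * ?y + Cc * \<bar>u - v\<bar>"
    by (intro add_mono b mult_right_mono d bnd) auto
  also have "\<dots> \<le> (Cc + C0 + C0 * rpow K (q - 1) + Cb * K) * (\<bar>u - v\<bar> + sqrt a * \<bar>ux - vx\<bar>)"
  proof -
    have "0 \<le> Cc * (sqrt a * ?y)" "0 \<le> (C0 + C0 * rpow K (q - 1) + Cb * K) * \<bar>u - v\<bar>"
      using C K R0 \<open>a \<ge> 0\<close> by auto
    then show ?thesis by (simp add: algebra_simps)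
  qed
  finally show ?thesis .
qed

text \<open>The disjunction is moved inside the quantifiers, so that one pointwise estimate handles
  both cases. In Case 2 the quotients are cleared by the positive factor
  \<open>sqrt (a x)\<close>.\<close>

lemma cases_slice:
  assumes "case1 T a b d C0 K ux vx \<or> case2 T a b d q C0 K ux vx" and a: "weight a"
  shows "AE t in LT T. AE x in LI.
    (\<bar>b (x, t)\<bar> + \<bar>d (x, t)\<bar> \<le> C0 * sqrt (a x) \<and> \<bar>ux (x, t)\<bar> \<le> K \<and> \<bar>vx (x, t)\<bar> \<le> K) \<or>
    (rpow \<bar>ux (x, t)\<bar> (q - 1) \<le> K * sqrt (a x) \<and> rpow \<bar>vx (x, t)\<bar> (q - 1) \<le> K * sqrt (a x) \<and>
      \<bar>d (x, t)\<bar> \<le> C0 * sqrt (a x))"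
  using assms(1)
proof
  assume h: "case1 T a b d C0 K ux vx"
  have "AE z in lebesgue_on (Q T). \<bar>b z\<bar> + \<bar>d z\<bar> \<le> C0 * sqrt (a (fst z)) \<and> \<bar>ux z\<bar> \<le> K \<and> \<bar>vx z\<bar> \<le> K"
    using h Linf_norm_AE[of T ux K] Linf_norm_AE[of T vx K] by (auto simp: case1_def case_prod_unfold)
  from AE_slice[OF this] show ?thesis
  proof eventually_elim
    case (elim t)
    then show ?case by eventually_elim simp
  qed
next
  assume h: "case2 T a b d q C0 K ux vx"
  have "AE z in lebesgue_on (Q T). \<bar>rpow \<bar>ux z\<bar> (q - 1) / sqrt (a (fst z))\<bar> \<le> K \<and>
      \<bar>rpow \<bar>vx z\<bar> (q - 1) / sqrt (a (fst z))\<bar> \<le> K \<and> \<bar>d z\<bar> \<le> C0 * sqrt (a (fst z))"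
    using h Linf_norm_AE[of T "\<lambda>z. rpow \<bar>ux z\<bar> (q - 1) / sqrt (a (fst z))" K]
      Linf_norm_AE[of T "\<lambda>z. rpow \<bar>vx z\<bar> (q - 1) / sqrt (a (fst z))" K]
    by (auto simp: case2_def case_prod_unfold)
  from AE_slice[OF this] show ?thesis
  proof eventually_elim
    case (elim t)
    show ?case
    proof (rule lebesgue_on_mono[OF elim], rule disjI2)
      fix x assume h: "\<bar>rpow \<bar>ux (x, t)\<bar> (q - 1) / sqrt (a (fst (x, t)))\<bar> \<le> K \<and>
          \<bar>rpow \<bar>vx (x, t)\<bar> (q - 1) / sqrt (a (fst (x, t)))\<bar> \<le> K \<and> \<bar>d (x, t)\<bar> \<le> C0 * sqrt (a (fst (x, t)))"
        and x: "x \<in> {0<..<1}"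
      have "sqrt (a x) > 0" using weight.a_pos[OF a x] by simp
      moreover have "rpow \<bar>ux (x, t)\<bar> (q - 1) / sqrt (a x) \<le> K" "rpow \<bar>vx (x, t)\<bar> (q - 1) / sqrt (a x) \<le> K"
        using h by (simp_all only: abs_le_iff fst_conv)
      ultimately show "rpow \<bar>ux (x, t)\<bar> (q - 1) \<le> K * sqrt (a x) \<and> rpow \<bar>vx (x, t)\<bar> (q - 1) \<le> K * sqrt (a x) \<and>
          \<bar>d (x, t)\<bar> \<le> C0 * sqrt (a x)" using h by (simp add: pos_divide_le_eq)
    qed
  qed
qed

text \<open>This is \<open>log_convexity\<close> with the weighted norm for \<open>f\<close>, the
  Dirichlet energy for \<open>D\<close> and \<open>L\<^sup>2\<close> for \<open>c\<close>. The
  explicit \<open>L\<close> and \<open>\<mu>\<close> show that the constant and the exponents do not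
  depend on \<open>u\<close>, \<open>v\<close> or \<open>G\<close>.\<close>

lemma backward_interpolation:
  assumes a: "weight a" and t0: "0 < t0" "t0 < T" and q: "q \<ge> 1" and K: "K > 0" and C: "0 \<le> Cb" "0 \<le> Cc" "0 < C0"
    and bnd: "AE z in lebesgue_on (Q T). \<bar>b z\<bar> \<le> Cb" "AE z in lebesgue_on (Q T). \<bar>c z\<bar> \<le> Cc"
    and u: "solves T a b c d q G u ut ux uxx" and v: "solves T a b c d q G v vt vx vxx"
    and cases: "case1 T a b d C0 K ux vx \<or> case2 T a b d q C0 K ux vx"
    and L: "L = Cc + C0 + C0 * rpow K (q - 1) + Cb * K"
    and \<mu>: "\<mu> = t0 * exp (- L\<^sup>2 * T) / (3 * T * exp (L\<^sup>2 * T))"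
    and z: "z = (\<lambda>t x. at_time u t x - at_time v t x)"
  shows "B0 a (z t0) (z t0) \<le> exp (T * (2 + 2 * L\<^sup>2)) *
    (B0 a (z 0) (z 0) powr (1 / (1 + \<mu>)) * B0 a (z T) (z T) powr (\<mu> / (1 + \<mu>)))"
proof -
  interpret weight a by (rule a)
  have T: "T > 0" using t0 by simp
  have L0: "L > 0"
  proof -
    have "0 \<le> C0 * rpow K (q - 1)" "0 \<le> Cb * K" using C K by (auto simp: rpow_def)
    then show ?thesis unfolding L using C by linarith
  qed
  define z' where "z' = (\<lambda>t x. at_time ut t x - at_time vt t x)"
  note U = solvesD[OF u a T] and V = solvesD[OF v a T]
  note Q0 = dominated_form.quadratic_time_derivative[OF dominated_forms(1) U(1-4) V(1-4) T z z'_def]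
  note Q1 = dominated_form.quadratic_time_derivative[OF dominated_forms(2) U(1-4) V(1-4) T z z'_def]
  have zX: "z t \<in> H1w a" if "t \<in> {0..T}" for t
    using H1w_lincomb[of "at_time u t" "at_time v t" 1 "- 1"] U(1) V(1) that by (simp add: z C_time_def)
  have E: "AE t in LT T. (\<forall>e>0. (2 * B1 (z' t) (z t)) * (B0 a (z t) (z t) + e) - B1 (z t) (z t) * (2 * B0 a (z' t) (z t))
        \<le> L\<^sup>2 * (B0 a (z t) (z t) + B1 (z t) (z t)) * (B0 a (z t) (z t) + e)) \<and>
      2 * B0 a (z' t) (z t) \<le> - B1 (z t) (z t) + (1 + 2 * L\<^sup>2) * B0 a (z t) (z t) \<and>
      - 3 * B1 (z t) (z t) - (1 + 2 * L\<^sup>2) * B0 a (z t) (z t) \<le> 2 * B0 a (z' t) (z t)"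
    using U(5) V(5) cases_slice[OF cases a] AE_slice[OF bnd(1)] AE_slice[OF bnd(2)]
  proof eventually_elim
    case (elim t)
    let ?u = "at_time u t" and ?v = "at_time v t"
    obtain g where g: "has_weak_deriv (weak_deriv ?u) g" "g \<in> borel_measurable LI" "(\<lambda>x. sqrt (a x) * g x) \<in> sqint LI"
        "AE x in LI. weak_deriv ?u x = ux (x, t)" "AE x in LI. g x = uxx (x, t)" using elim(1) by blast
    obtain h where h: "has_weak_deriv (weak_deriv ?v) h" "h \<in> borel_measurable LI" "(\<lambda>x. sqrt (a x) * h x) \<in> sqint LI"
        "AE x in LI. weak_deriv ?v x = vx (x, t)" "AE x in LI. h x = vxx (x, t)" using elim(2) by blast
    have X: "?u \<in> H1w a" "?v \<in> H1w a" "at_time ut t \<in> H1w a" "at_time vt t \<in> H1w a" using elim(1,2) by blast+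
    define y where "y = (\<lambda>x. 1 * weak_deriv ?u x + (- 1) * weak_deriv ?v x)"
    define y' where "y' = (\<lambda>x. 1 * g x + (- 1) * h x)"
    have p: "z t = (\<lambda>x. 1 * ?u x + (- 1) * ?v x)" "z' t = (\<lambda>x. 1 * at_time ut t x + (- 1) * at_time vt t x)"
      by (simp_all add: z z'_def)
    have pX: "z t \<in> H1w a" "z' t \<in> H1w a" unfolding p by (rule H1w_lincomb[OF X(1,2)] H1w_lincomb[OF X(3,4)])+
    have y: "y \<in> sqint LI" "has_weak_deriv y y'" "AE x in LI. weak_deriv (z t) x = y x"
      unfolding y_def y'_def p
      by (rule sqint_lincomb[OF H1D(3)[OF H1wD(2)[OF X(1)]] H1D(3)[OF H1wD(2)[OF X(2)]]]
          has_weak_deriv_lincomb[OF g(1) h(1)] weak_deriv_lincomb[OF H1wD(2)[OF X(1)] H1wD(2)[OF X(2)]])+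
    have y'm: "y' \<in> borel_measurable LI"
      unfolding y'_def by (intro borel_measurable_add borel_measurable_times borel_measurable_const g(2) h(2))
    have y's: "(\<lambda>x. sqrt (a x) * y' x) \<in> sqint LI"
      using sqint_lincomb[OF g(3) h(3), of 1 "- 1"] by (simp add: y'_def algebra_simps)
    \<comment> \<open>Membership in the interval is phrased as an almost everywhere fact so that the
      elimination below can use positivity of \<open>a x\<close>.\<close>
    have "AE x in LI. x \<in> {0<..<1}" by (rule AE_I2) simp
    then have le: "AE x in LI. \<bar>z' t x - a x * y' x\<bar> \<le> L * (\<bar>z t x\<bar> + sqrt (a x) * \<bar>y x\<bar>)"
      using g(4,5) h(4,5) elim(1)[THEN conjunct2, THEN conjunct2, THEN conjunct2]
        elim(2)[THEN conjunct2, THEN conjunct2, THEN conjunct2] elim(3,4,5)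
    proof eventually_elim
      case (elim x)
      have "\<bar>(ut (x, t) - vt (x, t)) - a x * (uxx (x, t) - vxx (x, t))\<bar> \<le>
          L * (\<bar>u (x, t) - v (x, t)\<bar> + sqrt (a x) * \<bar>ux (x, t) - vx (x, t)\<bar>)"
        unfolding L
        by (rule lower_order_bound[OF elim(6,7) q less_imp_le[OF a_pos[OF elim(1)]] K C(1,2) less_imp_le[OF C(3)] elim(9,10,8)])
      then show ?case using elim(2-5) by (simp add: z z'_def y_def y'_def at_time_def)
    qed
    note R = energy_inequalities[OF pX y y'm y's le L0 refl]
    show ?case using R by blast
  qed
  show ?thesis
  proof (rule log_convexity[OF Q0 Q1])
    show "0 \<le> B0 a (z t) (z t)" "0 \<le> B1 (z t) (z t)" if "t \<in> {0..T}" for t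
      using b0.B_nonneg[OF zX[OF that]] b1.B_nonneg[OF zX[OF that]] by simp_all
    show "AE t in LT T. 2 * B1 (z' t) (z t) * (B0 a (z t) (z t) + e) - B1 (z t) (z t) * (2 * B0 a (z' t) (z t))
        \<le> L\<^sup>2 * (B0 a (z t) (z t) + B1 (z t) (z t)) * (B0 a (z t) (z t) + e)" if "e > 0" for e
      using E by eventually_elim (use that in blast)
    show "AE t in LT T. 2 * B0 a (z' t) (z t) \<le> - B1 (z t) (z t) + (1 + 2 * L\<^sup>2) * B0 a (z t) (z t) \<and>
        - 3 * B1 (z t) (z t) - (1 + 2 * L\<^sup>2) * B0 a (z t) (z t) \<le> 2 * B0 a (z' t) (z t)"
      using E by eventually_elim blast
  qed (use t0 \<mu> in auto)
qed

theorem theorem3p2: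
  fixes T t0 q M1 C0 K :: real
    and a :: "real \<Rightarrow> real"
    and b c d :: "real \<times> real \<Rightarrow> real"
  assumes "T > 0" and "0 < t0" and "t0 < T"
    and "continuous_on {0..1} a" and "\<forall>x\<in>{0<..<1}. a x > 0" and "a 0 = 0" and "a 1 = 0"
    and "q \<ge> 1" and "M1 > 0" and "C0 > 0" and "K > 0"
    and "b \<in> Linf T" and "c \<in> Linf T" and "d \<in> Linf T"
  shows "\<exists>C>0. \<exists>\<theta>. 0 < \<theta> \<and> \<theta> < 1 \<and> (\<forall>G u ut ux uxx v vt vx vxx.
           solves T a b c d q G u ut ux uxx \<longrightarrow>
           solves T a b c d q G v vt vx vxx \<longrightarrow>
           norm_H1w a (at_time u 0) \<le> M1 \<longrightarrow>
           norm_H1w a (at_time v 0) \<le> M1 \<longrightarrow>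
           case1 T a b d C0 K ux vx \<or> case2 T a b d q C0 K ux vx \<longrightarrow>
           norm_L2w a (\<lambda>x. u (x, t0) - v (x, t0))
             \<le> C * (norm_H1w a (\<lambda>x. u (x, T) - v (x, T)) powr \<theta>
                    + norm_H1w a (\<lambda>x. u (x, T) - v (x, T))))"
proof -
  have w: "weight a" by unfold_locales (use assms(4,5) in auto)
  interpret weight a by (rule w)
  obtain Cb where Cb: "Cb \<ge> 0" "AE z in lebesgue_on (Q T). \<bar>b z\<bar> \<le> Cb" using Linf_bounded[OF \<open>b \<in> Linf T\<close>] by blast
  obtain Cc where Cc: "Cc \<ge> 0" "AE z in lebesgue_on (Q T). \<bar>c z\<bar> \<le> Cc" using Linf_bounded[OF \<open>c \<in> Linf T\<close>] by blast
  define L where "L = Cc + C0 + C0 * rpow K (q - 1) + Cb * K"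
  define \<mu> where "\<mu> = t0 * exp (- L\<^sup>2 * T) / (3 * T * exp (L\<^sup>2 * T))"
  define \<alpha> where "\<alpha> = 1 / (1 + \<mu>)"
  define \<theta> where "\<theta> = \<mu> / (1 + \<mu>)"
  \<comment> \<open>By the triangle inequality \<open>f 0\<close> is at most
    \<open>(2 * M1)\<^sup>2\<close>; this enters with the exponent \<open>\<alpha>\<close> of the
    initial time. The final constant is \<open>sqrt E\<close>, because \<open>f\<close> is a squared
    norm.\<close>
  define E where "E = exp (T * (2 + 2 * L\<^sup>2)) * ((2 * M1)\<^sup>2) powr \<alpha>"
  have "\<mu> > 0" unfolding \<mu>_def using assms by simp
  then have \<theta>: "0 < \<theta>" "\<theta> < 1" "0 < \<alpha>" by (auto simp: \<theta>_def \<alpha>_def)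
  have E: "E > 0" unfolding E_def using \<open>M1 > 0\<close> by simp
  have main: "norm_L2w a (\<lambda>x. u (x, t0) - v (x, t0))
      \<le> sqrt E * (norm_H1w a (\<lambda>x. u (x, T) - v (x, T)) powr \<theta> + norm_H1w a (\<lambda>x. u (x, T) - v (x, T)))"
    if u: "solves T a b c d q G u ut ux uxx" and v: "solves T a b c d q G v vt vx vxx"
      and M: "norm_H1w a (at_time u 0) \<le> M1" "norm_H1w a (at_time v 0) \<le> M1"
      and cs: "case1 T a b d C0 K ux vx \<or> case2 T a b d q C0 K ux vx"
    for G u ut ux uxx v vt vx vxx
  proof -
    define z where "z = (\<lambda>t x. at_time u t x - at_time v t x)"
    have zeq: "(\<lambda>x. u (x, t) - v (x, t)) = z t" for t by (simp add: z_def at_time_def)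
    have X: "at_time u t \<in> H1w a" "at_time v t \<in> H1w a" "z t \<in> H1w a" if "t \<in> {0..T}" for t
    proof -
      show uv: "at_time u t \<in> H1w a" "at_time v t \<in> H1w a"
        using solvesD(1)[OF u w \<open>T > 0\<close>] solvesD(1)[OF v w \<open>T > 0\<close>] that by (auto simp: C_time_def)
      show "z t \<in> H1w a" using H1w_lincomb[OF uv, of 1 "- 1"] by (simp add: z_def)
    qed
    have B_le: "0 \<le> B0 a (z t) (z t)" "B0 a (z t) (z t) \<le> (norm_H1w a (z t))\<^sup>2" "0 \<le> norm_H1w a (z t)"
      if "t \<in> {0..T}" for t
    proof -
      note zX = X(3)[OF that]
      show "0 \<le> B0 a (z t) (z t)" by (rule b0.B_nonneg[OF zX])
      show "0 \<le> norm_H1w a (z t)" using h.N_nonneg[OF zX] norm_H1w_N[OF zX] by simp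
      show "B0 a (z t) (z t) \<le> (norm_H1w a (z t))\<^sup>2"
        using h.N_square[OF zX] norm_H1w_N[OF zX] b1.B_nonneg[OF zX] by simp
    qed
    have 0: "0 \<in> {0..T}" and TT: "T \<in> {0..T}" using assms by auto
    interpret D: dominated_form "H1w a" "norm_H1w a" "B0 a" by (rule dominated_forms(1))
    have "norm_H1w a (z 0) \<le> norm_H1w a (at_time u 0) + norm_H1w a (at_time v 0)"
      unfolding z_def by (rule D.Nm_diff_le[OF X(1,2)[OF 0]])
    then have "norm_H1w a (z 0) \<le> 2 * M1" using M by simp
    then have "(norm_H1w a (z 0))\<^sup>2 \<le> (2 * M1)\<^sup>2" by (rule power_mono) (rule B_le(3)[OF 0])
    then have f0: "B0 a (z 0) (z 0) powr \<alpha> \<le> ((2 * M1)\<^sup>2) powr \<alpha>"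
      using B_le(1,2)[OF 0] \<theta> by (intro powr_mono2) auto
    let ?N = "norm_H1w a (z T)"
    have "B0 a (z T) (z T) powr \<theta> \<le> (?N\<^sup>2) powr \<theta>"
      using B_le(1,2)[OF TT] \<theta> by (intro powr_mono2) auto
    \<comment> \<open>Written as a square so that the root at the end leaves the exponent
      \<open>\<theta>\<close> unchanged.\<close>
    also have "\<dots> = (?N powr \<theta>)\<^sup>2"
      using B_le(3)[OF TT] by (simp add: power2_eq_square powr_mult)
    finally have fT: "B0 a (z T) (z T) powr \<theta> \<le> (?N powr \<theta>)\<^sup>2" .
    have "B0 a (z t0) (z t0) \<le> exp (T * (2 + 2 * L\<^sup>2)) * (B0 a (z 0) (z 0) powr \<alpha> * B0 a (z T) (z T) powr \<theta>)"
      unfolding \<alpha>_def \<theta>_def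
      by (rule backward_interpolation[OF w \<open>0 < t0\<close> \<open>t0 < T\<close> \<open>q \<ge> 1\<close> \<open>K > 0\<close> Cb(1) Cc(1) \<open>C0 > 0\<close>
            Cb(2) Cc(2) u v cs L_def \<mu>_def z_def])
    also have "\<dots> \<le> exp (T * (2 + 2 * L\<^sup>2)) * (((2 * M1)\<^sup>2) powr \<alpha> * (?N powr \<theta>)\<^sup>2)"
      by (intro mult_left_mono mult_mono f0 fT) auto
    also have "\<dots> = E * (?N powr \<theta>)\<^sup>2" by (simp add: E_def)
    finally have "norm_L2w a (z t0) \<le> sqrt (E * (?N powr \<theta>)\<^sup>2)"
      unfolding norm_L2w_N b0.N_def by (rule real_sqrt_le_mono)
    also have "\<dots> = sqrt E * ?N powr \<theta>" by (simp add: real_sqrt_mult)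
    also have "\<dots> \<le> sqrt E * (?N powr \<theta> + ?N)"
      using B_le(3)[OF TT] E by (intro mult_left_mono) auto
    finally show ?thesis unfolding zeq .
  qed
  show ?thesis
    by (rule exI[of _ "sqrt E"], rule conjI, use E in simp, rule exI[of _ \<theta>])
      (use \<theta> main in blast)
qed

end
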